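(* Suppose $k$ is a finite field and $R$ is a quasi-Frobenius $k$-algebra which is finite-dimensional as a $k$-vector space. Then the category of finitely generated (left) $R$-modules admits the structure of a Waldhausen category in which the cofibrations are the monomorphisms and the weak equivalences are the stable equivalences. Furthermore, this Waldhausen category satisfies the saturation and extension axioms, and it admits a cylinder functor satisfying the cylinder axiom.
   Context: A ring $R$ is quasi-Frobenius if every projective $R$-module is injective and vice versa. In the category of finitely generated left $R$-modules, for maps $f,g:M\to N$ write $f\simeq g$ if $f-g$ factors through a projective object; a map $f:M\to N$ is a stable equivalence if there is $h:N\to M$ with $f\circ h\simeq\mathrm{id}_N$ and $h\circ f\simeq \mathrm{id}_M$. **Waldhausen categories.** A Waldhausen category is a pointed category (zero object $\mathrm{pt}$) with finite pushouts, with a specified class of cofibrations and a specified class of weak equivalences, both closed under composition, such that: (Cof 1) isomorphisms are cofibrations; (Cof 2) $\mathrm{pt}\to X$ is a cofibration for every object $X$; (Cof 3) if $X\to Y$ is a morphism and $X\to Z$ a cofibration, then $Y\to Y\coprod_X Z$ is a cofibration; (Weq 1) isomorphisms are weak equivalences; (Weq 2) given a commutative diagram with rows $Y\leftarrow X\to Z$ and $Y'\leftarrow X'\to Z'$ and vertical maps from the first row to the second, with $X\to Y$ and $X'\to Y'$ cofibrations and all three vertical maps weak equivalences, the induced map $Y\coprod_X Z\to Y'\coprod_{X'}Z'$ is a weak equivalence. Saturation axiom: if $f,g$ are composable and two of $f,g,g\circ f$ are weak equivalences, so is the third. Extension axiom: given a map of cofiber sequences from $X\to Y\to Y/X$ to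 $X'\to Y'\to Y'/X'$ such that $X\to X'$ and $Y/X\to Y'/X'$ are weak equivalences, $Y\to Y'$ is a weak equivalence. **Cylinder functors.** A cylinder functor on a Waldhausen category is a functor from the category of arrows $f:X\to Y$ to the category of diagrams consisting of an object $T(f)$ and maps $j_1:X\to T(f)$, $j_2:Y\to T(f)$, $p:T(f)\to Y$ with $p\circ j_1=f$ and $p\circ j_2=\mathrm{id}_Y$, such that: (Cyl 1) given a commutative square from $f':X'\to Y'$ to $f:X\to Y$ whose vertical maps $X'\to X$, $Y'\to Y$ are weak equivalences, the map $T(f')\to T(f)$ is a weak equivalence; and if the vertical maps are cofibrations, then $T(f')\to T(f)$ and $X\coprod_{X'}T(f')\coprod_{Y'}Y\to T(f)$ are cofibrations; (Cyl 2) $T(\mathrm{pt}\to Y)=Y$, with $p$ and $j_2$ the identity of $Y$; (Cyl 3) $j_1\coprod j_2:X\coprod Y\to T(f)$ is a cofibration. It satisfies the cylinder axiom if for every map $f$ the map $p$ is a weak equivalence. *)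

theory Defs
  imports "HOL-Algebra.Module"
begin

section \<open>Categories\<close>

record ('o, 'a) category =
  Obj :: "'o set"
  Arr :: "'a set"
  Dom :: "'a \<Rightarrow> 'o"
  Cod :: "'a \<Rightarrow> 'o"
  Id :: "'o \<Rightarrow> 'a"
  Comp :: "'a \<Rightarrow> 'a \<Rightarrow> 'a"  (infixr \<open>\<cdot>\<index>\<close> 75)

definition Hom :: "('o, 'a, 'z) category_scheme \<Rightarrow> 'o \<Rightarrow> 'o \<Rightarrow> 'a set" where
  "Hom C X Y = {f \<in> Arr C. Dom C f = X \<and> Cod C f = Y}"

locale category =
  fixes C :: "('o, 'a, 'z) category_scheme" (structure)
  assumes dom_in: "f \<in> Arr C \<Longrightarrow> Dom C f \<in> Obj C"
    and cod_in: "f \<in> Arr C \<Longrightarrow> Cod C f \<in> Obj C"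
    and id_in: "X \<in> Obj C \<Longrightarrow> Id C X \<in> Hom C X X"
    and comp_in: "f \<in> Hom C X Y \<Longrightarrow> g \<in> Hom C Y Z \<Longrightarrow> g \<cdot> f \<in> Hom C X Z"
    and comp_id_right: "f \<in> Hom C X Y \<Longrightarrow> f \<cdot> Id C X = f"
    and comp_id_left: "f \<in> Hom C X Y \<Longrightarrow> Id C Y \<cdot> f = f"
    and comp_assoc: "f \<in> Hom C W X \<Longrightarrow> g \<in> Hom C X Y \<Longrightarrow> h \<in> Hom C Y Z \<Longrightarrow>
      (h \<cdot> g) \<cdot> f = h \<cdot> (g \<cdot> f)"

definition iso_arrow :: "('o, 'a, 'z) category_scheme \<Rightarrow> 'a \<Rightarrow> bool" where
  "iso_arrow C f \<longleftrightarrow> f \<in> Arr C \<and>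
     (\<exists>g \<in> Hom C (Cod C f) (Dom C f).
        g \<cdot>\<^bsub>C\<^esub> f = Id C (Dom C f) \<and> f \<cdot>\<^bsub>C\<^esub> g = Id C (Cod C f))"

definition monic :: "('o, 'a, 'z) category_scheme \<Rightarrow> 'a \<Rightarrow> bool" where
  "monic C f \<longleftrightarrow> f \<in> Arr C \<and>
     (\<forall>W \<in> Obj C. \<forall>g \<in> Hom C W (Dom C f). \<forall>h \<in> Hom C W (Dom C f).
        f \<cdot>\<^bsub>C\<^esub> g = f \<cdot>\<^bsub>C\<^esub> h \<longrightarrow> g = h)"

definition epic :: "('o, 'a, 'z) category_scheme \<Rightarrow> 'a \<Rightarrow> bool" where
  "epic C f \<longleftrightarrow> f \<in> Arr C \<and>
     (\<forall>W \<in> Obj C. \<forall>g \<in> Hom C (Cod C f) W. \<forall>h \<in> Hom C (Cod C f) W.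
        g \<cdot>\<^bsub>C\<^esub> f = h \<cdot>\<^bsub>C\<^esub> f \<longrightarrow> g = h)"

definition projective_object :: "('o, 'a, 'z) category_scheme \<Rightarrow> 'o \<Rightarrow> bool" where
  "projective_object C P \<longleftrightarrow> P \<in> Obj C \<and>
     (\<forall>e f. epic C e \<and> f \<in> Hom C P (Cod C e) \<longrightarrow>
        (\<exists>g \<in> Hom C P (Dom C e). e \<cdot>\<^bsub>C\<^esub> g = f))"

definition injective_object :: "('o, 'a, 'z) category_scheme \<Rightarrow> 'o \<Rightarrow> bool" where
  "injective_object C I \<longleftrightarrow> I \<in> Obj C \<and>
     (\<forall>m f. monic C m \<and> f \<in> Hom C (Dom C m) I \<longrightarrow>
        (\<exists>g \<in> Hom C (Cod C m) I. g \<cdot>\<^bsub>C\<^esub> m = f))"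

definition zero_object :: "('o, 'a, 'z) category_scheme \<Rightarrow> 'o \<Rightarrow> bool" where
  "zero_object C Z \<longleftrightarrow> Z \<in> Obj C \<and>
     (\<forall>X \<in> Obj C. (\<exists>!f. f \<in> Hom C Z X) \<and> (\<exists>!f. f \<in> Hom C X Z))"

text \<open>A span is a pair of arrows with a common domain.  In \<open>is_pushout C f g i j\<close> the arrows
  \<open>f : X \<rightarrow> Y\<close> and \<open>g : X \<rightarrow> Z\<close> form the span, and \<open>i : Y \<rightarrow> P\<close> and \<open>j : Z \<rightarrow> P\<close> the cocone.\<close>

definition span :: "('o, 'a, 'z) category_scheme \<Rightarrow> 'a \<Rightarrow> 'a \<Rightarrow> bool" where
  "span C f g \<longleftrightarrow> f \<in> Arr C \<and> g \<in> Arr C \<and> Dom C f = Dom C g"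

definition cocone :: "('o, 'a, 'z) category_scheme \<Rightarrow> 'a \<Rightarrow> 'a \<Rightarrow> 'a \<Rightarrow> 'a \<Rightarrow> bool" where
  "cocone C f g i j \<longleftrightarrow> i \<in> Arr C \<and> j \<in> Arr C \<and> Dom C i = Cod C f \<and> Dom C j = Cod C g \<and>
     Cod C i = Cod C j \<and> i \<cdot>\<^bsub>C\<^esub> f = j \<cdot>\<^bsub>C\<^esub> g"

definition is_pushout :: "('o, 'a, 'z) category_scheme \<Rightarrow> 'a \<Rightarrow> 'a \<Rightarrow> 'a \<Rightarrow> 'a \<Rightarrow> bool" where
  "is_pushout C f g i j \<longleftrightarrow> span C f g \<and> cocone C f g i j \<and>
     (\<forall>i' j'. cocone C f g i' j' \<longrightarrow>
        (\<exists>!u. u \<in> Hom C (Cod C i) (Cod C i') \<and> u \<cdot>\<^bsub>C\<^esub> i = i' \<and> u \<cdot>\<^bsub>C\<^esub> j = j'))"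

definition is_coproduct :: "('o, 'a, 'z) category_scheme \<Rightarrow> 'a \<Rightarrow> 'a \<Rightarrow> bool" where
  "is_coproduct C i j \<longleftrightarrow> i \<in> Arr C \<and> j \<in> Arr C \<and> Cod C i = Cod C j \<and>
     (\<forall>W \<in> Obj C. \<forall>i' \<in> Hom C (Dom C i) W. \<forall>j' \<in> Hom C (Dom C j) W.
        (\<exists>!u. u \<in> Hom C (Cod C i) W \<and> u \<cdot>\<^bsub>C\<^esub> i = i' \<and> u \<cdot>\<^bsub>C\<^esub> j = j'))"

text \<open>\<open>square C f' f a b\<close>: the arrows \<open>a\<close> (on domains) and \<open>b\<close> (on codomains) form a morphism
  \<open>f' \<rightarrow> f\<close> in the category of arrows of \<open>C\<close>.\<close>

definition square :: "('o, 'a, 'z) category_scheme \<Rightarrow> 'a \<Rightarrow> 'a \<Rightarrow> 'a \<Rightarrow> 'a \<Rightarrow> bool" where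
  "square C f' f a b \<longleftrightarrow> f' \<in> Arr C \<and> f \<in> Arr C \<and>
     a \<in> Hom C (Dom C f') (Dom C f) \<and> b \<in> Hom C (Cod C f') (Cod C f) \<and>
     f \<cdot>\<^bsub>C\<^esub> a = b \<cdot>\<^bsub>C\<^esub> f'"


section \<open>Waldhausen categories\<close>

text \<open>Pushouts are determined only up to isomorphism, so the axioms mentioning
  \<open>Y \<amalg>\<^sub>X Z\<close> are imposed for every choice of the pushout.\<close>

locale waldhausen_category = category C for C :: "('o, 'a, 'z) category_scheme" (structure) +
  fixes pt :: 'o and cof weq :: "'a set"
  assumes pt_zero: "zero_object C pt"
    and pushouts_exist: "span C f g \<Longrightarrow> \<exists>i j. is_pushout C f g i j"
    and cof_arr: "cof \<subseteq> Arr C"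
    and weq_arr: "weq \<subseteq> Arr C"
    and cof_comp: "f \<in> cof \<Longrightarrow> g \<in> cof \<Longrightarrow> Dom C g = Cod C f \<Longrightarrow> g \<cdot> f \<in> cof"
    and weq_comp: "f \<in> weq \<Longrightarrow> g \<in> weq \<Longrightarrow> Dom C g = Cod C f \<Longrightarrow> g \<cdot> f \<in> weq"
    and cof_1: "iso_arrow C f \<Longrightarrow> f \<in> cof"
    and cof_2: "X \<in> Obj C \<Longrightarrow> f \<in> Hom C pt X \<Longrightarrow> f \<in> cof"
    and cof_3: "is_pushout C f g i j \<Longrightarrow> g \<in> cof \<Longrightarrow> i \<in> cof"
    and weq_1: "iso_arrow C f \<Longrightarrow> f \<in> weq"
    and weq_2: "is_pushout C f g i j \<Longrightarrow> is_pushout C f' g' i' j' \<Longrightarrow> f \<in> cof \<Longrightarrow> f' \<in> cof \<Longrightarrow>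
      square C f f' x y \<Longrightarrow> square C g g' x z \<Longrightarrow> x \<in> weq \<Longrightarrow> y \<in> weq \<Longrightarrow> z \<in> weq \<Longrightarrow>
      u \<in> Hom C (Cod C i) (Cod C i') \<Longrightarrow> u \<cdot> i = i' \<cdot> y \<Longrightarrow> u \<cdot> j = j' \<cdot> z \<Longrightarrow> u \<in> weq"

definition saturation_axiom :: "('o, 'a, 'z) category_scheme \<Rightarrow> 'a set \<Rightarrow> bool" where
  "saturation_axiom C weq \<longleftrightarrow>
     (\<forall>f \<in> Arr C. \<forall>g \<in> Arr C. Dom C g = Cod C f \<longrightarrow>
        (f \<in> weq \<and> g \<in> weq \<longrightarrow> g \<cdot>\<^bsub>C\<^esub> f \<in> weq) \<and>
        (f \<in> weq \<and> g \<cdot>\<^bsub>C\<^esub> f \<in> weq \<longrightarrow> g \<in> weq) \<and>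
        (g \<in> weq \<and> g \<cdot>\<^bsub>C\<^esub> f \<in> weq \<longrightarrow> f \<in> weq))"

text \<open>\<open>cofiber_sequence C pt cof f q\<close>: the arrow \<open>f : X \<rightarrow> Y\<close> is a cofibration and
  \<open>q : Y \<rightarrow> Y/X\<close> is the pushout of \<open>X \<rightarrow> pt\<close> along \<open>f\<close>.\<close>

definition cofiber_sequence ::
  "('o, 'a, 'z) category_scheme \<Rightarrow> 'o \<Rightarrow> 'a set \<Rightarrow> 'a \<Rightarrow> 'a \<Rightarrow> bool" where
  "cofiber_sequence C pt cof f q \<longleftrightarrow> f \<in> cof \<and>
     (\<exists>t \<in> Hom C (Dom C f) pt. \<exists>z. is_pushout C f t q z)"

definition extension_axiom :: "('o, 'a, 'z) category_scheme \<Rightarrow> 'o \<Rightarrow> 'a set \<Rightarrow> 'a set \<Rightarrow> bool" where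
  "extension_axiom C pt cof weq \<longleftrightarrow>
     (\<forall>f q f' q' x y z.
        cofiber_sequence C pt cof f q \<and> cofiber_sequence C pt cof f' q' \<and>
        square C f f' x y \<and> square C q q' y z \<and> x \<in> weq \<and> z \<in> weq \<longrightarrow> y \<in> weq)"


section \<open>Cylinder functors\<close>

text \<open>For an arrow \<open>f : X \<rightarrow> Y\<close>, the object \<open>T(f)\<close> is \<open>Cyl T f\<close>; for a morphism of arrows
  \<open>(a, b) : f' \<rightarrow> f\<close>, the induced map \<open>T(f') \<rightarrow> T(f)\<close> is \<open>Cyl_map T f' f a b\<close>.\<close>

record ('o, 'a) cylinder =
  Cyl :: "'a \<Rightarrow> 'o"
  j1 :: "'a \<Rightarrow> 'a"
  j2 :: "'a \<Rightarrow> 'a"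
  pr :: "'a \<Rightarrow> 'a"
  Cyl_map :: "'a \<Rightarrow> 'a \<Rightarrow> 'a \<Rightarrow> 'a \<Rightarrow> 'a"

text \<open>In \<open>cyl_1_cof_pushout\<close>, \<open>X \<amalg>\<^bsub>X'\<^esub> T(f') \<amalg>\<^bsub>Y'\<^esub> Y\<close> is formed as an iterated pushout: first
  \<open>i : X \<rightarrow> P\<close> and \<open>k : T(f') \<rightarrow> P\<close>, and then \<open>l : P \<rightarrow> Q\<close> and \<open>m : Y \<rightarrow> Q\<close>.\<close>

locale cylinder_functor = waldhausen_category C pt cof weq
  for C :: "('o, 'a, 'z) category_scheme" (structure) and pt cof weq +
  fixes T :: "('o, 'a) cylinder"
  assumes cyl_obj: "f \<in> Arr C \<Longrightarrow> Cyl T f \<in> Obj C"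
    and j1_in: "f \<in> Arr C \<Longrightarrow> j1 T f \<in> Hom C (Dom C f) (Cyl T f)"
    and j2_in: "f \<in> Arr C \<Longrightarrow> j2 T f \<in> Hom C (Cod C f) (Cyl T f)"
    and pr_in: "f \<in> Arr C \<Longrightarrow> pr T f \<in> Hom C (Cyl T f) (Cod C f)"
    and pr_j1: "f \<in> Arr C \<Longrightarrow> pr T f \<cdot> j1 T f = f"
    and pr_j2: "f \<in> Arr C \<Longrightarrow> pr T f \<cdot> j2 T f = Id C (Cod C f)"
    and map_in: "square C f' f a b \<Longrightarrow> Cyl_map T f' f a b \<in> Hom C (Cyl T f') (Cyl T f)"
    and map_j1: "square C f' f a b \<Longrightarrow> Cyl_map T f' f a b \<cdot> j1 T f' = j1 T f \<cdot> a"
    and map_j2: "square C f' f a b \<Longrightarrow> Cyl_map T f' f a b \<cdot> j2 T f' = j2 T f \<cdot> b"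
    and map_pr: "square C f' f a b \<Longrightarrow> pr T f \<cdot> Cyl_map T f' f a b = b \<cdot> pr T f'"
    and map_id: "f \<in> Arr C \<Longrightarrow>
      Cyl_map T f f (Id C (Dom C f)) (Id C (Cod C f)) = Id C (Cyl T f)"
    and map_comp: "square C f'' f' a' b' \<Longrightarrow> square C f' f a b \<Longrightarrow>
      Cyl_map T f'' f (a \<cdot> a') (b \<cdot> b') = Cyl_map T f' f a b \<cdot> Cyl_map T f'' f' a' b'"
    and cyl_1_weq: "square C f' f a b \<Longrightarrow> a \<in> weq \<Longrightarrow> b \<in> weq \<Longrightarrow> Cyl_map T f' f a b \<in> weq"
    and cyl_1_cof: "square C f' f a b \<Longrightarrow> a \<in> cof \<Longrightarrow> b \<in> cof \<Longrightarrow> Cyl_map T f' f a b \<in> cof"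
    and cyl_1_cof_pushout: "square C f' f a b \<Longrightarrow> a \<in> cof \<Longrightarrow> b \<in> cof \<Longrightarrow>
      is_pushout C a (j1 T f') i k \<Longrightarrow> is_pushout C (k \<cdot> j2 T f') b l m \<Longrightarrow>
      u \<in> Hom C (Cod C l) (Cyl T f) \<Longrightarrow>
      u \<cdot> (l \<cdot> i) = j1 T f \<Longrightarrow> u \<cdot> (l \<cdot> k) = Cyl_map T f' f a b \<Longrightarrow> u \<cdot> m = j2 T f \<Longrightarrow>
      u \<in> cof"
    and cyl_2: "Y \<in> Obj C \<Longrightarrow> f \<in> Hom C pt Y \<Longrightarrow>
      Cyl T f = Y \<and> pr T f = Id C Y \<and> j2 T f = Id C Y"
    and cyl_3: "f \<in> Arr C \<Longrightarrow> is_coproduct C i j \<Longrightarrow> Dom C i = Dom C f \<Longrightarrow> Dom C j = Cod C f \<Longrightarrow>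
      u \<in> Hom C (Cod C i) (Cyl T f) \<Longrightarrow> u \<cdot> i = j1 T f \<Longrightarrow> u \<cdot> j = j2 T f \<Longrightarrow> u \<in> cof"

definition cylinder_axiom ::
  "('o, 'a, 'z) category_scheme \<Rightarrow> 'a set \<Rightarrow> ('o, 'a) cylinder \<Rightarrow> bool" where
  "cylinder_axiom C weq T \<longleftrightarrow> (\<forall>f \<in> Arr C. pr T f \<in> weq)"


section \<open>Modules over a noncommutative ring\<close>

text \<open>The locale \<open>module\<close> of HOL-Algebra assumes a commutative base ring.  As there, the
  multiplicative fields that the record type of modules inherits from rings carry no meaning for
  a module.\<close>

locale left_module = R?: ring R + M?: abelian_group M
  for R :: "('r, 'b) ring_scheme" and M :: "('r, 'm, 'c) module_scheme" (structure) +
  assumes lsmult_closed: "a \<in> carrier R \<Longrightarrow> x \<in> carrier M \<Longrightarrow> a \<odot>\<^bsub>M\<^esub> x \<in> carrier M"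
    and lsmult_l_distr: "a \<in> carrier R \<Longrightarrow> b \<in> carrier R \<Longrightarrow> x \<in> carrier M \<Longrightarrow>
      (a \<oplus>\<^bsub>R\<^esub> b) \<odot>\<^bsub>M\<^esub> x = a \<odot>\<^bsub>M\<^esub> x \<oplus>\<^bsub>M\<^esub> b \<odot>\<^bsub>M\<^esub> x"
    and lsmult_r_distr: "a \<in> carrier R \<Longrightarrow> x \<in> carrier M \<Longrightarrow> y \<in> carrier M \<Longrightarrow>
      a \<odot>\<^bsub>M\<^esub> (x \<oplus>\<^bsub>M\<^esub> y) = a \<odot>\<^bsub>M\<^esub> x \<oplus>\<^bsub>M\<^esub> a \<odot>\<^bsub>M\<^esub> y"
    and lsmult_assoc: "a \<in> carrier R \<Longrightarrow> b \<in> carrier R \<Longrightarrow> x \<in> carrier M \<Longrightarrow>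
      (a \<otimes>\<^bsub>R\<^esub> b) \<odot>\<^bsub>M\<^esub> x = a \<odot>\<^bsub>M\<^esub> (b \<odot>\<^bsub>M\<^esub> x)"
    and lsmult_one: "x \<in> carrier M \<Longrightarrow> \<one>\<^bsub>R\<^esub> \<odot>\<^bsub>M\<^esub> x = x"

definition finitely_generated ::
  "('r, 'b) ring_scheme \<Rightarrow> ('r, 'm, 'c) module_scheme \<Rightarrow> bool" where
  "finitely_generated R M \<longleftrightarrow>
     (\<exists>S. finite S \<and> S \<subseteq> carrier M \<and>
        (\<forall>x \<in> carrier M. \<exists>c \<in> S \<rightarrow> carrier R. x = (\<Oplus>\<^bsub>M\<^esub>s\<in>S. c s \<odot>\<^bsub>M\<^esub> s)))"

text \<open>The locale \<open>algebra\<close> of HOL-Algebra assumes that the algebra itself is commutative.\<close>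

locale associative_algebra = module K R + R?: ring R
  for K :: "('k, 'b) ring_scheme" and R :: "('k, 'r, 'c) module_scheme" (structure) +
  assumes smult_mult_left: "a \<in> carrier K \<Longrightarrow> x \<in> carrier R \<Longrightarrow> y \<in> carrier R \<Longrightarrow>
      (a \<odot> x) \<otimes> y = a \<odot> (x \<otimes> y)"
    and smult_mult_right: "a \<in> carrier K \<Longrightarrow> x \<in> carrier R \<Longrightarrow> y \<in> carrier R \<Longrightarrow>
      x \<otimes> (a \<odot> y) = a \<odot> (x \<otimes> y)"


section \<open>Categories of modules\<close>

text \<open>Module homomorphisms are extensional (\<open>undefined\<close> off the carrier), so that equal
  homomorphisms are equal as functions.\<close>

definition lmodule_hom :: "('r, 'b) ring_scheme \<Rightarrow> ('r, 'm) module \<Rightarrow> ('r, 'm) module \<Rightarrow>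
    ('m \<Rightarrow> 'm) set" where
  "lmodule_hom R M N = {f \<in> carrier M \<rightarrow>\<^sub>E carrier N.
     (\<forall>x \<in> carrier M. \<forall>y \<in> carrier M. f (x \<oplus>\<^bsub>M\<^esub> y) = f x \<oplus>\<^bsub>N\<^esub> f y) \<and>
     (\<forall>a \<in> carrier R. \<forall>x \<in> carrier M. f (a \<odot>\<^bsub>M\<^esub> x) = a \<odot>\<^bsub>N\<^esub> f x)}"

type_synonym ('r, 'm) module_arrow = "('r, 'm) module \<times> ('r, 'm) module \<times> ('m \<Rightarrow> 'm)"

type_synonym ('r, 'm) module_category = "(('r, 'm) module, ('r, 'm) module_arrow) category"

text \<open>The category of those left \<open>R\<close>-modules that belong to \<open>A\<close>.\<close>

definition module_category_on ::
  "('r, 'b) ring_scheme \<Rightarrow> ('r, 'm) module set \<Rightarrow> ('r, 'm) module_category" where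
  "module_category_on R A =
     \<lparr> Obj = {M \<in> A. left_module R M},
       Arr = {(M, N, f). M \<in> A \<and> left_module R M \<and> N \<in> A \<and> left_module R N \<and>
                         f \<in> lmodule_hom R M N},
       Dom = (\<lambda>(M, N, f). M),
       Cod = (\<lambda>(M, N, f). N),
       Id = (\<lambda>M. (M, M, \<lambda>x\<in>carrier M. x)),
       Comp = (\<lambda>(N', P, g) (M, N, f). (M, P, compose (carrier M) g f)) \<rparr>"

text \<open>The type \<open>'m\<close>, in which the carriers of the modules lie, plays the role of a universe.\<close>

definition modules :: "('r, 'b) ring_scheme \<Rightarrow> ('r, 'm) module_category" where
  "modules R = module_category_on R UNIV"

definition fg_modules :: "('r, 'b) ring_scheme \<Rightarrow> ('r, 'm) module_category" where
  "fg_modules R = module_category_on R {M. finitely_generated R M}"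

text \<open>Projectivity and injectivity are understood in the category of left \<open>R\<close>-modules with
  carriers in \<open>'m\<close>.  For a finite ring \<open>R\<close> and an infinite type \<open>'m\<close> this involves no loss: a
  free module on the elements of a module in the universe is isomorphic to a module in the
  universe, so projective means being a direct summand of a free module, and the left ideals of
  \<open>R\<close> are isomorphic to modules in the universe, so injectivity can be tested on them by Baer's
  criterion.\<close>

definition quasi_frobenius :: "'m itself \<Rightarrow> ('r, 'b) ring_scheme \<Rightarrow> bool" where
  "quasi_frobenius _ R \<longleftrightarrow> ring R \<and>
     (\<forall>M :: ('r, 'm) module.
        projective_object (modules R) M \<longleftrightarrow> injective_object (modules R) M)"

definition arrow_diff ::
  "('r, 'm) module_arrow \<Rightarrow> ('r, 'm) module_arrow \<Rightarrow> ('r, 'm) module_arrow" where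
  "arrow_diff = (\<lambda>(M, N, f) (M', N', g). (M, N, \<lambda>x\<in>carrier M. f x \<ominus>\<^bsub>N\<^esub> g x))"

definition factors_through :: "('o, 'a, 'z) category_scheme \<Rightarrow> 'a \<Rightarrow> 'o \<Rightarrow> bool" where
  "factors_through C f P \<longleftrightarrow>
     (\<exists>g \<in> Hom C (Dom C f) P. \<exists>h \<in> Hom C P (Cod C f). f = h \<cdot>\<^bsub>C\<^esub> g)"

text \<open>The relation \<open>f \<simeq> g\<close> on parallel arrows of \<open>fg_modules R\<close>.\<close>

definition stably_equal ::
  "('r, 'b) ring_scheme \<Rightarrow> ('r, 'm) module_arrow \<Rightarrow> ('r, 'm) module_arrow \<Rightarrow> bool" where
  "stably_equal R f g \<longleftrightarrow>
     (\<exists>P. projective_object (fg_modules R) P \<and>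
          factors_through (fg_modules R) (arrow_diff f g) P)"

definition stable_equivalence :: "('r, 'b) ring_scheme \<Rightarrow> ('r, 'm) module_arrow \<Rightarrow> bool" where
  "stable_equivalence R f \<longleftrightarrow>
     (let C = fg_modules R; M = Dom C f; N = Cod C f
      in f \<in> Arr C \<and>
         (\<exists>h \<in> Hom C N M. stably_equal R (f \<cdot>\<^bsub>C\<^esub> h) (Id C N) \<and> stably_equal R (h \<cdot>\<^bsub>C\<^esub> f) (Id C M)))"

end

theory Submission
  imports Defs
begin

text \<open>Let \<open>F = k \<cdot> 1\<close>, and let \<open>I(M) = Hom\<^sub>F(R, M)\<close> be the coinduced module, in which \<open>M\<close> embeds by
  \<open>\<eta>(x) = (r \<mapsto> r x)\<close>.  Subspaces of vector spaces have complements; hence \<open>I\<close> is an exact functor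
  with injective values (\<open>coind_injective\<close>, \<open>cmap_surj\<close>), and these values are also projective, \<open>R\<close>
  being quasi-Frobenius.  A map of finitely generated modules factors through a projective module iff
  it extends along \<open>\<eta>\<close>.  Such null maps form an ideal that is closed under sums, from which
  saturation follows formally; they extend along monomorphisms.

  The main point is a criterion for stable equivalences: \<open>f : M \<rightarrow> N\<close> is one iff its mapping cone, the
  cokernel of \<open>(f, \<eta>) : M \<rightarrow> N \<oplus> I(M)\<close>, is injective (\<open>stable_eqv_iff_cone_inj_mod\<close>).  Indeed, a
  monomorphism with injective cokernel splits, because the cokernel is projective, and its complement
  is stably zero.  Conversely, a stable retraction of a monomorphism can be corrected to a strict one,
  and the complement is then stably zero, hence injective.

  Because \<open>I\<close> is exact, a map of short exact sequences gives a short exact sequence of mapping cones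
  (\<open>ses_cokernels\<close>).  If the first module of a short exact sequence is injective, the second is
  injective iff the third is (\<open>ses_inj_mod\<close>).  So if the first vertical map is a stable equivalence,
  the second is one iff the third is (\<open>ses_stable_eqv\<close>).  One direction is the extension axiom.  The
  other, applied to \<open>X \<rightarrow> Y \<oplus> Z \<rightarrow> Y \<amalg>\<^sub>X Z\<close>, is the axiom on pushouts and weak equivalences.

  The cylinder of \<open>f : X \<rightarrow> Y\<close> is \<open>T(f) = Y \<oplus> I(X)\<close>, with \<open>j\<^sub>1 = (f, \<eta>)\<close>, the inclusion \<open>j\<^sub>2\<close> of \<open>Y\<close>
  and the projection \<open>p\<close> to \<open>Y\<close>; the map \<open>p\<close> is a stable equivalence because \<open>I(X)\<close> is projective.

  As \<open>R\<close> is finite, the finitely generated modules are the finite ones.  Whatever module is built from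
  them by finitely many direct sums, quotients and applications of \<open>I\<close> is finite again, and can be
  transported to a module with carrier in the infinite type \<open>'m\<close>.\<close>

section \<open>Left modules and linear maps\<close>

lemma (in left_module) lsmult_zero_right:
  assumes "a \<in> carrier R" shows "a \<odot> \<zero> = \<zero>"
proof -
  have "a \<odot> \<zero> \<oplus> a \<odot> \<zero> = a \<odot> \<zero> \<oplus> \<zero>"
    using lsmult_r_distr[OF assms, of \<zero> \<zero>] assms by (simp add: lsmult_closed)
  with assms show ?thesis by (metis M.r_neg1 M.zero_closed lsmult_closed)
qed

lemma (in left_module) lsmult_zero_left:
  assumes "x \<in> carrier M" shows "\<zero>\<^bsub>R\<^esub> \<odot> x = \<zero>"
proof -
  have "\<zero>\<^bsub>R\<^esub> \<odot> x \<oplus> \<zero>\<^bsub>R\<^esub> \<odot> x = \<zero>\<^bsub>R\<^esub> \<odot> x \<oplus> \<zero>"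
    using lsmult_l_distr[of "\<zero>\<^bsub>R\<^esub>" "\<zero>\<^bsub>R\<^esub>" x] assms by (simp add: lsmult_closed)
  with assms show ?thesis by (metis M.r_neg1 M.zero_closed R.zero_closed lsmult_closed)
qed

lemma (in left_module) lsmult_minus_right:
  assumes "a \<in> carrier R" "x \<in> carrier M" shows "a \<odot> (\<ominus> x) = \<ominus> (a \<odot> x)"
proof -
  have "a \<odot> (\<ominus> x) \<oplus> a \<odot> x = \<zero>"
    using assms lsmult_r_distr[of a "\<ominus> x" x] by (simp add: lsmult_zero_right M.l_neg)
  with assms show ?thesis by (metis M.minus_equality M.a_inv_closed lsmult_closed)
qed

text \<open>A division subring \<open>F\<close> of \<open>R\<close>; for an algebra over a field \<open>k\<close> this is \<open>k \<cdot> 1\<close>.  The zero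
  ring with \<open>F = {0}\<close> is included: a finite-dimensional algebra may be zero, and then
  \<open>k \<rightarrow> k \<cdot> 1\<close> is not injective.\<close>

locale ring_over_division_subring = ring R for R :: "('r, 'b) ring_scheme" +
  fixes F :: "'r set"
  assumes F_sub: "F \<subseteq> carrier R"
    and F_one: "\<one>\<^bsub>R\<^esub> \<in> F"
    and F_mult: "c \<in> F \<Longrightarrow> d \<in> F \<Longrightarrow> c \<otimes>\<^bsub>R\<^esub> d \<in> F"
    and F_add: "c \<in> F \<Longrightarrow> d \<in> F \<Longrightarrow> c \<oplus>\<^bsub>R\<^esub> d \<in> F"
    and F_neg: "c \<in> F \<Longrightarrow> \<ominus>\<^bsub>R\<^esub> c \<in> F"
    and F_inv: "c \<in> F \<Longrightarrow> c \<noteq> \<zero>\<^bsub>R\<^esub> \<Longrightarrow> \<exists>d \<in> F. d \<otimes>\<^bsub>R\<^esub> c = \<one>\<^bsub>R\<^esub>"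
begin

abbreviation lmod :: "('r, 'x) module \<Rightarrow> bool" where "lmod M \<equiv> left_module R M"

text \<open>In contrast to the arrows of a module category, linear maps may connect modules whose carriers
  lie in different types, and they are not restricted off the carrier.  Auxiliary modules such as
  direct sums, coinduced modules and cones can then be used as they are; only the modules that have
  to be objects of the category are moved to the type of its modules.\<close>

definition lin :: "('r, 'x) module \<Rightarrow> ('r, 'y) module \<Rightarrow> ('x \<Rightarrow> 'y) \<Rightarrow> bool" where
  "lin M N f \<longleftrightarrow> lmod M \<and> lmod N \<and> f ` carrier M \<subseteq> carrier N \<and>
     (\<forall>x \<in> carrier M. \<forall>y \<in> carrier M. f (x \<oplus>\<^bsub>M\<^esub> y) = f x \<oplus>\<^bsub>N\<^esub> f y) \<and>
     (\<forall>a \<in> carrier R. \<forall>x \<in> carrier M. f (a \<odot>\<^bsub>M\<^esub> x) = a \<odot>\<^bsub>N\<^esub> f x)"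

context
  fixes M :: "('r, 'x) module"
  assumes M: "lmod M"
begin

interpretation M: left_module R M by (rule M)

lemma lmod_abelian_group: "abelian_group M" by unfold_locales

lemma lmod_add_closed: "x \<in> carrier M \<Longrightarrow> y \<in> carrier M \<Longrightarrow> x \<oplus>\<^bsub>M\<^esub> y \<in> carrier M"
  and lmod_zero_closed: "\<zero>\<^bsub>M\<^esub> \<in> carrier M"
  and lmod_neg_closed: "x \<in> carrier M \<Longrightarrow> \<ominus>\<^bsub>M\<^esub> x \<in> carrier M"
  and lmod_smult_closed: "a \<in> carrier R \<Longrightarrow> x \<in> carrier M \<Longrightarrow> a \<odot>\<^bsub>M\<^esub> x \<in> carrier M"
  by (simp_all add: M.lsmult_closed)

lemma lmod_assoc: "x \<in> carrier M \<Longrightarrow> y \<in> carrier M \<Longrightarrow> z \<in> carrier M \<Longrightarrow>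
    x \<oplus>\<^bsub>M\<^esub> y \<oplus>\<^bsub>M\<^esub> z = x \<oplus>\<^bsub>M\<^esub> (y \<oplus>\<^bsub>M\<^esub> z)"
  and lmod_comm: "x \<in> carrier M \<Longrightarrow> y \<in> carrier M \<Longrightarrow> x \<oplus>\<^bsub>M\<^esub> y = y \<oplus>\<^bsub>M\<^esub> x"
  and lmod_lcomm: "x \<in> carrier M \<Longrightarrow> y \<in> carrier M \<Longrightarrow> z \<in> carrier M \<Longrightarrow>
    x \<oplus>\<^bsub>M\<^esub> (y \<oplus>\<^bsub>M\<^esub> z) = y \<oplus>\<^bsub>M\<^esub> (x \<oplus>\<^bsub>M\<^esub> z)"
  by (fact M.M.a_assoc M.M.a_comm M.M.a_lcomm)+

lemma lmod_l_zero: "x \<in> carrier M \<Longrightarrow> \<zero>\<^bsub>M\<^esub> \<oplus>\<^bsub>M\<^esub> x = x"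
  and lmod_r_zero: "x \<in> carrier M \<Longrightarrow> x \<oplus>\<^bsub>M\<^esub> \<zero>\<^bsub>M\<^esub> = x"
  and lmod_l_neg: "x \<in> carrier M \<Longrightarrow> \<ominus>\<^bsub>M\<^esub> x \<oplus>\<^bsub>M\<^esub> x = \<zero>\<^bsub>M\<^esub>"
  and lmod_r_neg: "x \<in> carrier M \<Longrightarrow> x \<oplus>\<^bsub>M\<^esub> \<ominus>\<^bsub>M\<^esub> x = \<zero>\<^bsub>M\<^esub>"
  and lmod_r_neg1: "x \<in> carrier M \<Longrightarrow> y \<in> carrier M \<Longrightarrow> \<ominus>\<^bsub>M\<^esub> x \<oplus>\<^bsub>M\<^esub> (x \<oplus>\<^bsub>M\<^esub> y) = y"
  and lmod_r_neg2: "x \<in> carrier M \<Longrightarrow> y \<in> carrier M \<Longrightarrow> x \<oplus>\<^bsub>M\<^esub> (\<ominus>\<^bsub>M\<^esub> x \<oplus>\<^bsub>M\<^esub> y) = y"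
  and lmod_minus_minus: "x \<in> carrier M \<Longrightarrow> \<ominus>\<^bsub>M\<^esub> (\<ominus>\<^bsub>M\<^esub> x) = x"
  and lmod_minus_zero: "\<ominus>\<^bsub>M\<^esub> \<zero>\<^bsub>M\<^esub> = \<zero>\<^bsub>M\<^esub>"
  by (simp_all add: M.M.l_neg M.M.r_neg M.M.r_neg1 M.M.r_neg2)

lemma lmod_minus_add: "x \<in> carrier M \<Longrightarrow> y \<in> carrier M \<Longrightarrow>
    \<ominus>\<^bsub>M\<^esub> (x \<oplus>\<^bsub>M\<^esub> y) = \<ominus>\<^bsub>M\<^esub> x \<oplus>\<^bsub>M\<^esub> \<ominus>\<^bsub>M\<^esub> y"
  by (rule M.M.minus_add)

lemma lmod_eq_neg_iff: "x \<in> carrier M \<Longrightarrow> y \<in> carrier M \<Longrightarrow>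
    x \<oplus>\<^bsub>M\<^esub> y = \<zero>\<^bsub>M\<^esub> \<longleftrightarrow> x = \<ominus>\<^bsub>M\<^esub> y"
  by (metis M.M.minus_equality M.M.minus_minus M.M.l_neg)

lemma lmod_l_cancel: "x \<in> carrier M \<Longrightarrow> y \<in> carrier M \<Longrightarrow> z \<in> carrier M \<Longrightarrow>
    x \<oplus>\<^bsub>M\<^esub> y = x \<oplus>\<^bsub>M\<^esub> z \<longleftrightarrow> y = z"
  by simp

lemma lmod_smult_l_distr: "a \<in> carrier R \<Longrightarrow> b \<in> carrier R \<Longrightarrow> x \<in> carrier M \<Longrightarrow>
      (a \<oplus>\<^bsub>R\<^esub> b) \<odot>\<^bsub>M\<^esub> x = a \<odot>\<^bsub>M\<^esub> x \<oplus>\<^bsub>M\<^esub> b \<odot>\<^bsub>M\<^esub> x"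
    and lmod_smult_r_distr: "a \<in> carrier R \<Longrightarrow> x \<in> carrier M \<Longrightarrow> y \<in> carrier M \<Longrightarrow>
      a \<odot>\<^bsub>M\<^esub> (x \<oplus>\<^bsub>M\<^esub> y) = a \<odot>\<^bsub>M\<^esub> x \<oplus>\<^bsub>M\<^esub> a \<odot>\<^bsub>M\<^esub> y"
    and lmod_smult_assoc: "a \<in> carrier R \<Longrightarrow> b \<in> carrier R \<Longrightarrow> x \<in> carrier M \<Longrightarrow>
      (a \<otimes>\<^bsub>R\<^esub> b) \<odot>\<^bsub>M\<^esub> x = a \<odot>\<^bsub>M\<^esub> (b \<odot>\<^bsub>M\<^esub> x)"
    and lmod_smult_one: "x \<in> carrier M \<Longrightarrow> \<one>\<^bsub>R\<^esub> \<odot>\<^bsub>M\<^esub> x = x"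
    and lmod_smult_zero: "a \<in> carrier R \<Longrightarrow> a \<odot>\<^bsub>M\<^esub> \<zero>\<^bsub>M\<^esub> = \<zero>\<^bsub>M\<^esub>"
    and lmod_zero_smult: "x \<in> carrier M \<Longrightarrow> \<zero>\<^bsub>R\<^esub> \<odot>\<^bsub>M\<^esub> x = \<zero>\<^bsub>M\<^esub>"
    and lmod_smult_minus: "a \<in> carrier R \<Longrightarrow> x \<in> carrier M \<Longrightarrow> a \<odot>\<^bsub>M\<^esub> (\<ominus>\<^bsub>M\<^esub> x) = \<ominus>\<^bsub>M\<^esub> (a \<odot>\<^bsub>M\<^esub> x)"
  by (fact M.lsmult_l_distr M.lsmult_r_distr M.lsmult_assoc M.lsmult_one M.lsmult_zero_right
      M.lsmult_zero_left M.lsmult_minus_right)+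

end

lemmas lmod_simps [simp] =
  lmod_add_closed lmod_zero_closed lmod_neg_closed lmod_smult_closed
  lmod_l_zero lmod_r_zero lmod_l_neg lmod_r_neg lmod_r_neg1 lmod_r_neg2
  lmod_minus_minus lmod_minus_zero lmod_l_cancel
  lmod_smult_one lmod_smult_zero lmod_zero_smult

lemma lmod_cancel_mid [simp]:
  assumes "lmod M" "x \<in> carrier M" "y \<in> carrier M"
  shows "x \<oplus>\<^bsub>M\<^esub> (y \<oplus>\<^bsub>M\<^esub> \<ominus>\<^bsub>M\<^esub> x) = y" "\<ominus>\<^bsub>M\<^esub> x \<oplus>\<^bsub>M\<^esub> (y \<oplus>\<^bsub>M\<^esub> x) = y"
  using assms by (simp_all add: lmod_comm[of M y])

lemmas lmod_ac = lmod_assoc lmod_comm lmod_lcomm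
lemmas lmod_distr = lmod_smult_r_distr lmod_smult_l_distr lmod_smult_minus lmod_minus_add

lemma lmodI:
  assumes add: "\<And>x y. x \<in> carrier M \<Longrightarrow> y \<in> carrier M \<Longrightarrow> x \<oplus>\<^bsub>M\<^esub> y \<in> carrier M"
    and zero: "\<zero>\<^bsub>M\<^esub> \<in> carrier M"
    and smult: "\<And>a x. a \<in> carrier R \<Longrightarrow> x \<in> carrier M \<Longrightarrow> a \<odot>\<^bsub>M\<^esub> x \<in> carrier M"
    and assoc: "\<And>x y z. x \<in> carrier M \<Longrightarrow> y \<in> carrier M \<Longrightarrow> z \<in> carrier M \<Longrightarrow>
      x \<oplus>\<^bsub>M\<^esub> y \<oplus>\<^bsub>M\<^esub> z = x \<oplus>\<^bsub>M\<^esub> (y \<oplus>\<^bsub>M\<^esub> z)"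
    and comm: "\<And>x y. x \<in> carrier M \<Longrightarrow> y \<in> carrier M \<Longrightarrow> x \<oplus>\<^bsub>M\<^esub> y = y \<oplus>\<^bsub>M\<^esub> x"
    and l_zero: "\<And>x. x \<in> carrier M \<Longrightarrow> \<zero>\<^bsub>M\<^esub> \<oplus>\<^bsub>M\<^esub> x = x"
    and l_neg: "\<And>x. x \<in> carrier M \<Longrightarrow> \<exists>y \<in> carrier M. y \<oplus>\<^bsub>M\<^esub> x = \<zero>\<^bsub>M\<^esub>"
    and "\<And>a b x. a \<in> carrier R \<Longrightarrow> b \<in> carrier R \<Longrightarrow> x \<in> carrier M \<Longrightarrow>
      (a \<oplus>\<^bsub>R\<^esub> b) \<odot>\<^bsub>M\<^esub> x = a \<odot>\<^bsub>M\<^esub> x \<oplus>\<^bsub>M\<^esub> b \<odot>\<^bsub>M\<^esub> x"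
    and "\<And>a x y. a \<in> carrier R \<Longrightarrow> x \<in> carrier M \<Longrightarrow> y \<in> carrier M \<Longrightarrow>
      a \<odot>\<^bsub>M\<^esub> (x \<oplus>\<^bsub>M\<^esub> y) = a \<odot>\<^bsub>M\<^esub> x \<oplus>\<^bsub>M\<^esub> a \<odot>\<^bsub>M\<^esub> y"
    and "\<And>a b x. a \<in> carrier R \<Longrightarrow> b \<in> carrier R \<Longrightarrow> x \<in> carrier M \<Longrightarrow>
      (a \<otimes>\<^bsub>R\<^esub> b) \<odot>\<^bsub>M\<^esub> x = a \<odot>\<^bsub>M\<^esub> (b \<odot>\<^bsub>M\<^esub> x)"
    and "\<And>x. x \<in> carrier M \<Longrightarrow> \<one>\<^bsub>R\<^esub> \<odot>\<^bsub>M\<^esub> x = x"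
  shows "lmod M"
proof -
  interpret abelian_group M
    by (rule abelian_groupI) (use assms in auto)
  show ?thesis
    by unfold_locales (use assms in auto)
qed

lemma linI:
  assumes "lmod M" "lmod N" "\<And>x. x \<in> carrier M \<Longrightarrow> f x \<in> carrier N"
    and "\<And>x y. x \<in> carrier M \<Longrightarrow> y \<in> carrier M \<Longrightarrow> f (x \<oplus>\<^bsub>M\<^esub> y) = f x \<oplus>\<^bsub>N\<^esub> f y"
    and "\<And>a x. a \<in> carrier R \<Longrightarrow> x \<in> carrier M \<Longrightarrow> f (a \<odot>\<^bsub>M\<^esub> x) = a \<odot>\<^bsub>N\<^esub> f x"
  shows "lin M N f"
  using assms unfolding lin_def by blast

lemma lin_dom: "lin M N f \<Longrightarrow> lmod M"
  and lin_cod: "lin M N f \<Longrightarrow> lmod N"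
  and lin_in [simp]: "lin M N f \<Longrightarrow> x \<in> carrier M \<Longrightarrow> f x \<in> carrier N"
  and lin_add: "lin M N f \<Longrightarrow> x \<in> carrier M \<Longrightarrow> y \<in> carrier M \<Longrightarrow> f (x \<oplus>\<^bsub>M\<^esub> y) = f x \<oplus>\<^bsub>N\<^esub> f y"
  and lin_smult: "lin M N f \<Longrightarrow> a \<in> carrier R \<Longrightarrow> x \<in> carrier M \<Longrightarrow> f (a \<odot>\<^bsub>M\<^esub> x) = a \<odot>\<^bsub>N\<^esub> f x"
  unfolding lin_def by blast+

lemma lin_zero:
  assumes "lin M N f" shows "f \<zero>\<^bsub>M\<^esub> = \<zero>\<^bsub>N\<^esub>"
proof -
  have [simp]: "lmod M" "lmod N" using assms lin_dom lin_cod by auto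
  have "f \<zero>\<^bsub>M\<^esub> \<oplus>\<^bsub>N\<^esub> f \<zero>\<^bsub>M\<^esub> = f \<zero>\<^bsub>M\<^esub> \<oplus>\<^bsub>N\<^esub> \<zero>\<^bsub>N\<^esub>"
    using lin_add[OF assms, of "\<zero>\<^bsub>M\<^esub>" "\<zero>\<^bsub>M\<^esub>"] assms by simp
  with assms show ?thesis by (simp del: lmod_r_zero)
qed

lemma lin_neg:
  assumes "lin M N f" "x \<in> carrier M" shows "f (\<ominus>\<^bsub>M\<^esub> x) = \<ominus>\<^bsub>N\<^esub> f x"
proof -
  have [simp]: "lmod M" "lmod N" using assms lin_dom lin_cod by auto
  have "f (\<ominus>\<^bsub>M\<^esub> x) \<oplus>\<^bsub>N\<^esub> f x = \<zero>\<^bsub>N\<^esub>"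
    using assms by (simp flip: lin_add lin_zero)
  with assms show ?thesis by (simp add: lmod_eq_neg_iff)
qed

lemmas lin_simps = lin_add lin_smult lin_zero lin_neg

lemma lin_cong: "lin M N f \<Longrightarrow> (\<And>x. x \<in> carrier M \<Longrightarrow> g x = f x) \<Longrightarrow> lin M N g"
  by (rule linI) (auto simp: lin_dom lin_cod lin_simps)

lemma lin_id: "lmod M \<Longrightarrow> lin M M (\<lambda>x. x)"
  by (rule linI) auto

lemma lin_comp: "lin M N f \<Longrightarrow> lin N P g \<Longrightarrow> lin M P (\<lambda>x. g (f x))"
  by (rule linI) (auto simp: lin_dom lin_cod lin_simps)

lemma lin_sum:
  assumes "lin M N f" "lin M N g" shows "lin M N (\<lambda>x. f x \<oplus>\<^bsub>N\<^esub> g x)"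
proof -
  have [simp]: "lmod M" "lmod N" using assms lin_dom lin_cod by auto
  show ?thesis
    by (rule linI) (use assms in \<open>auto simp: lin_simps lmod_ac lmod_distr\<close>)
qed

lemma lin_minus:
  assumes "lin M N f" shows "lin M N (\<lambda>x. \<ominus>\<^bsub>N\<^esub> f x)"
proof -
  have [simp]: "lmod M" "lmod N" using assms lin_dom lin_cod by auto
  show ?thesis
    by (rule linI) (use assms in \<open>auto simp: lin_simps lmod_ac lmod_distr\<close>)
qed

lemma lin_const_zero: "lmod M \<Longrightarrow> lmod N \<Longrightarrow> lin M N (\<lambda>_. \<zero>\<^bsub>N\<^esub>)"
  by (rule linI) auto

lemma inj_on_lin_iff:
  assumes "lin M N f"
  shows "inj_on f (carrier M) \<longleftrightarrow> (\<forall>x \<in> carrier M. f x = \<zero>\<^bsub>N\<^esub> \<longrightarrow> x = \<zero>\<^bsub>M\<^esub>)"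
proof
  have [simp]: "lmod M" "lmod N" using assms lin_dom lin_cod by auto
  show "inj_on f (carrier M) \<Longrightarrow> \<forall>x \<in> carrier M. f x = \<zero>\<^bsub>N\<^esub> \<longrightarrow> x = \<zero>\<^bsub>M\<^esub>"
    using lin_zero[OF assms] by (metis inj_on_def lmod_zero_closed \<open>lmod M\<close>)
  assume *: "\<forall>x \<in> carrier M. f x = \<zero>\<^bsub>N\<^esub> \<longrightarrow> x = \<zero>\<^bsub>M\<^esub>"
  show "inj_on f (carrier M)"
  proof (rule inj_onI)
    fix x y assume xy: "x \<in> carrier M" "y \<in> carrier M" "f x = f y"
    then have "f (x \<oplus>\<^bsub>M\<^esub> \<ominus>\<^bsub>M\<^esub> y) = \<zero>\<^bsub>N\<^esub>" using assms by (simp add: lin_simps)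
    with * xy have "x \<oplus>\<^bsub>M\<^esub> \<ominus>\<^bsub>M\<^esub> y = \<zero>\<^bsub>M\<^esub>" by simp
    with xy show "x = y" by (simp add: lmod_eq_neg_iff)
  qed
qed

lemma lin_inv_into:
  assumes "lin M N f" "bij_betw f (carrier M) (carrier N)"
  shows "lin N M (inv_into (carrier M) f)"
proof -
  have [simp]: "lmod M" "lmod N" using assms lin_dom lin_cod by auto
  have inj: "inj_on f (carrier M)" and surj: "f ` carrier M = carrier N"
    using assms by (auto simp: bij_betw_def)
  let ?g = "inv_into (carrier M) f"
  have g: "?g y \<in> carrier M" "f (?g y) = y" if "y \<in> carrier N" for y
    using that surj by (auto simp: inv_into_into f_inv_into_f)
  show ?thesis
  proof (rule linI)
    fix x y assume "x \<in> carrier N" "y \<in> carrier N"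
    then show "?g (x \<oplus>\<^bsub>N\<^esub> y) = ?g x \<oplus>\<^bsub>M\<^esub> ?g y"
      using g inj assms by (intro inv_into_f_eq) (auto simp: lin_simps)
  next
    fix a x assume "a \<in> carrier R" "x \<in> carrier N"
    then show "?g (a \<odot>\<^bsub>N\<^esub> x) = a \<odot>\<^bsub>M\<^esub> ?g x"
      using g inj assms by (intro inv_into_f_eq) (auto simp: lin_simps)
  qed (use g in auto)
qed

text \<open>Choosing preimages under \<open>q\<close> and applying \<open>h\<close> is linear, since \<open>h\<close> is constant on the fibres
  of \<open>q\<close>.  All maps out of cokernels are obtained in this way.\<close>

lemma lin_factor_surj:
  assumes q: "lin B D q" and surj: "q ` carrier B = carrier D" and h: "lin B E h"
    and ker: "\<And>b. b \<in> carrier B \<Longrightarrow> q b = \<zero>\<^bsub>D\<^esub> \<Longrightarrow> h b = \<zero>\<^bsub>E\<^esub>"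
  obtains h' where "lin D E h'" "\<And>b. b \<in> carrier B \<Longrightarrow> h' (q b) = h b"
proof
  have [simp]: "lmod B" "lmod D" "lmod E" using q h lin_dom lin_cod by auto
  let ?s = "inv_into (carrier B) q"
  let ?h = "\<lambda>d. h (?s d)"
  have s: "?s d \<in> carrier B" "q (?s d) = d" if "d \<in> carrier D" for d
    using that surj by (auto simp: inv_into_into f_inv_into_f)
  have wd: "h b = h b'" if "b \<in> carrier B" "b' \<in> carrier B" "q b = q b'" for b b'
  proof -
    have "q (b \<oplus>\<^bsub>B\<^esub> \<ominus>\<^bsub>B\<^esub> b') = \<zero>\<^bsub>D\<^esub>" using that q by (simp add: lin_simps)
    then have "h (b \<oplus>\<^bsub>B\<^esub> \<ominus>\<^bsub>B\<^esub> b') = \<zero>\<^bsub>E\<^esub>" using that ker by simp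
    then show ?thesis using that h by (simp add: lin_simps lmod_eq_neg_iff)
  qed
  show *: "?h (q b) = h b" if "b \<in> carrier B" for b
    using that s q by (intro wd) auto
  show "lin D E ?h"
  proof (rule linI)
    fix x y assume "x \<in> carrier D" "y \<in> carrier D"
    then show "?h (x \<oplus>\<^bsub>D\<^esub> y) = ?h x \<oplus>\<^bsub>E\<^esub> ?h y"
      using s *[of "?s x \<oplus>\<^bsub>B\<^esub> ?s y"] q h by (simp add: lin_simps)
  next
    fix a x assume "a \<in> carrier R" "x \<in> carrier D"
    then show "?h (a \<odot>\<^bsub>D\<^esub> x) = a \<odot>\<^bsub>E\<^esub> ?h x"
      using s *[of "a \<odot>\<^bsub>B\<^esub> ?s x"] q h by (simp add: lin_simps)
  qed (use s h in auto)
qed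

section \<open>Constructions of modules\<close>

definition zero_mod :: "('r, 'x) module" where
  "zero_mod = \<lparr>carrier = {undefined}, mult = undefined, one = undefined, zero = undefined,
     add = (\<lambda>_ _. undefined), smult = (\<lambda>_ _. undefined)\<rparr>"

lemma zero_mod_simps [simp]:
  "carrier zero_mod = {undefined}" "\<zero>\<^bsub>zero_mod\<^esub> = undefined" "x \<oplus>\<^bsub>zero_mod\<^esub> y = undefined"
  "a \<odot>\<^bsub>zero_mod\<^esub> x = undefined"
  by (simp_all add: zero_mod_def)

lemma lmod_zero_mod [simp]: "lmod zero_mod"
  by (rule lmodI) simp_all

definition dsum :: "('r, 'x) module \<Rightarrow> ('r, 'y) module \<Rightarrow> ('r, 'x \<times> 'y) module" where
  "dsum M N = \<lparr>carrier = carrier M \<times> carrier N, mult = undefined, one = undefined,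
     zero = (\<zero>\<^bsub>M\<^esub>, \<zero>\<^bsub>N\<^esub>), add = (\<lambda>p q. (fst p \<oplus>\<^bsub>M\<^esub> fst q, snd p \<oplus>\<^bsub>N\<^esub> snd q)),
     smult = (\<lambda>a p. (a \<odot>\<^bsub>M\<^esub> fst p, a \<odot>\<^bsub>N\<^esub> snd p))\<rparr>"

lemma dsum_simps [simp]:
  "carrier (dsum M N) = carrier M \<times> carrier N"
  "\<zero>\<^bsub>dsum M N\<^esub> = (\<zero>\<^bsub>M\<^esub>, \<zero>\<^bsub>N\<^esub>)"
  "p \<oplus>\<^bsub>dsum M N\<^esub> q = (fst p \<oplus>\<^bsub>M\<^esub> fst q, snd p \<oplus>\<^bsub>N\<^esub> snd q)"
  "a \<odot>\<^bsub>dsum M N\<^esub> p = (a \<odot>\<^bsub>M\<^esub> fst p, a \<odot>\<^bsub>N\<^esub> snd p)"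
  by (simp_all add: dsum_def)

lemma lmod_dsum [simp]:
  assumes [simp]: "lmod M" "lmod N" shows "lmod (dsum M N)"
proof (rule lmodI)
  fix p assume "p \<in> carrier (dsum M N)"
  then show "\<exists>q \<in> carrier (dsum M N). q \<oplus>\<^bsub>dsum M N\<^esub> p = \<zero>\<^bsub>dsum M N\<^esub>"
    by (intro bexI[of _ "(\<ominus>\<^bsub>M\<^esub> fst p, \<ominus>\<^bsub>N\<^esub> snd p)"]) auto
qed (auto simp: lmod_assoc lmod_distr lmod_smult_assoc intro: lmod_comm)

lemma lin_pair: "lin M N f \<Longrightarrow> lin M P g \<Longrightarrow> lin M (dsum N P) (\<lambda>x. (f x, g x))"
  by (rule linI) (auto simp: lin_dom lin_cod lin_simps)

lemma lin_fst: "lmod M \<Longrightarrow> lmod N \<Longrightarrow> lin (dsum M N) M fst"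
  and lin_snd: "lmod M \<Longrightarrow> lmod N \<Longrightarrow> lin (dsum M N) N snd"
  by (rule linI; auto)+

lemma lin_copair:
  assumes "lin M P f" "lin N P g" shows "lin (dsum M N) P (\<lambda>p. f (fst p) \<oplus>\<^bsub>P\<^esub> g (snd p))"
proof -
  have [simp]: "lmod M" "lmod N" "lmod P" using assms lin_dom lin_cod by auto
  show ?thesis
    using lin_sum[OF lin_comp[OF lin_fst assms(1)] lin_comp[OF lin_snd assms(2)]] by simp
qed

text \<open>The module structure carried over along a map that is compatible with the operations.  It
  serves both for transport along injections and for quotients, the latter with a choice of
  coset representatives as the map.\<close>

definition img_mod :: "('r, 'x) module \<Rightarrow> ('x \<Rightarrow> 'y) \<Rightarrow> ('r, 'y) module" where
  "img_mod B q = (let s = inv_into (carrier B) q in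
     \<lparr>carrier = q ` carrier B, mult = undefined, one = undefined, zero = q \<zero>\<^bsub>B\<^esub>,
      add = (\<lambda>x y. q (s x \<oplus>\<^bsub>B\<^esub> s y)), smult = (\<lambda>a x. q (a \<odot>\<^bsub>B\<^esub> s x))\<rparr>)"

lemma img_mod_carrier [simp]: "carrier (img_mod B q) = q ` carrier B"
  by (simp add: img_mod_def Let_def)

lemma lin_img_mod:
  assumes [simp]: "lmod B"
    and add: "\<And>x x' y y'. x \<in> carrier B \<Longrightarrow> x' \<in> carrier B \<Longrightarrow> y \<in> carrier B \<Longrightarrow> y' \<in> carrier B \<Longrightarrow>
      q x = q x' \<Longrightarrow> q y = q y' \<Longrightarrow> q (x \<oplus>\<^bsub>B\<^esub> y) = q (x' \<oplus>\<^bsub>B\<^esub> y')"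
    and smult: "\<And>a x x'. a \<in> carrier R \<Longrightarrow> x \<in> carrier B \<Longrightarrow> x' \<in> carrier B \<Longrightarrow> q x = q x' \<Longrightarrow>
      q (a \<odot>\<^bsub>B\<^esub> x) = q (a \<odot>\<^bsub>B\<^esub> x')"
  shows "lin B (img_mod B q) q"
proof -
  let ?s = "inv_into (carrier B) q"
  have s: "?s (q x) \<in> carrier B" "q (?s (q x)) = q x" if "x \<in> carrier B" for x
    using that by (auto intro: inv_into_into f_inv_into_f)
  have z: "\<zero>\<^bsub>img_mod B q\<^esub> = q \<zero>\<^bsub>B\<^esub>" by (simp add: img_mod_def Let_def)
  have a: "q x \<oplus>\<^bsub>img_mod B q\<^esub> q y = q (x \<oplus>\<^bsub>B\<^esub> y)" if "x \<in> carrier B" "y \<in> carrier B" for x y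
    unfolding img_mod_def Let_def using that s by (auto intro!: add)
  have m: "c \<odot>\<^bsub>img_mod B q\<^esub> q x = q (c \<odot>\<^bsub>B\<^esub> x)" if "c \<in> carrier R" "x \<in> carrier B" for c x
    unfolding img_mod_def Let_def using that s by (auto intro!: smult)
  have "lmod (img_mod B q)"
  proof (rule lmodI)
    fix x assume "x \<in> carrier (img_mod B q)"
    then obtain b where b: "b \<in> carrier B" "x = q b" by auto
    show "\<exists>y \<in> carrier (img_mod B q). y \<oplus>\<^bsub>img_mod B q\<^esub> x = \<zero>\<^bsub>img_mod B q\<^esub>"
      by (rule bexI[of _ "q (\<ominus>\<^bsub>B\<^esub> b)"]) (use b in \<open>auto simp: a z\<close>)
  next
    fix x y assume "x \<in> carrier (img_mod B q)" "y \<in> carrier (img_mod B q)"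
    then obtain b c where b: "b \<in> carrier B" "x = q b" "c \<in> carrier B" "y = q c" by auto
    then have "b \<oplus>\<^bsub>B\<^esub> c = c \<oplus>\<^bsub>B\<^esub> b" by (simp add: lmod_comm)
    with b show "x \<oplus>\<^bsub>img_mod B q\<^esub> y = y \<oplus>\<^bsub>img_mod B q\<^esub> x" by (simp add: a)
  qed (auto simp: z a m lmod_assoc lmod_distr lmod_smult_assoc)
  then show ?thesis
    by (intro linI) (auto simp: a m)
qed

lemma lin_img_mod_inj:
  assumes "lmod B" "inj_on q (carrier B)" shows "lin B (img_mod B q) q"
  using assms by (intro lin_img_mod) (auto dest: inj_onD)

lemma smult_minus_one:
  assumes [simp]: "lmod M" and x: "x \<in> carrier M"
  shows "\<ominus>\<^bsub>R\<^esub> \<one>\<^bsub>R\<^esub> \<odot>\<^bsub>M\<^esub> x = \<ominus>\<^bsub>M\<^esub> x"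
proof -
  have "(\<ominus>\<^bsub>R\<^esub> \<one>\<^bsub>R\<^esub> \<oplus>\<^bsub>R\<^esub> \<one>\<^bsub>R\<^esub>) \<odot>\<^bsub>M\<^esub> x = \<ominus>\<^bsub>R\<^esub> \<one>\<^bsub>R\<^esub> \<odot>\<^bsub>M\<^esub> x \<oplus>\<^bsub>M\<^esub> x"
    using x by (subst lmod_smult_l_distr) auto
  then have "\<ominus>\<^bsub>R\<^esub> \<one>\<^bsub>R\<^esub> \<odot>\<^bsub>M\<^esub> x \<oplus>\<^bsub>M\<^esub> x = \<zero>\<^bsub>M\<^esub>"
    using x by (simp add: l_neg)
  then show ?thesis using x by (simp add: lmod_eq_neg_iff)
qed

text \<open>Representatives are used in place of cosets so that the quotient stays in the type of \<open>B\<close>;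
  for a module in the universe it is then again in the universe.\<close>

lemma quotient_exists:
  fixes B :: "('r, 'x) module"
  assumes B [simp]: "lmod B" and S: "S \<subseteq> carrier B" "\<zero>\<^bsub>B\<^esub> \<in> S"
    and S_add: "\<And>x y. x \<in> S \<Longrightarrow> y \<in> S \<Longrightarrow> x \<oplus>\<^bsub>B\<^esub> y \<in> S"
    and S_smult: "\<And>a x. a \<in> carrier R \<Longrightarrow> x \<in> S \<Longrightarrow> a \<odot>\<^bsub>B\<^esub> x \<in> S"
  obtains D :: "('r, 'x) module" and q where "lin B D q" "q ` carrier B = carrier D"
    "\<And>b. b \<in> carrier B \<Longrightarrow> q b = \<zero>\<^bsub>D\<^esub> \<longleftrightarrow> b \<in> S"
proof -
  define E where "E x y \<longleftrightarrow> (\<exists>s \<in> S. x = y \<oplus>\<^bsub>B\<^esub> s)" for x y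
  define q where "q x = (SOME y. y \<in> carrier B \<and> E x y)" for x
  have S_in [simp]: "s \<in> carrier B" if "s \<in> S" for s using that S by auto
  have S_neg: "\<ominus>\<^bsub>B\<^esub> s \<in> S" if "s \<in> S" for s
    using S_smult[of "\<ominus>\<^bsub>R\<^esub> \<one>\<^bsub>R\<^esub>" s] that by (simp add: smult_minus_one)
  have E_refl: "E x x" if "x \<in> carrier B" for x
    unfolding E_def using that S by (auto intro!: bexI[of _ "\<zero>\<^bsub>B\<^esub>"])
  have E_sym: "E y x" if "E x y" "y \<in> carrier B" for x y
    using that S_neg unfolding E_def by (force simp: lmod_assoc)
  have E_trans: "E x z" if "E x y" "E y z" "z \<in> carrier B" for x y z
    using that S_add unfolding E_def by (force simp: lmod_assoc)
  have E_add: "E (x \<oplus>\<^bsub>B\<^esub> x') (y \<oplus>\<^bsub>B\<^esub> y')" if "E x y" "E x' y'" "y \<in> carrier B" "y' \<in> carrier B" for x x' y y'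
  proof -
    from that obtain s s' where "s \<in> S" "s' \<in> S" "x = y \<oplus>\<^bsub>B\<^esub> s" "x' = y' \<oplus>\<^bsub>B\<^esub> s'"
      unfolding E_def by auto
    with that show ?thesis
      unfolding E_def by (intro bexI[of _ "s \<oplus>\<^bsub>B\<^esub> s'"]) (auto simp: lmod_ac S_add)
  qed
  have E_smult: "E (a \<odot>\<^bsub>B\<^esub> x) (a \<odot>\<^bsub>B\<^esub> y)" if "E x y" "a \<in> carrier R" "y \<in> carrier B" for a x y
    using that S_smult unfolding E_def by (force simp: lmod_distr)
  have q_in: "q x \<in> carrier B" and q_E: "E x (q x)" if "x \<in> carrier B" for x
    unfolding q_def using someI_ex[of "\<lambda>y. y \<in> carrier B \<and> E x y"] that E_refl by blast+
  have q_eq: "q x = q y \<longleftrightarrow> E x y" if "x \<in> carrier B" "y \<in> carrier B" for x y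
  proof
    assume "q x = q y"
    then show "E x y" using q_E[OF that(1)] q_E[OF that(2)] q_in that E_sym E_trans by metis
  next
    assume "E x y"
    then have "E x z \<longleftrightarrow> E y z" if "z \<in> carrier B" for z
      using that \<open>x \<in> carrier B\<close> \<open>y \<in> carrier B\<close> E_sym E_trans by metis
    then show "q x = q y" unfolding q_def by metis
  qed
  have lin: "lin B (img_mod B q) q"
    by (rule lin_img_mod) (auto simp: q_eq E_add E_smult)
  show ?thesis
  proof (rule that[OF lin])
    fix b assume b: "b \<in> carrier B"
    have "q b = \<zero>\<^bsub>img_mod B q\<^esub> \<longleftrightarrow> q b = q \<zero>\<^bsub>B\<^esub>" using lin by (simp add: lin_simps)
    then show "q b = \<zero>\<^bsub>img_mod B q\<^esub> \<longleftrightarrow> b \<in> S"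
      using b by (simp add: q_eq E_def)
  qed simp
qed

lemma cokernel_exists:
  fixes B :: "('r, 'y) module"
  assumes f: "lin A B f"
  obtains C :: "('r, 'y) module" and q where "lin B C q" "q ` carrier B = carrier C"
    "\<And>b. b \<in> carrier B \<Longrightarrow> q b = \<zero>\<^bsub>C\<^esub> \<longleftrightarrow> b \<in> f ` carrier A"
proof -
  have [simp]: "lmod A" "lmod B" using f lin_dom lin_cod by auto
  show ?thesis
  proof (rule quotient_exists[of B "f ` carrier A"])
    show "\<zero>\<^bsub>B\<^esub> \<in> f ` carrier A"
      using f by (intro image_eqI[of _ _ "\<zero>\<^bsub>A\<^esub>"]) (simp_all add: lin_zero)
    show "x \<oplus>\<^bsub>B\<^esub> y \<in> f ` carrier A" if "x \<in> f ` carrier A" "y \<in> f ` carrier A" for x y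
    proof -
      from that obtain a b where "a \<in> carrier A" "x = f a" "b \<in> carrier A" "y = f b" by blast
      then show ?thesis using f by (intro image_eqI[of _ _ "a \<oplus>\<^bsub>A\<^esub> b"]) (simp_all add: lin_add)
    qed
    show "c \<odot>\<^bsub>B\<^esub> x \<in> f ` carrier A" if "c \<in> carrier R" "x \<in> f ` carrier A" for c x
    proof -
      from that obtain a where "a \<in> carrier A" "x = f a" by blast
      then show ?thesis using f that by (intro image_eqI[of _ _ "c \<odot>\<^bsub>A\<^esub> a"]) (simp_all add: lin_smult)
    qed
  qed (use f in \<open>auto intro: that\<close>)
qed

section \<open>Linearity over the division subring\<close>

lemma F_in [simp]: "c \<in> F \<Longrightarrow> c \<in> carrier R" using F_sub by auto

definition F_lin :: "('r, 'x) module \<Rightarrow> ('r, 'y) module \<Rightarrow> ('x \<Rightarrow> 'y) \<Rightarrow> bool" where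
  "F_lin M N f \<longleftrightarrow> f ` carrier M \<subseteq> carrier N \<and>
     (\<forall>x \<in> carrier M. \<forall>y \<in> carrier M. f (x \<oplus>\<^bsub>M\<^esub> y) = f x \<oplus>\<^bsub>N\<^esub> f y) \<and>
     (\<forall>c \<in> F. \<forall>x \<in> carrier M. f (c \<odot>\<^bsub>M\<^esub> x) = c \<odot>\<^bsub>N\<^esub> f x)"

definition F_space :: "('r, 'x) module \<Rightarrow> 'x set \<Rightarrow> bool" where
  "F_space B S \<longleftrightarrow> S \<subseteq> carrier B \<and> \<zero>\<^bsub>B\<^esub> \<in> S \<and> (\<forall>x \<in> S. \<forall>y \<in> S. x \<oplus>\<^bsub>B\<^esub> y \<in> S) \<and>
     (\<forall>c \<in> F. \<forall>x \<in> S. c \<odot>\<^bsub>B\<^esub> x \<in> S)"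

lemma F_space_subset: "F_space B S \<Longrightarrow> S \<subseteq> carrier B"
  and F_space_zero: "F_space B S \<Longrightarrow> \<zero>\<^bsub>B\<^esub> \<in> S"
  and F_space_add: "F_space B S \<Longrightarrow> x \<in> S \<Longrightarrow> y \<in> S \<Longrightarrow> x \<oplus>\<^bsub>B\<^esub> y \<in> S"
  and F_space_smult: "F_space B S \<Longrightarrow> c \<in> F \<Longrightarrow> x \<in> S \<Longrightarrow> c \<odot>\<^bsub>B\<^esub> x \<in> S"
  unfolding F_space_def by blast+

lemma F_space_neg:
  assumes "lmod B" "F_space B S" "x \<in> S" shows "\<ominus>\<^bsub>B\<^esub> x \<in> S"
  using assms smult_minus_one[of B x] F_neg[OF F_one] unfolding F_space_def by (metis subset_iff)

text \<open>A maximal subspace \<open>W\<close> meeting \<open>S\<close> trivially is a complement: were \<open>b\<close> outside \<open>S + W\<close>, then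
  \<open>W + F b\<close> would still meet \<open>S\<close> trivially, because nonzero coefficients of \<open>b\<close> can be inverted.
  Zorn's lemma is required as injectivity is tested on modules of arbitrary size.\<close>

lemma F_space_complement:
  assumes B [simp]: "lmod B" and S: "F_space B S"
  obtains W where "F_space B W" "S \<inter> W = {\<zero>\<^bsub>B\<^esub>}"
    "\<And>b. b \<in> carrier B \<Longrightarrow> \<exists>s \<in> S. \<exists>w \<in> W. b = s \<oplus>\<^bsub>B\<^esub> w"
proof -
  let ?A = "{W. F_space B W \<and> S \<inter> W = {\<zero>\<^bsub>B\<^esub>}}"
  have "\<exists>W \<in> ?A. \<forall>X \<in> ?A. W \<subseteq> X \<longrightarrow> X = W"
  proof (rule subset_Zorn_nonempty)
    show "?A \<noteq> {}" using S by (auto simp: F_space_def intro!: exI[of _ "{\<zero>\<^bsub>B\<^esub>}"])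
  next
    fix Ch assume Ch: "Ch \<noteq> {}" "subset.chain ?A Ch"
    have mem: "W \<in> Ch \<Longrightarrow> F_space B W" "W \<in> Ch \<Longrightarrow> S \<inter> W = {\<zero>\<^bsub>B\<^esub>}" for W
      using Ch(2) by (auto simp: subset.chain_def)
    have tot: "W \<in> Ch \<Longrightarrow> W' \<in> Ch \<Longrightarrow> W \<subseteq> W' \<or> W' \<subseteq> W" for W W'
      using Ch(2) by (auto simp: subset.chain_def)
    obtain V where V: "V \<in> Ch" using Ch(1) by blast
    have "F_space B (\<Union>Ch)"
      unfolding F_space_def
    proof (intro conjI ballI)
      show "\<Union>Ch \<subseteq> carrier B" by (intro Union_least F_space_subset mem(1))
      show "\<zero>\<^bsub>B\<^esub> \<in> \<Union>Ch" using F_space_zero[OF mem(1)[OF V]] V by blast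
    next
      fix x y assume "x \<in> \<Union>Ch" "y \<in> \<Union>Ch"
      then obtain W W' where W: "W \<in> Ch" "x \<in> W" "W' \<in> Ch" "y \<in> W'" by blast
      then obtain V where V: "V \<in> Ch" "x \<in> V" "y \<in> V" using tot[OF W(1,3)] by blast
      from F_space_add[OF mem(1)[OF V(1)] V(2,3)] V(1) show "x \<oplus>\<^bsub>B\<^esub> y \<in> \<Union>Ch" by blast
    next
      fix c x assume "c \<in> F" "x \<in> \<Union>Ch"
      then show "c \<odot>\<^bsub>B\<^esub> x \<in> \<Union>Ch" by (auto intro: F_space_smult[OF mem(1)])
    qed
    moreover have "S \<inter> \<Union>Ch = {\<zero>\<^bsub>B\<^esub>}" using Ch(1) mem(2) by blast
    ultimately show "\<Union>Ch \<in> ?A" by blast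
  qed
  then obtain W where WA: "W \<in> ?A" and W_max: "\<forall>X \<in> ?A. W \<subseteq> X \<longrightarrow> X = W" by (rule bexE)
  have W: "F_space B W" "S \<inter> W = {\<zero>\<^bsub>B\<^esub>}" using WA by simp_all
  have max: "X = W" if "F_space B X" "S \<inter> X = {\<zero>\<^bsub>B\<^esub>}" "W \<subseteq> X" for X
    using W_max that by simp
  have S_in [simp]: "s \<in> carrier B" if "s \<in> S" for s using that S by (auto simp: F_space_def)
  have W_in [simp]: "w \<in> carrier B" if "w \<in> W" for w using that W by (auto simp: F_space_def)
  show ?thesis
  proof (rule that[OF W])
    fix b assume b [simp]: "b \<in> carrier B"
    show "\<exists>s \<in> S. \<exists>w \<in> W. b = s \<oplus>\<^bsub>B\<^esub> w"
    proof (rule ccontr)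
      assume no: "\<not> ?thesis"
      define X where "X = {w \<oplus>\<^bsub>B\<^esub> c \<odot>\<^bsub>B\<^esub> b | w c. w \<in> W \<and> c \<in> F}"
      have zF: "\<zero>\<^bsub>R\<^esub> \<in> F" using F_add[OF F_one F_neg[OF F_one]] by (simp add: r_neg)
      have XI: "w \<oplus>\<^bsub>B\<^esub> c \<odot>\<^bsub>B\<^esub> b \<in> X" if "w \<in> W" "c \<in> F" for w c
        using that unfolding X_def by blast
      have WX: "W \<subseteq> X"
      proof
        fix w assume "w \<in> W"
        then show "w \<in> X" using XI[OF _ zF] by fastforce
      qed
      have "F_space B X"
        unfolding F_space_def
      proof (intro conjI ballI)
        show "X \<subseteq> carrier B" by (auto simp: X_def)
        show "\<zero>\<^bsub>B\<^esub> \<in> X" using W(1) WX by (auto simp: F_space_def)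
      next
        fix x y assume "x \<in> X" "y \<in> X"
        then obtain w c w' c' where x: "w \<in> W" "c \<in> F" "x = w \<oplus>\<^bsub>B\<^esub> c \<odot>\<^bsub>B\<^esub> b"
          "w' \<in> W" "c' \<in> F" "y = w' \<oplus>\<^bsub>B\<^esub> c' \<odot>\<^bsub>B\<^esub> b" unfolding X_def by blast
        then have "x \<oplus>\<^bsub>B\<^esub> y = (w \<oplus>\<^bsub>B\<^esub> w') \<oplus>\<^bsub>B\<^esub> (c \<oplus>\<^bsub>R\<^esub> c') \<odot>\<^bsub>B\<^esub> b"
          by (simp add: lmod_distr lmod_ac)
        then show "x \<oplus>\<^bsub>B\<^esub> y \<in> X"
          using XI[OF F_space_add[OF W(1) x(1,4)] F_add[OF x(2,5)]] by simp
      next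
        fix d x assume d: "d \<in> F" and "x \<in> X"
        then obtain w c where x: "w \<in> W" "c \<in> F" "x = w \<oplus>\<^bsub>B\<^esub> c \<odot>\<^bsub>B\<^esub> b" unfolding X_def by blast
        then have "d \<odot>\<^bsub>B\<^esub> x = d \<odot>\<^bsub>B\<^esub> w \<oplus>\<^bsub>B\<^esub> (d \<otimes>\<^bsub>R\<^esub> c) \<odot>\<^bsub>B\<^esub> b"
          using d by (simp add: lmod_distr lmod_smult_assoc)
        then show "d \<odot>\<^bsub>B\<^esub> x \<in> X"
          using XI[OF F_space_smult[OF W(1) d x(1)] F_mult[OF d x(2)]] by simp
      qed
      moreover have "S \<inter> X = {\<zero>\<^bsub>B\<^esub>}"
      proof
        show "{\<zero>\<^bsub>B\<^esub>} \<subseteq> S \<inter> X" using WX W(2) by auto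
        show "S \<inter> X \<subseteq> {\<zero>\<^bsub>B\<^esub>}"
        proof
          fix x assume "x \<in> S \<inter> X"
          then obtain w c where x: "x \<in> S" "w \<in> W" "c \<in> F" "x = w \<oplus>\<^bsub>B\<^esub> c \<odot>\<^bsub>B\<^esub> b"
            unfolding X_def by blast
          show "x \<in> {\<zero>\<^bsub>B\<^esub>}"
          proof (cases "c = \<zero>\<^bsub>R\<^esub>")
            case True
            then have "x = w" using x by simp
            then show ?thesis using x W(2) by auto
          next
            case False
            then obtain d where d: "d \<in> F" "d \<otimes>\<^bsub>R\<^esub> c = \<one>\<^bsub>R\<^esub>" using F_inv x by blast
            have "b = d \<odot>\<^bsub>B\<^esub> (c \<odot>\<^bsub>B\<^esub> b)" using d x by (simp flip: lmod_smult_assoc)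
            also have "c \<odot>\<^bsub>B\<^esub> b = x \<oplus>\<^bsub>B\<^esub> \<ominus>\<^bsub>B\<^esub> w" using x by (simp add: lmod_ac)
            also have "d \<odot>\<^bsub>B\<^esub> (x \<oplus>\<^bsub>B\<^esub> \<ominus>\<^bsub>B\<^esub> w) = d \<odot>\<^bsub>B\<^esub> x \<oplus>\<^bsub>B\<^esub> d \<odot>\<^bsub>B\<^esub> (\<ominus>\<^bsub>B\<^esub> w)"
              using d x by (simp add: lmod_distr)
            finally have "b = d \<odot>\<^bsub>B\<^esub> x \<oplus>\<^bsub>B\<^esub> d \<odot>\<^bsub>B\<^esub> (\<ominus>\<^bsub>B\<^esub> w)" .
            moreover have "d \<odot>\<^bsub>B\<^esub> x \<in> S" "d \<odot>\<^bsub>B\<^esub> (\<ominus>\<^bsub>B\<^esub> w) \<in> W"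
              using S W(1) d x F_space_neg[OF B W(1)] by (auto simp: F_space_def)
            ultimately show ?thesis using no by blast
          qed
        qed
      qed
      ultimately have "X = W" using max WX by blast
      moreover have "b \<in> X" using XI[OF F_space_zero[OF W(1)] F_one] by simp
      ultimately have "b \<in> W" by simp
      moreover have "\<zero>\<^bsub>B\<^esub> \<in> S" using S by (auto simp: F_space_def)
      moreover have "b = \<zero>\<^bsub>B\<^esub> \<oplus>\<^bsub>B\<^esub> b" by simp
      ultimately show False using no by blast
    qed
  qed
qed

lemma F_lin_section:
  assumes q: "lin B C q" and surj: "q ` carrier B = carrier C"
  obtains s where "F_lin C B s" "\<And>c. c \<in> carrier C \<Longrightarrow> q (s c) = c"
proof -
  have [simp]: "lmod B" "lmod C" using q lin_dom lin_cod by auto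
  let ?S = "{b \<in> carrier B. q b = \<zero>\<^bsub>C\<^esub>}"
  have ks: "F_space B ?S" using q by (auto simp: F_space_def lin_simps)
  obtain W where W: "F_space B W" "?S \<inter> W = {\<zero>\<^bsub>B\<^esub>}"
    and dec: "\<And>b. b \<in> carrier B \<Longrightarrow> \<exists>s \<in> ?S. \<exists>w \<in> W. b = s \<oplus>\<^bsub>B\<^esub> w"
    by (rule F_space_complement[OF \<open>lmod B\<close> ks]) (rule that)
  have W_in [simp]: "w \<in> carrier B" if "w \<in> W" for w using that W by (auto simp: F_space_def)
  have inj: "w = w'" if "w \<in> W" "w' \<in> W" "q w = q w'" for w w'
  proof -
    have "w \<oplus>\<^bsub>B\<^esub> \<ominus>\<^bsub>B\<^esub> w' \<in> W"
      using that W(1) by (simp add: F_space_add F_space_neg)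
    moreover have "w \<oplus>\<^bsub>B\<^esub> \<ominus>\<^bsub>B\<^esub> w' \<in> ?S"
      using that q by (simp add: lin_add lin_neg)
    ultimately have "w \<oplus>\<^bsub>B\<^esub> \<ominus>\<^bsub>B\<^esub> w' = \<zero>\<^bsub>B\<^esub>" using W(2) by blast
    then show ?thesis using that by (simp add: lmod_eq_neg_iff)
  qed
  have "\<exists>w. w \<in> W \<and> q w = c" if "c \<in> carrier C" for c
  proof -
    from that surj obtain b where b: "b \<in> carrier B" "c = q b" by blast
    with dec obtain s w where "s \<in> ?S" "w \<in> W" "b = s \<oplus>\<^bsub>B\<^esub> w" by blast
    with b q show ?thesis by (intro exI[of _ w]) (simp add: lin_simps)
  qed
  then obtain s where s: "\<And>c. c \<in> carrier C \<Longrightarrow> s c \<in> W \<and> q (s c) = c" by metis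
  show ?thesis
  proof (rule that)
    show "q (s c) = c" if "c \<in> carrier C" for c using s that by auto
    show "F_lin C B s"
      unfolding F_lin_def
    proof (intro conjI ballI)
      show "s ` carrier C \<subseteq> carrier B" using s by auto
    next
      fix x y assume "x \<in> carrier C" "y \<in> carrier C"
      then show "s (x \<oplus>\<^bsub>C\<^esub> y) = s x \<oplus>\<^bsub>B\<^esub> s y"
        using s W(1) q by (intro inj) (simp_all add: F_space_add lin_add)
    next
      fix a x assume "a \<in> F" "x \<in> carrier C"
      then show "s (a \<odot>\<^bsub>C\<^esub> x) = a \<odot>\<^bsub>B\<^esub> s x"
        using s W(1) q by (intro inj) (simp_all add: F_space_smult lin_smult)
    qed
  qed
qed

lemma F_lin_extend:
  assumes i: "lin A B i" and inj: "inj_on i (carrier A)" and g: "F_lin A M g"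
  obtains g' where "F_lin B M g'" "\<And>a. a \<in> carrier A \<Longrightarrow> g' (i a) = g a"
proof -
  have [simp]: "lmod B" "lmod A" using i lin_dom lin_cod by auto
  have ks: "F_space B (i ` carrier A)"
    unfolding F_space_def
  proof (intro conjI ballI)
    show "\<zero>\<^bsub>B\<^esub> \<in> i ` carrier A" using i by (auto intro!: image_eqI[of _ _ "\<zero>\<^bsub>A\<^esub>"] simp: lin_simps)
  qed (use i in \<open>auto simp flip: lin_add lin_smult\<close>)
  obtain W where W: "F_space B W" "i ` carrier A \<inter> W = {\<zero>\<^bsub>B\<^esub>}"
    and dec: "\<And>b. b \<in> carrier B \<Longrightarrow> \<exists>s \<in> i ` carrier A. \<exists>w \<in> W. b = s \<oplus>\<^bsub>B\<^esub> w"
    by (rule F_space_complement[OF \<open>lmod B\<close> ks]) (rule that)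
  have W_in [simp]: "w \<in> carrier B" if "w \<in> W" for w using that W by (auto simp: F_space_def)
  have uniq: "a = a'" if "a \<in> carrier A" "a' \<in> carrier A" "w \<in> W" "w' \<in> W"
    "i a \<oplus>\<^bsub>B\<^esub> w = i a' \<oplus>\<^bsub>B\<^esub> w'" for a a' w w'
  proof -
    have "i (a \<oplus>\<^bsub>A\<^esub> \<ominus>\<^bsub>A\<^esub> a') = i a \<oplus>\<^bsub>B\<^esub> \<ominus>\<^bsub>B\<^esub> i a'" using that i by (simp add: lin_simps)
    also have "i a = (i a \<oplus>\<^bsub>B\<^esub> w) \<oplus>\<^bsub>B\<^esub> \<ominus>\<^bsub>B\<^esub> w" using that(1-4) i by (simp add: lmod_assoc)
    also have "\<dots> \<oplus>\<^bsub>B\<^esub> \<ominus>\<^bsub>B\<^esub> i a' = w' \<oplus>\<^bsub>B\<^esub> \<ominus>\<^bsub>B\<^esub> w"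
      unfolding that(5) using that(1-4) i by (simp add: lmod_ac)
    finally have "i (a \<oplus>\<^bsub>A\<^esub> \<ominus>\<^bsub>A\<^esub> a') \<in> W"
      using that W(1) by (simp add: F_space_add F_space_neg)
    moreover have "i (a \<oplus>\<^bsub>A\<^esub> \<ominus>\<^bsub>A\<^esub> a') \<in> i ` carrier A" using that by auto
    ultimately have "i (a \<oplus>\<^bsub>A\<^esub> \<ominus>\<^bsub>A\<^esub> a') = \<zero>\<^bsub>B\<^esub>" using W(2) by blast
    then have "a \<oplus>\<^bsub>A\<^esub> \<ominus>\<^bsub>A\<^esub> a' = \<zero>\<^bsub>A\<^esub>" using inj i that by (simp add: inj_on_lin_iff)
    then show ?thesis using that by (simp add: lmod_eq_neg_iff)
  qed
  have "\<exists>a. a \<in> carrier A \<and> (\<exists>w \<in> W. b = i a \<oplus>\<^bsub>B\<^esub> w)" if "b \<in> carrier B" for b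
    using dec[OF that] by blast
  then obtain p where p_in: "\<And>b. b \<in> carrier B \<Longrightarrow> p b \<in> carrier A"
    and p: "\<And>b. b \<in> carrier B \<Longrightarrow> \<exists>w \<in> W. b = i (p b) \<oplus>\<^bsub>B\<^esub> w"
    by metis
  have p_eq: "p (i a \<oplus>\<^bsub>B\<^esub> w) = a" if a: "a \<in> carrier A" and w: "w \<in> W" for a w
  proof -
    have b: "i a \<oplus>\<^bsub>B\<^esub> w \<in> carrier B" using a w i by simp
    from p[OF this] obtain w' where w': "w' \<in> W"
      and "i a \<oplus>\<^bsub>B\<^esub> w = i (p (i a \<oplus>\<^bsub>B\<^esub> w)) \<oplus>\<^bsub>B\<^esub> w'" by blast
    from uniq[OF a p_in[OF b] w this] show ?thesis by (rule sym)
  qed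
  have p_add: "p (x \<oplus>\<^bsub>B\<^esub> y) = p x \<oplus>\<^bsub>A\<^esub> p y" if xy: "x \<in> carrier B" "y \<in> carrier B" for x y
  proof -
    from p[OF xy(1)] p[OF xy(2)] obtain v w where
      vw: "v \<in> W" "w \<in> W" and x: "x = i (p x) \<oplus>\<^bsub>B\<^esub> v" and y: "y = i (p y) \<oplus>\<^bsub>B\<^esub> w" by blast
    note arg_cong2[where f = "add B", OF x y]
    also have "i (p x) \<oplus>\<^bsub>B\<^esub> v \<oplus>\<^bsub>B\<^esub> (i (p y) \<oplus>\<^bsub>B\<^esub> w) = i (p x \<oplus>\<^bsub>A\<^esub> p y) \<oplus>\<^bsub>B\<^esub> (v \<oplus>\<^bsub>B\<^esub> w)"
      using p_in[OF xy(1)] p_in[OF xy(2)] vw i by (simp add: lin_add lmod_ac)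
    finally show ?thesis
      using p_eq[of "p x \<oplus>\<^bsub>A\<^esub> p y" "v \<oplus>\<^bsub>B\<^esub> w"] p_in[OF xy(1)] p_in[OF xy(2)] vw W(1)
      by (simp add: F_space_add)
  qed
  have p_smult: "p (c \<odot>\<^bsub>B\<^esub> x) = c \<odot>\<^bsub>A\<^esub> p x" if cx: "c \<in> F" "x \<in> carrier B" for c x
  proof -
    from p[OF cx(2)] obtain v where v: "v \<in> W" and x: "x = i (p x) \<oplus>\<^bsub>B\<^esub> v" by blast
    note arg_cong[where f = "smult B c", OF x]
    also have "c \<odot>\<^bsub>B\<^esub> (i (p x) \<oplus>\<^bsub>B\<^esub> v) = i (c \<odot>\<^bsub>A\<^esub> p x) \<oplus>\<^bsub>B\<^esub> c \<odot>\<^bsub>B\<^esub> v"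
      using p_in[OF cx(2)] cx v i by (simp add: lin_smult lmod_distr)
    finally show ?thesis
      using p_eq[of "c \<odot>\<^bsub>A\<^esub> p x" "c \<odot>\<^bsub>B\<^esub> v"] p_in[OF cx(2)] cx v W(1) by (simp add: F_space_smult)
  qed
  show ?thesis
  proof (rule that[of "\<lambda>b. g (p b)"])
    show "F_lin B M (\<lambda>b. g (p b))"
      using g p_in unfolding F_lin_def by (auto simp: p_add p_smult image_subset_iff)
    fix a assume a: "a \<in> carrier A"
    have "\<zero>\<^bsub>B\<^esub> \<in> W" using W(1) by (auto simp: F_space_def)
    from p_eq[OF a this] show "g (p (i a)) = g a" using a i by simp
  qed
qed

section \<open>Coinduced modules\<close>

definition reg :: "('r, 'r) module" where
  "reg = \<lparr>carrier = carrier R, mult = undefined, one = undefined, zero = \<zero>\<^bsub>R\<^esub>,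
     add = add R, smult = mult R\<rparr>"

lemma reg_simps [simp]:
  "carrier reg = carrier R" "\<zero>\<^bsub>reg\<^esub> = \<zero>\<^bsub>R\<^esub>" "x \<oplus>\<^bsub>reg\<^esub> y = x \<oplus>\<^bsub>R\<^esub> y" "a \<odot>\<^bsub>reg\<^esub> x = a \<otimes>\<^bsub>R\<^esub> x"
  by (simp_all add: reg_def)

lemma lmod_reg [simp]: "lmod reg"
proof (rule lmodI)
  fix x assume "x \<in> carrier reg"
  then show "\<exists>y \<in> carrier reg. y \<oplus>\<^bsub>reg\<^esub> x = \<zero>\<^bsub>reg\<^esub>" by (intro bexI[of _ "\<ominus>\<^bsub>R\<^esub> x"]) (auto simp: l_neg)
qed (auto simp: a_ac l_distr r_distr m_assoc)

text \<open>The coinduced module \<open>I(M) = Hom\<^sub>F(R, M)\<close>, with \<open>R\<close> acting through right multiplication on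
  the argument.\<close>

definition coind :: "('r, 'x) module \<Rightarrow> ('r, 'r \<Rightarrow> 'x) module" where
  "coind M = \<lparr>carrier = {\<phi> \<in> extensional (carrier R). F_lin reg M \<phi>}, mult = undefined,
     one = undefined, zero = (\<lambda>r\<in>carrier R. \<zero>\<^bsub>M\<^esub>),
     add = (\<lambda>\<phi> \<psi>. \<lambda>r\<in>carrier R. \<phi> r \<oplus>\<^bsub>M\<^esub> \<psi> r),
     smult = (\<lambda>a \<phi>. \<lambda>r\<in>carrier R. \<phi> (r \<otimes>\<^bsub>R\<^esub> a))\<rparr>"

lemma coind_zero [simp]: "r \<in> carrier R \<Longrightarrow> \<zero>\<^bsub>coind M\<^esub> r = \<zero>\<^bsub>M\<^esub>"
  and coind_add [simp]: "r \<in> carrier R \<Longrightarrow> (\<phi> \<oplus>\<^bsub>coind M\<^esub> \<psi>) r = \<phi> r \<oplus>\<^bsub>M\<^esub> \<psi> r"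
  and coind_smult [simp]: "r \<in> carrier R \<Longrightarrow> (a \<odot>\<^bsub>coind M\<^esub> \<phi>) r = \<phi> (r \<otimes>\<^bsub>R\<^esub> a)"
  by (simp_all add: coind_def)

lemma coind_carrier: "\<phi> \<in> carrier (coind M) \<longleftrightarrow> \<phi> \<in> extensional (carrier R) \<and> F_lin reg M \<phi>"
  by (simp add: coind_def)

lemma coind_in [simp]: "\<phi> \<in> carrier (coind M) \<Longrightarrow> r \<in> carrier R \<Longrightarrow> \<phi> r \<in> carrier M"
  and coind_app_add: "\<phi> \<in> carrier (coind M) \<Longrightarrow> r \<in> carrier R \<Longrightarrow> s \<in> carrier R \<Longrightarrow>
    \<phi> (r \<oplus>\<^bsub>R\<^esub> s) = \<phi> r \<oplus>\<^bsub>M\<^esub> \<phi> s"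
  and coind_app_F: "\<phi> \<in> carrier (coind M) \<Longrightarrow> c \<in> F \<Longrightarrow> r \<in> carrier R \<Longrightarrow>
    \<phi> (c \<otimes>\<^bsub>R\<^esub> r) = c \<odot>\<^bsub>M\<^esub> \<phi> r"
  by (auto simp: coind_carrier F_lin_def)

lemma F_linI:
  assumes "\<And>x. x \<in> carrier M \<Longrightarrow> f x \<in> carrier N"
    and "\<And>x y. x \<in> carrier M \<Longrightarrow> y \<in> carrier M \<Longrightarrow> f (x \<oplus>\<^bsub>M\<^esub> y) = f x \<oplus>\<^bsub>N\<^esub> f y"
    and "\<And>c x. c \<in> F \<Longrightarrow> x \<in> carrier M \<Longrightarrow> f (c \<odot>\<^bsub>M\<^esub> x) = c \<odot>\<^bsub>N\<^esub> f x"
  shows "F_lin M N f"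
  using assms unfolding F_lin_def by (simp add: image_subset_iff)

lemma coindI:
  assumes "\<And>r. r \<in> carrier R \<Longrightarrow> f r \<in> carrier M"
    and "\<And>r s. r \<in> carrier R \<Longrightarrow> s \<in> carrier R \<Longrightarrow> f (r \<oplus>\<^bsub>R\<^esub> s) = f r \<oplus>\<^bsub>M\<^esub> f s"
    and "\<And>c r. c \<in> F \<Longrightarrow> r \<in> carrier R \<Longrightarrow> f (c \<otimes>\<^bsub>R\<^esub> r) = c \<odot>\<^bsub>M\<^esub> f r"
  shows "(\<lambda>r\<in>carrier R. f r) \<in> carrier (coind M)"
  unfolding coind_carrier by (intro conjI F_linI restrict_extensional) (use assms in simp_all)

lemma coind_eqI:
  assumes "\<phi> \<in> carrier (coind M)" "\<psi> \<in> carrier (coind M)"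
    and "\<And>r. r \<in> carrier R \<Longrightarrow> \<phi> r = \<psi> r"
  shows "\<phi> = \<psi>"
  using assms by (auto simp: coind_carrier intro: extensionalityI)

lemma lmod_coind [simp]:
  assumes M [simp]: "lmod M" shows "lmod (coind M)"
proof -
  have add: "\<phi> \<oplus>\<^bsub>coind M\<^esub> \<psi> \<in> carrier (coind M)"
    if "\<phi> \<in> carrier (coind M)" "\<psi> \<in> carrier (coind M)" for \<phi> \<psi>
  proof -
    have "(\<lambda>r\<in>carrier R. \<phi> r \<oplus>\<^bsub>M\<^esub> \<psi> r) \<in> carrier (coind M)"
      by (rule coindI) (use that in \<open>simp_all add: coind_app_add coind_app_F lmod_distr lmod_ac\<close>)
    then show ?thesis by (simp add: coind_def)
  qed
  have zero: "\<zero>\<^bsub>coind M\<^esub> \<in> carrier (coind M)"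
  proof -
    have "(\<lambda>r\<in>carrier R. \<zero>\<^bsub>M\<^esub>) \<in> carrier (coind M)" by (rule coindI) simp_all
    then show ?thesis by (simp add: coind_def)
  qed
  have smult: "a \<odot>\<^bsub>coind M\<^esub> \<phi> \<in> carrier (coind M)"
    if "a \<in> carrier R" "\<phi> \<in> carrier (coind M)" for a \<phi>
  proof -
    have "(\<lambda>r\<in>carrier R. \<phi> (r \<otimes>\<^bsub>R\<^esub> a)) \<in> carrier (coind M)"
      by (rule coindI) (use that in \<open>simp_all add: coind_app_add coind_app_F l_distr m_assoc\<close>)
    then show ?thesis by (simp add: coind_def)
  qed
  show ?thesis
  proof (rule lmodI)
    fix \<phi> assume \<phi>: "\<phi> \<in> carrier (coind M)"
    have "(\<lambda>r\<in>carrier R. \<ominus>\<^bsub>M\<^esub> \<phi> r) \<in> carrier (coind M)"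
      by (rule coindI) (use \<phi> in \<open>simp_all add: coind_app_add coind_app_F lmod_distr lmod_ac\<close>)
    moreover have "(\<lambda>r\<in>carrier R. \<ominus>\<^bsub>M\<^esub> \<phi> r) \<oplus>\<^bsub>coind M\<^esub> \<phi> = \<zero>\<^bsub>coind M\<^esub>"
      by (rule coind_eqI[of _ M, OF add]) (use \<phi> calculation zero in simp_all)
    ultimately show "\<exists>\<psi> \<in> carrier (coind M). \<psi> \<oplus>\<^bsub>coind M\<^esub> \<phi> = \<zero>\<^bsub>coind M\<^esub>" by blast
  qed (use add zero smult in \<open>auto intro!: coind_eqI[of _ M]
         simp: coind_app_add lmod_ac r_distr m_assoc\<close>)
qed

lemma finite_coind:
  assumes "finite (carrier R)" "finite (carrier M)" shows "finite (carrier (coind M))"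
proof (rule finite_subset)
  show "carrier (coind M) \<subseteq> carrier R \<rightarrow>\<^sub>E carrier M"
    by (auto simp: PiE_def coind_carrier F_lin_def)
  show "finite (carrier R \<rightarrow>\<^sub>E carrier M)" using assms by (intro finite_PiE) auto
qed

definition eta :: "('r, 'x) module \<Rightarrow> 'x \<Rightarrow> 'r \<Rightarrow> 'x" where
  "eta M x = (\<lambda>r\<in>carrier R. r \<odot>\<^bsub>M\<^esub> x)"

definition cmap :: "('x \<Rightarrow> 'y) \<Rightarrow> ('r \<Rightarrow> 'x) \<Rightarrow> 'r \<Rightarrow> 'y" where
  "cmap f \<phi> = (\<lambda>r\<in>carrier R. f (\<phi> r))"

lemma eta_app [simp]: "r \<in> carrier R \<Longrightarrow> eta M x r = r \<odot>\<^bsub>M\<^esub> x" by (simp add: eta_def)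
lemma cmap_app [simp]: "r \<in> carrier R \<Longrightarrow> cmap f \<phi> r = f (\<phi> r)" by (simp add: cmap_def)

lemma lin_eta:
  assumes [simp]: "lmod M" shows "lin M (coind M) (eta M)"
proof -
  have c: "eta M x \<in> carrier (coind M)" if "x \<in> carrier M" for x
    unfolding eta_def by (rule coindI) (use that in \<open>simp_all add: lmod_distr lmod_smult_assoc\<close>)
  show ?thesis
  proof (rule linI)
    fix x y assume "x \<in> carrier M" "y \<in> carrier M"
    then show "eta M (x \<oplus>\<^bsub>M\<^esub> y) = eta M x \<oplus>\<^bsub>coind M\<^esub> eta M y"
      by (intro coind_eqI[of _ M]) (simp_all add: c lmod_distr)
  next
    fix a x assume "a \<in> carrier R" "x \<in> carrier M"
    then show "eta M (a \<odot>\<^bsub>M\<^esub> x) = a \<odot>\<^bsub>coind M\<^esub> eta M x"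
      by (intro coind_eqI[of _ M]) (simp_all add: c lmod_smult_assoc)
  qed (simp_all add: c)
qed

lemma inj_eta: "lmod M \<Longrightarrow> inj_on (eta M) (carrier M)"
  by (metis eta_app inj_onI lmod_smult_one one_closed)

lemma lin_cmap:
  assumes f: "lin M N f" shows "lin (coind M) (coind N) (cmap f)"
proof -
  have [simp]: "lmod M" "lmod N" using f lin_dom lin_cod by auto
  have c: "cmap f \<phi> \<in> carrier (coind N)" if "\<phi> \<in> carrier (coind M)" for \<phi>
    unfolding cmap_def
    by (rule coindI) (use that f in \<open>simp_all add: coind_app_add coind_app_F lin_add lin_smult\<close>)
  show ?thesis
  proof (rule linI)
    fix x y assume "x \<in> carrier (coind M)" "y \<in> carrier (coind M)"
    then show "cmap f (x \<oplus>\<^bsub>coind M\<^esub> y) = cmap f x \<oplus>\<^bsub>coind N\<^esub> cmap f y"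
      using f by (intro coind_eqI[of _ N]) (simp_all add: c lin_add)
  next
    fix a x assume "a \<in> carrier R" "x \<in> carrier (coind M)"
    then show "cmap f (a \<odot>\<^bsub>coind M\<^esub> x) = a \<odot>\<^bsub>coind N\<^esub> cmap f x"
      by (intro coind_eqI[of _ N]) (simp_all add: c)
  qed (simp_all add: c)
qed

lemma cmap_eta:
  assumes f: "lin M N f" "x \<in> carrier M"
  shows "cmap f (eta M x) = eta N (f x)"
  by (rule ext) (use assms in \<open>simp add: cmap_def eta_def lin_smult\<close>)

text \<open>Linear maps \<open>g\<close> to \<open>Hom\<^sub>F(R, M)\<close> correspond to \<open>F\<close>-linear maps \<open>a \<mapsto> g(a)(1)\<close> to \<open>M\<close>, and those
  extend along injections.\<close>

lemma coind_injective:
  assumes i: "lin A B i" and inj: "inj_on i (carrier A)" and g: "lin A (coind M) g" and [simp]: "lmod M"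
  obtains g' where "lin B (coind M) g'" "\<And>a. a \<in> carrier A \<Longrightarrow> g' (i a) = g a"
proof -
  have [simp]: "lmod B" "lmod A" using i lin_dom lin_cod by auto
  have "F_lin A M (\<lambda>a. g a \<one>\<^bsub>R\<^esub>)"
  proof (rule F_linI)
    fix c x assume cx: "c \<in> F" "x \<in> carrier A"
    then have "g x (c \<otimes>\<^bsub>R\<^esub> \<one>\<^bsub>R\<^esub>) = c \<odot>\<^bsub>M\<^esub> g x \<one>\<^bsub>R\<^esub>"
      by (intro coind_app_F) (use g in simp_all)
    then show "g (c \<odot>\<^bsub>A\<^esub> x) \<one>\<^bsub>R\<^esub> = c \<odot>\<^bsub>M\<^esub> g x \<one>\<^bsub>R\<^esub>"
      using cx g by (simp add: lin_smult)
  qed (use g in \<open>simp_all add: lin_add coind_in[OF lin_in]\<close>)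
  then obtain h where h: "F_lin B M h" and hi: "\<And>a. a \<in> carrier A \<Longrightarrow> h (i a) = g a \<one>\<^bsub>R\<^esub>"
    by (rule F_lin_extend[OF i inj]) (rule that)
  have h_in [simp]: "h b \<in> carrier M" if "b \<in> carrier B" for b using h that by (auto simp: F_lin_def)
  have h_add: "h (b \<oplus>\<^bsub>B\<^esub> b') = h b \<oplus>\<^bsub>M\<^esub> h b'" if "b \<in> carrier B" "b' \<in> carrier B" for b b'
    using h that by (auto simp: F_lin_def)
  have h_F: "h (c \<odot>\<^bsub>B\<^esub> b) = c \<odot>\<^bsub>M\<^esub> h b" if "c \<in> F" "b \<in> carrier B" for c b
    using h that by (auto simp: F_lin_def)
  define g' where "g' b = (\<lambda>r\<in>carrier R. h (r \<odot>\<^bsub>B\<^esub> b))" for b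
  have app [simp]: "g' b r = h (r \<odot>\<^bsub>B\<^esub> b)" if "r \<in> carrier R" for b r using that by (simp add: g'_def)
  have c: "g' b \<in> carrier (coind M)" if "b \<in> carrier B" for b
    unfolding g'_def by (rule coindI) (use that in \<open>simp_all add: h_add h_F lmod_distr lmod_smult_assoc\<close>)
  show ?thesis
  proof (rule that)
    show "lin B (coind M) g'"
    proof (rule linI)
      fix x y assume "x \<in> carrier B" "y \<in> carrier B"
      then show "g' (x \<oplus>\<^bsub>B\<^esub> y) = g' x \<oplus>\<^bsub>coind M\<^esub> g' y"
        by (intro coind_eqI[of _ M]) (simp_all add: c lmod_distr h_add)
    next
      fix a x assume "a \<in> carrier R" "x \<in> carrier B"
      then show "g' (a \<odot>\<^bsub>B\<^esub> x) = a \<odot>\<^bsub>coind M\<^esub> g' x"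
        by (intro coind_eqI[of _ M]) (simp_all add: c lmod_smult_assoc)
    qed (simp_all add: c)
  next
    fix a assume a: "a \<in> carrier A"
    show "g' (i a) = g a"
    proof (rule coind_eqI[of _ M])
      fix r assume r: "r \<in> carrier R"
      have "g' (i a) r = h (i (r \<odot>\<^bsub>A\<^esub> a))" using r a i by (simp add: lin_smult)
      also have "\<dots> = g (r \<odot>\<^bsub>A\<^esub> a) \<one>\<^bsub>R\<^esub>" using r a by (simp add: hi)
      also have "\<dots> = g a r" using r a g by (simp add: lin_smult)
      finally show "g' (i a) r = g a r" .
    qed (use a i g c in simp_all)
  qed
qed

text \<open>Composition with an \<open>F\<close>-linear section of \<open>q\<close> lifts elements of \<open>Hom\<^sub>F(R, C)\<close>, although \<open>q\<close> may
  have no \<open>R\<close>-linear section.  The rest of the exactness of \<open>I\<close> is formal.\<close>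

lemma cmap_surj:
  assumes q: "lin B C q" and surj: "q ` carrier B = carrier C"
  shows "cmap q ` carrier (coind B) = carrier (coind C)"
proof
  show "cmap q ` carrier (coind B) \<subseteq> carrier (coind C)" using lin_cmap[OF q] by (auto simp: lin_def)
  obtain s where s: "F_lin C B s" "\<And>c. c \<in> carrier C \<Longrightarrow> q (s c) = c"
    by (rule F_lin_section[OF q surj]) (rule that)
  show "carrier (coind C) \<subseteq> cmap q ` carrier (coind B)"
  proof
    fix \<phi> assume \<phi>: "\<phi> \<in> carrier (coind C)"
    have "(\<lambda>r\<in>carrier R. s (\<phi> r)) \<in> carrier (coind B)"
      by (rule coindI) (use \<phi> s(1) in \<open>auto simp: coind_app_add coind_app_F F_lin_def\<close>)
    moreover from this have "\<phi> = cmap q (\<lambda>r\<in>carrier R. s (\<phi> r))"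
      by (intro coind_eqI[of _ C]) (use \<phi> s(2) lin_cmap[OF q] in simp_all)
    ultimately show "\<phi> \<in> cmap q ` carrier (coind B)" by blast
  qed
qed

section \<open>Stable equality and stable equivalence\<close>

text \<open>The maps that factor through an injective module.  Any such map extends along the embedding of
  its source in the injective module \<open>I(M)\<close>, and the definition asks just for that: it involves no
  choice of the injective module, and sums of null maps are null for a trivial reason.\<close>

definition null_map :: "('r, 'x) module \<Rightarrow> ('r, 'y) module \<Rightarrow> ('x \<Rightarrow> 'y) \<Rightarrow> bool" where
  "null_map M N f \<longleftrightarrow> lmod M \<and> (\<exists>g. lin (coind M) N g \<and> (\<forall>x \<in> carrier M. g (eta M x) = f x))"

text \<open>\<open>P\<close> is injective iff its embedding in the injective module \<open>I(P)\<close> splits.\<close>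

definition inj_mod :: "('r, 'x) module \<Rightarrow> bool" where
  "inj_mod P \<longleftrightarrow> null_map P P (\<lambda>x. x)"

lemma nullI:
  assumes "lmod M" "lin (coind M) N g" "\<And>x. x \<in> carrier M \<Longrightarrow> g (eta M x) = f x"
  shows "null_map M N f"
  using assms unfolding null_map_def by blast

lemma nullE:
  assumes "null_map M N f"
  obtains g where "lmod M" "lin (coind M) N g" "\<And>x. x \<in> carrier M \<Longrightarrow> g (eta M x) = f x"
  using assms unfolding null_map_def by blast

lemma null_lin:
  assumes "null_map M N f" shows "lin M N f"
proof -
  from assms obtain g where g: "lmod M" "lin (coind M) N g" "\<And>x. x \<in> carrier M \<Longrightarrow> g (eta M x) = f x"
    by (rule nullE) (rule that)
  show ?thesis by (rule lin_cong[OF lin_comp[OF lin_eta[OF g(1)] g(2)]]) (simp add: g(3))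
qed

lemma null_cong:
  assumes "null_map M N f" "\<And>x. x \<in> carrier M \<Longrightarrow> f' x = f x"
  shows "null_map M N f'"
  using assms unfolding null_map_def by auto

lemma null_comp_left:
  assumes "null_map M N f" "lin N P h" shows "null_map M P (\<lambda>x. h (f x))"
proof -
  from assms(1) obtain g where g: "lmod M" "lin (coind M) N g" "\<And>x. x \<in> carrier M \<Longrightarrow> g (eta M x) = f x"
    by (rule nullE) (rule that)
  show ?thesis by (rule nullI[OF g(1) lin_comp[OF g(2) assms(2)]]) (simp add: g(3))
qed

lemma null_comp_right:
  assumes "lin M N h" "null_map N P f" shows "null_map M P (\<lambda>x. f (h x))"
proof -
  from assms(2) obtain g where g: "lmod N" "lin (coind N) P g" "\<And>x. x \<in> carrier N \<Longrightarrow> g (eta N x) = f x"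
    by (rule nullE) (rule that)
  show ?thesis
    by (rule nullI[OF lin_dom[OF assms(1)] lin_comp[OF lin_cmap[OF assms(1)] g(2)]])
      (use assms(1) in \<open>simp add: cmap_eta g(3)\<close>)
qed

lemma null_sum:
  assumes "null_map M N f" "null_map M N f'" shows "null_map M N (\<lambda>x. f x \<oplus>\<^bsub>N\<^esub> f' x)"
proof -
  from assms(1) obtain g where g: "lmod M" "lin (coind M) N g" "\<And>x. x \<in> carrier M \<Longrightarrow> g (eta M x) = f x"
    by (rule nullE) (rule that)
  from assms(2) obtain g' where g': "lin (coind M) N g'" "\<And>x. x \<in> carrier M \<Longrightarrow> g' (eta M x) = f' x"
    by (rule nullE) (rule that)
  show ?thesis by (rule nullI[OF g(1) lin_sum[OF g(2) g'(1)]]) (simp add: g(3) g'(2))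
qed

lemma null_minus:
  assumes "null_map M N f" shows "null_map M N (\<lambda>x. \<ominus>\<^bsub>N\<^esub> f x)"
  using null_comp_left[OF assms lin_minus[OF lin_id]] lin_cod[OF null_lin[OF assms]] by simp

lemma null_zero: "lmod M \<Longrightarrow> lmod N \<Longrightarrow> null_map M N (\<lambda>_. \<zero>\<^bsub>N\<^esub>)"
  by (rule nullI[of _ _ "\<lambda>_. \<zero>\<^bsub>N\<^esub>"]) (simp_all add: lin_const_zero)

lemma inj_mod_lmod: "inj_mod P \<Longrightarrow> lmod P"
  unfolding inj_mod_def by (blast dest: null_lin lin_dom)

lemma null_into_inj_mod: "inj_mod P \<Longrightarrow> lin M P k \<Longrightarrow> null_map M P k"
  unfolding inj_mod_def using null_comp_right by fastforce

lemma null_from_inj_mod: "inj_mod P \<Longrightarrow> lin P N h \<Longrightarrow> null_map P N h"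
  unfolding inj_mod_def using null_comp_left by fastforce

lemma inj_mod_coind:
  assumes [simp]: "lmod M" shows "inj_mod (coind M)"
proof -
  obtain g where "lin (coind (coind M)) (coind M) g"
    "\<And>a. a \<in> carrier (coind M) \<Longrightarrow> g (eta (coind M) a) = a"
    by (rule coind_injective[where A = "coind M" and M = M, OF lin_eta inj_eta lin_id]) (simp_all add: that)
  then show ?thesis unfolding inj_mod_def by (intro nullI[of _ _ g]) simp_all
qed

lemma inj_mod_retract:
  assumes "lin P Q i" "lin Q P r" "\<And>x. x \<in> carrier P \<Longrightarrow> r (i x) = x" "inj_mod Q"
  shows "inj_mod P"
  unfolding inj_mod_def
  by (rule null_cong[OF null_comp_left[OF null_into_inj_mod[OF assms(4,1)] assms(2)]])
    (simp add: assms(3))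

text \<open>The embedding \<open>\<eta> : A \<rightarrow> I(A)\<close> extends to \<open>B\<close> by injectivity of \<open>I(A)\<close>.\<close>

lemma null_extend:
  assumes f: "null_map A N f" and i: "lin A B i" and inj: "inj_on i (carrier A)"
  obtains f' where "null_map B N f'" "\<And>a. a \<in> carrier A \<Longrightarrow> f' (i a) = f a"
proof -
  from f obtain g where g: "lmod A" "lin (coind A) N g" "\<And>x. x \<in> carrier A \<Longrightarrow> g (eta A x) = f x"
    by (rule nullE) (rule that)
  obtain t where t: "lin B (coind A) t" "\<And>a. a \<in> carrier A \<Longrightarrow> t (i a) = eta A a"
    by (rule coind_injective[OF i inj lin_eta[OF g(1)] g(1)]) (rule that)
  show ?thesis
  proof (rule that)
    show "null_map B N (\<lambda>b. g (t b))"
      by (rule null_comp_right[OF t(1) null_from_inj_mod[OF inj_mod_coind[OF g(1)] g(2)]])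
  qed (simp add: t g)
qed

text \<open>The relation \<open>\<simeq>\<close>, with \<open>g\<close> moved to the other side so that proofs can do without
  subtraction.\<close>

definition stably_eq :: "('r, 'x) module \<Rightarrow> ('r, 'y) module \<Rightarrow> ('x \<Rightarrow> 'y) \<Rightarrow> ('x \<Rightarrow> 'y) \<Rightarrow> bool" where
  "stably_eq M N f g \<longleftrightarrow> lin M N f \<and> lin M N g \<and> (\<exists>n. null_map M N n \<and> (\<forall>x \<in> carrier M. f x = g x \<oplus>\<^bsub>N\<^esub> n x))"

lemma stably_eqI:
  assumes "lin M N g" "null_map M N n" "\<And>x. x \<in> carrier M \<Longrightarrow> f x = g x \<oplus>\<^bsub>N\<^esub> n x"
  shows "stably_eq M N f g"
  unfolding stably_eq_def using assms lin_cong[OF lin_sum[OF assms(1) null_lin[OF assms(2)]] assms(3)] by blast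

lemma stably_eqE:
  assumes "stably_eq M N f g"
  obtains n where "lin M N f" "lin M N g" "null_map M N n" "\<And>x. x \<in> carrier M \<Longrightarrow> f x = g x \<oplus>\<^bsub>N\<^esub> n x"
  using assms unfolding stably_eq_def by blast

lemma stably_eq_cong:
  "stably_eq M N f g \<Longrightarrow> (\<And>x. x \<in> carrier M \<Longrightarrow> f' x = f x) \<Longrightarrow> (\<And>x. x \<in> carrier M \<Longrightarrow> g' x = g x) \<Longrightarrow>
    stably_eq M N f' g'"
  by (erule stably_eqE) (rule stably_eqI[where n = n for n], erule lin_cong, auto)

lemma stably_eq_refl: "lin M N f \<Longrightarrow> stably_eq M N f f"
  by (rule stably_eqI[OF _ null_zero]) (auto simp: lin_dom lin_cod)

lemma stably_eq_sym:
  assumes "stably_eq M N f g" shows "stably_eq M N g f"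
proof -
  from assms obtain n where n: "lin M N f" "lin M N g" "null_map M N n"
    "\<And>x. x \<in> carrier M \<Longrightarrow> f x = g x \<oplus>\<^bsub>N\<^esub> n x" by (rule stably_eqE) (rule that)
  have [simp]: "lmod M" "lmod N" using n lin_dom lin_cod by auto
  show ?thesis
    by (rule stably_eqI[OF n(1) null_minus[OF n(3)]])
      (use n(2) null_lin[OF n(3)] in \<open>simp add: n(4) lmod_assoc\<close>)
qed

lemma stably_eq_trans:
  assumes "stably_eq M N f g" "stably_eq M N g h" shows "stably_eq M N f h"
proof -
  from assms(1) obtain n where n: "lin M N f" "lin M N g" "null_map M N n"
    "\<And>x. x \<in> carrier M \<Longrightarrow> f x = g x \<oplus>\<^bsub>N\<^esub> n x" by (rule stably_eqE) (rule that)
  from assms(2) obtain m where m: "lin M N h" "null_map M N m"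
    "\<And>x. x \<in> carrier M \<Longrightarrow> g x = h x \<oplus>\<^bsub>N\<^esub> m x" by (rule stably_eqE) (rule that)
  have [simp]: "lmod M" "lmod N" using n lin_dom lin_cod by auto
  show ?thesis
    by (rule stably_eqI[OF m(1) null_sum[OF m(2) n(3)]])
      (use m(1) null_lin[OF n(3)] null_lin[OF m(2)] in \<open>simp add: n(4) m(3) lmod_assoc\<close>)
qed

lemma stably_eq_comp_left:
  assumes "stably_eq M N f g" "lin N P h" shows "stably_eq M P (\<lambda>x. h (f x)) (\<lambda>x. h (g x))"
proof -
  from assms(1) obtain n where n: "lin M N f" "lin M N g" "null_map M N n"
    "\<And>x. x \<in> carrier M \<Longrightarrow> f x = g x \<oplus>\<^bsub>N\<^esub> n x" by (rule stably_eqE) (rule that)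
  show ?thesis
    by (rule stably_eqI[OF lin_comp[OF n(2) assms(2)] null_comp_left[OF n(3) assms(2)]])
      (use n(2) null_lin[OF n(3)] assms(2) in \<open>simp add: n(4) lin_add\<close>)
qed

lemma stably_eq_comp_right:
  assumes "lin M N h" "stably_eq N P f g" shows "stably_eq M P (\<lambda>x. f (h x)) (\<lambda>x. g (h x))"
proof -
  from assms(2) obtain n where n: "lin N P f" "lin N P g" "null_map N P n"
    "\<And>x. x \<in> carrier N \<Longrightarrow> f x = g x \<oplus>\<^bsub>P\<^esub> n x" by (rule stably_eqE) (rule that)
  show ?thesis
    by (rule stably_eqI[OF lin_comp[OF assms(1) n(2)] null_comp_right[OF assms(1) n(3)]])
      (use assms(1) in \<open>simp add: n(4)\<close>)
qed

definition stable_eqv :: "('r, 'x) module \<Rightarrow> ('r, 'y) module \<Rightarrow> ('x \<Rightarrow> 'y) \<Rightarrow> bool" where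
  "stable_eqv M N f \<longleftrightarrow> lin M N f \<and>
     (\<exists>h. lin N M h \<and> stably_eq M M (\<lambda>x. h (f x)) (\<lambda>x. x) \<and> stably_eq N N (\<lambda>y. f (h y)) (\<lambda>y. y))"

lemma stable_eqvI:
  assumes "lin M N f" "lin N M h" "stably_eq M M (\<lambda>x. h (f x)) (\<lambda>x. x)" "stably_eq N N (\<lambda>y. f (h y)) (\<lambda>y. y)"
  shows "stable_eqv M N f"
  using assms unfolding stable_eqv_def by blast

lemma stable_eqvE:
  assumes "stable_eqv M N f"
  obtains h where "lin M N f" "lin N M h"
    "stably_eq M M (\<lambda>x. h (f x)) (\<lambda>x. x)" "stably_eq N N (\<lambda>y. f (h y)) (\<lambda>y. y)"
  using assms unfolding stable_eqv_def by blast

lemma stable_eqv_lin: "stable_eqv M N f \<Longrightarrow> lin M N f"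
  unfolding stable_eqv_def by blast

lemma stable_eqv_comp:
  assumes "stable_eqv M N f" "stable_eqv N P g" shows "stable_eqv M P (\<lambda>x. g (f x))"
proof -
  from assms(1) obtain f' where f: "lin M N f" "lin N M f'"
    "stably_eq M M (\<lambda>x. f' (f x)) (\<lambda>x. x)" "stably_eq N N (\<lambda>y. f (f' y)) (\<lambda>y. y)" by (rule stable_eqvE) (rule that)
  from assms(2) obtain g' where g: "lin N P g" "lin P N g'"
    "stably_eq N N (\<lambda>x. g' (g x)) (\<lambda>x. x)" "stably_eq P P (\<lambda>y. g (g' y)) (\<lambda>y. y)" by (rule stable_eqvE) (rule that)
  show ?thesis
  proof (rule stable_eqvI[OF lin_comp[OF f(1) g(1)] lin_comp[OF g(2) f(2)]])
    show "stably_eq M M (\<lambda>x. f' (g' (g (f x)))) (\<lambda>x. x)"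
      by (rule stably_eq_trans[OF stably_eq_comp_left[OF stably_eq_comp_right[OF f(1) g(3)] f(2)] f(3)])
    show "stably_eq P P (\<lambda>x. g (f (f' (g' x)))) (\<lambda>x. x)"
      by (rule stably_eq_trans[OF stably_eq_comp_left[OF stably_eq_comp_right[OF g(2) f(4)] g(1)] g(4)])
  qed
qed

text \<open>If \<open>f'\<close> and \<open>k\<close> are stable inverses of \<open>f\<close> and of \<open>g f\<close>, then \<open>f k\<close> is one of \<open>g\<close>, as
  \<open>f k g \<simeq> f k g f f' \<simeq> f f' \<simeq> 1\<close>.\<close>

lemma stable_eqv_cancel_right:
  assumes "stable_eqv M N f" "stable_eqv M P (\<lambda>x. g (f x))" and g: "lin N P g" shows "stable_eqv N P g"
proof -
  from assms(1) obtain f' where f: "lin M N f" "lin N M f'"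
    "stably_eq M M (\<lambda>x. f' (f x)) (\<lambda>x. x)" "stably_eq N N (\<lambda>y. f (f' y)) (\<lambda>y. y)" by (rule stable_eqvE) (rule that)
  from assms(2) obtain k where k: "lin P M k"
    "stably_eq M M (\<lambda>x. k (g (f x))) (\<lambda>x. x)" "stably_eq P P (\<lambda>y. g (f (k y))) (\<lambda>y. y)" by (rule stable_eqvE) (rule that)
  show ?thesis
  proof (rule stable_eqvI[OF g lin_comp[OF k(1) f(1)] _ k(3)])
    have "stably_eq N N (\<lambda>y. f (k (g y))) (\<lambda>y. f (k (g (f (f' y)))))"
      by (rule stably_eq_sym[OF stably_eq_comp_left[OF f(4) lin_comp[OF lin_comp[OF g k(1)] f(1)]]])
    moreover have "stably_eq N N (\<lambda>y. f (k (g (f (f' y))))) (\<lambda>y. f (f' y))"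
      by (rule stably_eq_comp_left[OF stably_eq_comp_right[OF f(2) k(2)] f(1)])
    ultimately show "stably_eq N N (\<lambda>y. f (k (g y))) (\<lambda>y. y)" using f(4) by (blast intro: stably_eq_trans)
  qed
qed

lemma stable_eqv_cancel_left:
  assumes "stable_eqv N P g" "stable_eqv M P (\<lambda>x. g (f x))" and f: "lin M N f" shows "stable_eqv M N f"
proof -
  from assms(1) obtain g' where g: "lin N P g" "lin P N g'"
    "stably_eq N N (\<lambda>x. g' (g x)) (\<lambda>x. x)" "stably_eq P P (\<lambda>y. g (g' y)) (\<lambda>y. y)" by (rule stable_eqvE) (rule that)
  from assms(2) obtain k where k: "lin P M k"
    "stably_eq M M (\<lambda>x. k (g (f x))) (\<lambda>x. x)" "stably_eq P P (\<lambda>y. g (f (k y))) (\<lambda>y. y)" by (rule stable_eqvE) (rule that)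
  show ?thesis
  proof (rule stable_eqvI[OF f lin_comp[OF g(1) k(1)] k(2)])
    have "stably_eq N N (\<lambda>y. f (k (g y))) (\<lambda>y. g' (g (f (k (g y)))))"
      by (rule stably_eq_sym[OF stably_eq_comp_right[OF lin_comp[OF lin_comp[OF g(1) k(1)] f] g(3)]])
    moreover have "stably_eq N N (\<lambda>y. g' (g (f (k (g y))))) (\<lambda>y. g' (g y))"
      by (rule stably_eq_comp_left[OF stably_eq_comp_right[OF g(1) k(3)] g(2)])
    ultimately show "stably_eq N N (\<lambda>y. f (k (g y))) (\<lambda>y. y)" using g(3) by (blast intro: stably_eq_trans)
  qed
qed

lemma stable_eqv_iso:
  assumes f: "lin M N f" and bij: "bij_betw f (carrier M) (carrier N)"
  shows "stable_eqv M N f"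
proof (rule stable_eqvI[OF f lin_inv_into[OF f bij]])
  have [simp]: "lmod M" "lmod N" using f lin_dom lin_cod by auto
  show "stably_eq M M (\<lambda>x. inv_into (carrier M) f (f x)) (\<lambda>x. x)"
    by (rule stably_eq_cong[OF stably_eq_refl[OF lin_id]]) (use bij in \<open>auto simp: bij_betw_def\<close>)
  show "stably_eq N N (\<lambda>y. f (inv_into (carrier M) f y)) (\<lambda>y. y)"
    by (rule stably_eq_cong[OF stably_eq_refl[OF lin_id]]) (use bij in \<open>auto simp: bij_betw_def f_inv_into_f\<close>)
qed

lemma stable_eqv_inj_mod:
  assumes "inj_mod P" "inj_mod Q" and f: "lin P Q f" shows "stable_eqv P Q f"
proof -
  have [simp]: "lmod P" "lmod Q" using f lin_dom lin_cod by auto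
  have *: "stably_eq M M (\<lambda>x. \<zero>\<^bsub>M\<^esub>) (\<lambda>x. x)" if "inj_mod M" for M :: "('r, 'z) module"
  proof -
    have [simp]: "lmod M" using that by (rule inj_mod_lmod)
    show ?thesis
      by (rule stably_eqI[OF lin_id null_minus[OF that[unfolded inj_mod_def]]]) simp_all
  qed
  show ?thesis
  proof (rule stable_eqvI[OF f, of "\<lambda>_. \<zero>\<^bsub>P\<^esub>"])
    show "stably_eq Q Q (\<lambda>y. f \<zero>\<^bsub>P\<^esub>) (\<lambda>y. y)" using *[OF assms(2)] f by (simp add: lin_zero)
  qed (simp_all add: * assms lin_const_zero)
qed

lemma stable_eqv_dsum:
  assumes "stable_eqv M M' f" "stable_eqv N N' g"
  shows "stable_eqv (dsum M N) (dsum M' N') (\<lambda>p. (f (fst p), g (snd p)))"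
proof -
  from assms(1) obtain f' where f: "lin M M' f" "lin M' M f'"
    "stably_eq M M (\<lambda>x. f' (f x)) (\<lambda>x. x)" "stably_eq M' M' (\<lambda>y. f (f' y)) (\<lambda>y. y)" by (rule stable_eqvE) (rule that)
  from assms(2) obtain g' where g: "lin N N' g" "lin N' N g'"
    "stably_eq N N (\<lambda>x. g' (g x)) (\<lambda>x. x)" "stably_eq N' N' (\<lambda>y. g (g' y)) (\<lambda>y. y)" by (rule stable_eqvE) (rule that)
  have l: "lin (dsum A B) (dsum A' B') (\<lambda>p. (a (fst p), b (snd p)))"
    if "lin A A' a" "lin B B' b"
    for A :: "('r, 'p) module" and A' :: "('r, 'q) module" and B :: "('r, 's) module"
      and B' :: "('r, 't) module" and a b
    by (intro lin_pair lin_comp[OF lin_fst] lin_comp[OF lin_snd] that)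
      (use that in \<open>auto dest: lin_dom lin_cod\<close>)
  have s: "stably_eq (dsum A B) (dsum A B) (\<lambda>p. (a (fst p), b (snd p))) (\<lambda>p. p)"
    if a: "stably_eq A A a (\<lambda>x. x)" and b: "stably_eq B B b (\<lambda>x. x)"
    for A :: "('r, 'p) module" and B :: "('r, 's) module" and a b
  proof -
    from a obtain n where n: "lin A A a" "null_map A A n" "\<And>x. x \<in> carrier A \<Longrightarrow> a x = x \<oplus>\<^bsub>A\<^esub> n x"
      by (rule stably_eqE) (rule that)
    from b obtain m where m: "lin B B b" "null_map B B m" "\<And>x. x \<in> carrier B \<Longrightarrow> b x = x \<oplus>\<^bsub>B\<^esub> m x"
      by (rule stably_eqE) (rule that)
    have [simp]: "lmod A" "lmod B" using n(1) m(1) lin_dom by auto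
    have "null_map (dsum A B) (dsum A B) (\<lambda>p. (n (fst p), \<zero>\<^bsub>B\<^esub>) \<oplus>\<^bsub>dsum A B\<^esub> (\<zero>\<^bsub>A\<^esub>, m (snd p)))"
      by (intro null_sum null_comp_right[OF lin_fst] null_comp_right[OF lin_snd]
          null_comp_left[OF n(2)] null_comp_left[OF m(2)] lin_pair lin_id lin_const_zero) simp_all
    then show ?thesis
      by (rule stably_eqI[OF lin_id, rotated])
        (use null_lin[OF n(2)] null_lin[OF m(2)] in \<open>auto simp: n(3) m(3)\<close>)
  qed
  show ?thesis
  proof (rule stable_eqvI[OF l[OF f(1) g(1)] l[OF f(2) g(2)]])
    show "stably_eq (dsum M N) (dsum M N) (\<lambda>x. (f' (fst (f (fst x), g (snd x))), g' (snd (f (fst x), g (snd x))))) (\<lambda>x. x)"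
      using s[OF f(3) g(3)] by simp
    show "stably_eq (dsum M' N') (dsum M' N') (\<lambda>y. (f (fst (f' (fst y), g' (snd y))), g (snd (f' (fst y), g' (snd y))))) (\<lambda>y. y)"
      using s[OF f(4) g(4)] by simp
  qed
qed

section \<open>Short exact sequences\<close>

definition ses :: "('r, 'x) module \<Rightarrow> ('r, 'y) module \<Rightarrow> ('r, 'z) module \<Rightarrow> ('x \<Rightarrow> 'y) \<Rightarrow> ('y \<Rightarrow> 'z) \<Rightarrow> bool" where
  "ses A B C f g \<longleftrightarrow> lin A B f \<and> lin B C g \<and> inj_on f (carrier A) \<and> g ` carrier B = carrier C \<and>
     (\<forall>b \<in> carrier B. g b = \<zero>\<^bsub>C\<^esub> \<longleftrightarrow> b \<in> f ` carrier A)"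

lemma sesD:
  assumes "ses A B C f g"
  shows "lin A B f" "lin B C g" "inj_on f (carrier A)" "g ` carrier B = carrier C"
    "\<And>b. b \<in> carrier B \<Longrightarrow> g b = \<zero>\<^bsub>C\<^esub> \<Longrightarrow> b \<in> f ` carrier A"
    "\<And>a. a \<in> carrier A \<Longrightarrow> g (f a) = \<zero>\<^bsub>C\<^esub>"
  using assms unfolding ses_def by (auto dest: lin_in)

lemma ses_cokernel_exists:
  fixes B :: "('r, 'y) module"
  assumes f: "lin A B f" and inj: "inj_on f (carrier A)"
  obtains C :: "('r, 'y) module" and q where "ses A B C f q"
proof -
  obtain C :: "('r, 'y) module" and q where "lin B C q" "q ` carrier B = carrier C"
    "\<And>b. b \<in> carrier B \<Longrightarrow> q b = \<zero>\<^bsub>C\<^esub> \<longleftrightarrow> b \<in> f ` carrier A"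
    by (rule cokernel_exists[OF f]) (rule that)
  then have "ses A B C f q" unfolding ses_def using f inj by blast
  then show ?thesis by (rule that)
qed

text \<open>An injective \<open>X\<close> splits off: for a retraction \<open>r\<close> of \<open>f\<close> the map \<open>1 - f r\<close> kills the image of
  \<open>f\<close>, so it is \<open>t g\<close> for a section \<open>t\<close> of \<open>g\<close>, and \<open>1 = f r + t g\<close> on \<open>Y\<close>.\<close>

lemma ses_inj_mod:
  assumes s: "ses X Y Z f g" and X: "inj_mod X"
  shows "inj_mod Y \<longleftrightarrow> inj_mod Z"
proof -
  note f = sesD(1)[OF s] and g = sesD(2)[OF s] and inj = sesD(3)[OF s]
  have [simp]: "lmod X" "lmod Y" "lmod Z" using f g lin_dom lin_cod by auto
  obtain r where r: "null_map Y X r" "\<And>a. a \<in> carrier X \<Longrightarrow> r (f a) = a"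
    by (rule null_extend[OF X[unfolded inj_mod_def] f inj]) (rule that)
  note r_lin = null_lin[OF r(1)]
  let ?e = "\<lambda>y. y \<oplus>\<^bsub>Y\<^esub> \<ominus>\<^bsub>Y\<^esub> f (r y)"
  have e: "lin Y Y ?e" by (intro lin_sum lin_minus lin_comp[OF r_lin f] lin_id) simp
  obtain t where t: "lin Z Y t" "\<And>y. y \<in> carrier Y \<Longrightarrow> t (g y) = ?e y"
  proof (rule lin_factor_surj[OF g sesD(4)[OF s] e])
    fix b assume "b \<in> carrier Y" "g b = \<zero>\<^bsub>Z\<^esub>"
    then obtain a where "a \<in> carrier X" "b = f a" using sesD(5)[OF s] by blast
    then show "?e b = \<zero>\<^bsub>Y\<^esub>" using f by (simp add: r)
  qed (rule that)
  show ?thesis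
  proof
    assume Y: "inj_mod Y"
    show "inj_mod Z"
    proof (rule inj_mod_retract[OF t(1) g _ Y])
      fix z assume "z \<in> carrier Z"
      then obtain y where "y \<in> carrier Y" "z = g y" using sesD(4)[OF s] by blast
      then show "g (t z) = z" using g f r_lin sesD(6)[OF s] by (simp add: t lin_simps)
    qed
  next
    assume Z: "inj_mod Z"
    have "null_map Y Y (\<lambda>y. f (r y) \<oplus>\<^bsub>Y\<^esub> t (g y))"
      by (intro null_sum null_comp_left[OF r(1) f] null_comp_left[OF null_into_inj_mod[OF Z g] t(1)])
    then show "inj_mod Y" unfolding inj_mod_def
      by (rule null_cong) (use f r_lin in \<open>simp add: t\<close>)
  qed
qed

text \<open>Null maps on \<open>M\<close> extend along \<open>i\<close>, so a stable retraction of \<open>i\<close> can be corrected to a strict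
  one.  The complementary idempotent of \<open>B\<close> is then null, and the identity of \<open>C\<close> factors through
  it.\<close>

lemma stable_eqv_cokernel_inj_mod:
  assumes s: "ses M B C i q" and i: "stable_eqv M B i"
  shows "inj_mod C"
proof -
  note il = sesD(1)[OF s] and ql = sesD(2)[OF s] and inj = sesD(3)[OF s]
  have [simp]: "lmod M" "lmod B" "lmod C" using il ql lin_dom lin_cod by auto
  from i obtain r where r: "lin B M r" "stably_eq M M (\<lambda>x. r (i x)) (\<lambda>x. x)" "stably_eq B B (\<lambda>y. i (r y)) (\<lambda>y. y)"
    by (rule stable_eqvE) (rule that)
  from r(2) obtain n where n: "null_map M M n" "\<And>x. x \<in> carrier M \<Longrightarrow> r (i x) = x \<oplus>\<^bsub>M\<^esub> n x"
    by (rule stably_eqE) (rule that)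
  from r(3) obtain m where m: "null_map B B m" "\<And>x. x \<in> carrier B \<Longrightarrow> i (r x) = x \<oplus>\<^bsub>B\<^esub> m x"
    by (rule stably_eqE) (rule that)
  obtain n' where n': "null_map B M n'" "\<And>x. x \<in> carrier M \<Longrightarrow> n' (i x) = n x"
    by (rule null_extend[OF n(1) il inj]) (rule that)
  note lins = null_lin[OF n(1)] null_lin[OF m(1)] null_lin[OF n'(1)] il ql r(1)
  \<comment> \<open>The stable retraction \<open>r\<close> is corrected by a null map to a retraction \<open>r'\<close>; then \<open>e = i r' - 1\<close>
    is null, and it induces minus a section of \<open>q\<close>.\<close>
  let ?r' = "\<lambda>b. r b \<oplus>\<^bsub>M\<^esub> \<ominus>\<^bsub>M\<^esub> n' b"
  let ?e = "\<lambda>b. m b \<oplus>\<^bsub>B\<^esub> \<ominus>\<^bsub>B\<^esub> i (n' b)"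
  have e_null: "null_map B B ?e" by (intro null_sum m(1) null_minus null_comp_left[OF n'(1) il])
  have e_eq: "b \<oplus>\<^bsub>B\<^esub> ?e b = i (?r' b)" if "b \<in> carrier B" for b
  proof -
    have "b \<oplus>\<^bsub>B\<^esub> ?e b = (b \<oplus>\<^bsub>B\<^esub> m b) \<oplus>\<^bsub>B\<^esub> \<ominus>\<^bsub>B\<^esub> i (n' b)" using that lins by (simp add: lmod_assoc)
    then show ?thesis using that lins by (simp add: lin_add lin_neg flip: m(2))
  qed
  have e_ker: "?e (i x) = \<zero>\<^bsub>B\<^esub>" if "x \<in> carrier M" for x
  proof -
    have "i x \<oplus>\<^bsub>B\<^esub> ?e (i x) = i x \<oplus>\<^bsub>B\<^esub> \<zero>\<^bsub>B\<^esub>"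
      using e_eq[of "i x"] that lins by (simp add: n(2) n'(2) lmod_assoc)
    then show ?thesis using that lins by (simp only: lmod_l_cancel lmod_add_closed lmod_neg_closed
      lmod_zero_closed lin_in \<open>lmod B\<close>)
  qed
  have qe: "q (?e b) = \<ominus>\<^bsub>C\<^esub> q b" if "b \<in> carrier B" for b
  proof -
    have "q (b \<oplus>\<^bsub>B\<^esub> ?e b) = \<zero>\<^bsub>C\<^esub>" unfolding e_eq[OF that] using that lins sesD(6)[OF s] by simp
    then have "q (?e b) \<oplus>\<^bsub>C\<^esub> q b = \<zero>\<^bsub>C\<^esub>"
      using that lins null_lin[OF e_null] by (simp add: lin_add[OF ql] lmod_comm del: lmod_eq_neg_iff)
    then show ?thesis using that lins by (simp add: lmod_eq_neg_iff)
  qed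
  obtain t where t: "lin C B t" "\<And>b. b \<in> carrier B \<Longrightarrow> t (q b) = ?e b"
  proof (rule lin_factor_surj[OF ql sesD(4)[OF s] null_lin[OF e_null]])
    fix b assume "b \<in> carrier B" "q b = \<zero>\<^bsub>C\<^esub>"
    then obtain x where "x \<in> carrier M" "b = i x" using sesD(5)[OF s] by blast
    then show "?e b = \<zero>\<^bsub>B\<^esub>" using e_ker by simp
  qed (rule that)
  have "null_map C C (\<lambda>c. q (?e (t c)))"
    by (rule null_comp_left[OF null_comp_right[OF t(1) e_null] ql])
  then show "inj_mod C"
    unfolding inj_mod_def
  proof (rule null_cong)
    fix c assume "c \<in> carrier C"
    then obtain b where b: "b \<in> carrier B" "c = q b" using sesD(4)[OF s] by blast
    have eb: "?e b \<in> carrier B" using b lins by simp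
    show "c = q (?e (t c))"
      using b eb by (simp only: qe t) (use b lins in \<open>simp add: lin_in[OF ql]\<close>)
  qed
qed

text \<open>The cokernels form an exact sequence by the snake lemma; its left-hand map is injective because
  the right vertical map is.\<close>

lemma ses_cokernels:
  assumes top: "ses A B C f g" and bot: "ses A' B' C' f' g'"
    and a: "ses A A' QA a qa" and b: "ses B B' QB b qb" and c: "ses C C' QC c qc"
    and left: "\<And>x. x \<in> carrier A \<Longrightarrow> f' (a x) = b (f x)"
    and right: "\<And>x. x \<in> carrier B \<Longrightarrow> g' (b x) = c (g x)"
  obtains f'' g'' where "ses QA QB QC f'' g''"
proof -
  note lins = sesD(1,2)[OF top] sesD(1,2)[OF bot] sesD(1,2)[OF a] sesD(1,2)[OF b] sesD(1,2)[OF c]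
  have [simp]: "lmod A" "lmod B" "lmod C" "lmod A'" "lmod B'" "lmod C'" "lmod QA" "lmod QB" "lmod QC"
    using lins lin_dom lin_cod by blast+
  obtain f'' where f'': "lin QA QB f''" "\<And>x. x \<in> carrier A' \<Longrightarrow> f'' (qa x) = qb (f' x)"
  proof (rule lin_factor_surj[OF lins(6) sesD(4)[OF a] lin_comp[OF lins(3) lins(8)]])
    fix x assume "x \<in> carrier A'" "qa x = \<zero>\<^bsub>QA\<^esub>"
    then obtain y where "y \<in> carrier A" "x = a y" using sesD(5)[OF a] by blast
    then show "qb (f' x) = \<zero>\<^bsub>QB\<^esub>" using lins sesD(6)[OF b] by (simp add: left)
  qed (rule that)
  obtain g'' where g'': "lin QB QC g''" "\<And>x. x \<in> carrier B' \<Longrightarrow> g'' (qb x) = qc (g' x)"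
  proof (rule lin_factor_surj[OF lins(8) sesD(4)[OF b] lin_comp[OF lins(4) lins(10)]])
    fix x assume "x \<in> carrier B'" "qb x = \<zero>\<^bsub>QB\<^esub>"
    then obtain y where "y \<in> carrier B" "x = b y" using sesD(5)[OF b] by blast
    then show "qc (g' x) = \<zero>\<^bsub>QC\<^esub>" using lins sesD(6)[OF c] by (simp add: right)
  qed (rule that)
  have "ses QA QB QC f'' g''"
    unfolding ses_def
  proof (intro conjI f'' g'')
    show "inj_on f'' (carrier QA)"
      unfolding inj_on_lin_iff[OF f''(1)]
    proof (intro ballI impI)
      fix z assume "z \<in> carrier QA" and z0: "f'' z = \<zero>\<^bsub>QB\<^esub>"
      then obtain x where x: "x \<in> carrier A'" "z = qa x" using sesD(4)[OF a] by blast
      with z0 have "qb (f' x) = \<zero>\<^bsub>QB\<^esub>" by (simp add: f'')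
      then obtain y where y: "y \<in> carrier B" "f' x = b y" using sesD(5)[OF b] x lins by (metis imageE lin_in)
      have "c (g y) = g' (f' x)" using y right by simp
      also have "\<dots> = \<zero>\<^bsub>C'\<^esub>" using x sesD(6)[OF bot] by simp
      finally have "g y = \<zero>\<^bsub>C\<^esub>"
        using sesD(3)[OF c] y lins unfolding inj_on_lin_iff[OF lins(9)] by simp
      then obtain w where w: "w \<in> carrier A" "y = f w" using sesD(5)[OF top] y by blast
      have "f' x = f' (a w)" using y w left by simp
      then have "x = a w" using sesD(3)[OF bot] x w lins by (meson inj_onD lin_in)
      then show "z = \<zero>\<^bsub>QA\<^esub>" using x w sesD(6)[OF a] by simp
    qed
    show "g'' ` carrier QB = carrier QC"
    proof
      show "g'' ` carrier QB \<subseteq> carrier QC" using g''(1) by auto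
      show "carrier QC \<subseteq> g'' ` carrier QB"
      proof
        fix z assume "z \<in> carrier QC"
        then obtain x where x: "x \<in> carrier C'" "z = qc x" using sesD(4)[OF c] by blast
        then obtain y where y: "y \<in> carrier B'" "x = g' y" using sesD(4)[OF bot] by blast
        have "z = g'' (qb y)" using x y g'' by simp
        then show "z \<in> g'' ` carrier QB" using y lins by (simp add: image_eqI)
      qed
    qed
    show "\<forall>z \<in> carrier QB. g'' z = \<zero>\<^bsub>QC\<^esub> \<longleftrightarrow> z \<in> f'' ` carrier QA"
    proof (intro ballI iffI)
      fix z assume "z \<in> carrier QB" and z0: "g'' z = \<zero>\<^bsub>QC\<^esub>"
      then obtain x where x: "x \<in> carrier B'" "z = qb x" using sesD(4)[OF b] by blast
      with z0 have "qc (g' x) = \<zero>\<^bsub>QC\<^esub>" by (simp add: g'')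
      then obtain y where y: "y \<in> carrier C" "g' x = c y" using sesD(5)[OF c] x lins by (metis imageE lin_in)
      then obtain w where w: "w \<in> carrier B" "y = g w" using sesD(4)[OF top] by blast
      have "g' (x \<oplus>\<^bsub>B'\<^esub> \<ominus>\<^bsub>B'\<^esub> b w) = \<zero>\<^bsub>C'\<^esub>" using x y w lins by (simp add: lin_add lin_neg right)
      then obtain v where v: "v \<in> carrier A'" "x \<oplus>\<^bsub>B'\<^esub> \<ominus>\<^bsub>B'\<^esub> b w = f' v"
        using sesD(5)[OF bot] x w lins by (metis imageE lin_in lmod_add_closed lmod_neg_closed \<open>lmod B'\<close>)
      have "f'' (qa v) = qb (x \<oplus>\<^bsub>B'\<^esub> \<ominus>\<^bsub>B'\<^esub> b w)" using v f'' by simp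
      also have "\<dots> = qb x" using x w lins sesD(6)[OF b] by (simp add: lin_add lin_neg)
      finally show "z \<in> f'' ` carrier QA" using x v lins by (metis imageI lin_in)
    next
      fix z assume "z \<in> carrier QB" "z \<in> f'' ` carrier QA"
      then obtain y where "y \<in> carrier QA" "z = f'' y" by blast
      moreover then obtain x where "x \<in> carrier A'" "y = qa x" using sesD(4)[OF a] by blast
      ultimately show "g'' z = \<zero>\<^bsub>QC\<^esub>" using f'' g'' lins sesD(6)[OF bot] by (simp add: lin_zero)
    qed
  qed
  then show ?thesis by (rule that)
qed

lemma ses_dsum:
  assumes s: "ses A B C f g" and t: "ses A' B' C' f' g'"
  shows "ses (dsum A A') (dsum B B') (dsum C C') (\<lambda>p. (f (fst p), f' (snd p))) (\<lambda>p. (g (fst p), g' (snd p)))"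
proof -
  note lins = sesD(1,2)[OF s] sesD(1,2)[OF t]
  have [simp]: "lmod A" "lmod B" "lmod C" "lmod A'" "lmod B'" "lmod C'"
    using lins lin_dom lin_cod by blast+
  show ?thesis
    unfolding ses_def
  proof (intro conjI)
    show "lin (dsum A A') (dsum B B') (\<lambda>p. (f (fst p), f' (snd p)))"
      by (intro lin_pair lin_comp[OF lin_fst] lin_comp[OF lin_snd] lins) simp_all
    show "lin (dsum B B') (dsum C C') (\<lambda>p. (g (fst p), g' (snd p)))"
      by (intro lin_pair lin_comp[OF lin_fst] lin_comp[OF lin_snd] lins) simp_all
    show "inj_on (\<lambda>p. (f (fst p), f' (snd p))) (carrier (dsum A A'))"
      using sesD(3)[OF s] sesD(3)[OF t] by (auto simp: inj_on_def)
    show "(\<lambda>p. (g (fst p), g' (snd p))) ` carrier (dsum B B') = carrier (dsum C C')"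
      using sesD(4)[OF s] sesD(4)[OF t] by (force simp: image_def)
    show "\<forall>b \<in> carrier (dsum B B'). (g (fst b), g' (snd b)) = \<zero>\<^bsub>dsum C C'\<^esub> \<longleftrightarrow>
        b \<in> (\<lambda>p. (f (fst p), f' (snd p))) ` carrier (dsum A A')"
      using s t unfolding ses_def by (force simp: image_def)
  qed
qed

lemma ses_coind:
  assumes s: "ses A B C f g" shows "ses (coind A) (coind B) (coind C) (cmap f) (cmap g)"
proof -
  note f = sesD(1)[OF s] and g = sesD(2)[OF s] and inj = sesD(3)[OF s]
  have [simp]: "lmod A" "lmod B" "lmod C" using f g lin_dom lin_cod by blast+
  note fl = lin_cmap[OF f] and gl = lin_cmap[OF g]
  show ?thesis
    unfolding ses_def
  proof (intro conjI fl gl cmap_surj[OF g sesD(4)[OF s]])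
    show "inj_on (cmap f) (carrier (coind A))"
    proof (rule inj_onI)
      fix \<phi> \<psi> assume p: "\<phi> \<in> carrier (coind A)" "\<psi> \<in> carrier (coind A)" "cmap f \<phi> = cmap f \<psi>"
      show "\<phi> = \<psi>"
      proof (rule coind_eqI[OF p(1,2)])
        fix r assume r: "r \<in> carrier R"
        from fun_cong[OF p(3), of r] r have "f (\<phi> r) = f (\<psi> r)" by simp
        then show "\<phi> r = \<psi> r" using inj p r by (meson inj_onD coind_in)
      qed
    qed
    show "\<forall>\<phi> \<in> carrier (coind B). cmap g \<phi> = \<zero>\<^bsub>coind C\<^esub> \<longleftrightarrow> \<phi> \<in> cmap f ` carrier (coind A)"
    proof (intro ballI iffI)
      fix \<phi> assume p: "\<phi> \<in> carrier (coind B)" and 0: "cmap g \<phi> = \<zero>\<^bsub>coind C\<^esub>"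
      have "\<exists>x. x \<in> carrier A \<and> f x = \<phi> r" if r: "r \<in> carrier R" for r
      proof -
        from fun_cong[OF 0, of r] r have "g (\<phi> r) = \<zero>\<^bsub>C\<^esub>" by simp
        then show ?thesis using sesD(5)[OF s, of "\<phi> r"] p r by auto
      qed
      then obtain \<psi> where \<psi>: "\<And>r. r \<in> carrier R \<Longrightarrow> \<psi> r \<in> carrier A"
        "\<And>r. r \<in> carrier R \<Longrightarrow> f (\<psi> r) = \<phi> r" by metis
      have eqI: "x = y" if "f x = f y" "x \<in> carrier A" "y \<in> carrier A" for x y
        using that inj by (simp add: inj_on_def)
      have "(\<lambda>r\<in>carrier R. \<psi> r) \<in> carrier (coind A)"
        by (rule coindI; (rule eqI)?)
          (use \<psi> f p in \<open>simp_all add: coind_app_add coind_app_F lin_add lin_smult\<close>)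
      moreover from this have "\<phi> = cmap f (\<lambda>r\<in>carrier R. \<psi> r)"
        by (intro coind_eqI[of _ B]) (use p \<psi> fl in simp_all)
      ultimately show "\<phi> \<in> cmap f ` carrier (coind A)" by blast
    next
      fix \<phi> assume "\<phi> \<in> cmap f ` carrier (coind A)"
      then obtain \<psi> where p: "\<psi> \<in> carrier (coind A)" "\<phi> = cmap f \<psi>" by blast
      show "cmap g \<phi> = \<zero>\<^bsub>coind C\<^esub>"
        unfolding p(2) by (rule coind_eqI[of _ C]) (use p sesD(6)[OF s] fl gl in simp_all)
    qed
  qed
qed

lemma inj_mod_dsum:
  assumes "inj_mod P" "inj_mod Q" shows "inj_mod (dsum P Q)"
proof -
  have [simp]: "lmod P" "lmod Q" using assms inj_mod_lmod by auto
  have "null_map (dsum P Q) (dsum P Q) (\<lambda>p. (fst p, \<zero>\<^bsub>Q\<^esub>) \<oplus>\<^bsub>dsum P Q\<^esub> (\<zero>\<^bsub>P\<^esub>, snd p))"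
    by (intro null_sum null_comp_left[OF null_into_inj_mod[OF assms(1) lin_fst]]
        null_comp_left[OF null_into_inj_mod[OF assms(2) lin_snd]] lin_pair lin_id lin_const_zero) simp_all
  then show ?thesis unfolding inj_mod_def by (rule null_cong) auto
qed

lemma lin_corestrict:
  assumes i: "lin M B i" and inj: "inj_on i (carrier M)" and e: "lin D B e"
    and im: "\<And>b. b \<in> carrier D \<Longrightarrow> e b \<in> i ` carrier M"
  obtains r where "lin D M r" "\<And>b. b \<in> carrier D \<Longrightarrow> i (r b) = e b"
proof -
  have [simp]: "lmod M" "lmod B" "lmod D" using i e lin_dom lin_cod by blast+
  have "\<exists>x. x \<in> carrier M \<and> i x = e b" if "b \<in> carrier D" for b using im[OF that] by (metis imageE)
  then obtain r where r: "\<And>b. b \<in> carrier D \<Longrightarrow> r b \<in> carrier M"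
    "\<And>b. b \<in> carrier D \<Longrightarrow> i (r b) = e b" by metis
  have eqI: "x = y" if "i x = i y" "x \<in> carrier M" "y \<in> carrier M" for x y
    using that inj by (simp add: inj_on_def)
  show ?thesis
  proof (rule that[OF _ r(2)])
    show "lin D M r"
      by (rule linI; (rule eqI)?) (use r i e in \<open>simp_all add: lin_add lin_smult\<close>)
  qed
qed

text \<open>The other projection factors through the injective module \<open>P\<close>, so it is null.\<close>

lemma stable_eqv_fst:
  assumes [simp]: "lmod N" and P: "inj_mod P" shows "stable_eqv (dsum N P) N fst"
proof -
  have [simp]: "lmod P" using P by (rule inj_mod_lmod)
  show ?thesis
  proof (rule stable_eqvI[OF lin_fst])
    show "lin N (dsum N P) (\<lambda>x. (x, \<zero>\<^bsub>P\<^esub>))" by (intro lin_pair lin_id lin_const_zero) simp_all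
    show "stably_eq N N (\<lambda>y. fst (y, \<zero>\<^bsub>P\<^esub>)) (\<lambda>y. y)" by (simp add: stably_eq_refl lin_id)
    have "null_map (dsum N P) (dsum N P) (\<lambda>p. (\<zero>\<^bsub>N\<^esub>, \<ominus>\<^bsub>P\<^esub> snd p))"
      by (rule null_comp_left[OF null_into_inj_mod[OF P lin_snd]])
        (intro lin_pair lin_minus lin_id lin_const_zero | simp)+
    then show "stably_eq (dsum N P) (dsum N P) (\<lambda>x. (fst x, \<zero>\<^bsub>P\<^esub>)) (\<lambda>x. x)"
      by (rule stably_eqI[OF lin_id, rotated]) auto
  qed simp_all
qed

text \<open>The map \<open>(f, \<eta>) : M \<rightarrow> N \<oplus> I(M)\<close>, whose cokernel is the mapping cone of \<open>f\<close>.\<close>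

lemma lin_cone_map: "lin M N f \<Longrightarrow> lin M (dsum N (coind M)) (\<lambda>x. (f x, eta M x))"
  by (intro lin_pair lin_eta) (auto dest: lin_dom)

lemma inj_cone_map: "lin M N f \<Longrightarrow> inj_on (\<lambda>x. (f x, eta M x)) (carrier M)"
  using inj_eta[of M] by (auto simp: inj_on_def dest: lin_dom)

text \<open>Injectivity and projectivity tested on modules in the same type as \<open>P\<close>, in terms of linear
  maps.\<close>

definition inj_univ :: "('r, 'm) module \<Rightarrow> bool" where
  "inj_univ P \<longleftrightarrow> lmod P \<and> (\<forall>(A :: ('r, 'm) module) (B :: ('r, 'm) module) i f. lin A B i \<and> inj_on i (carrier A) \<and> lin A P f \<longrightarrow>
     (\<exists>g. lin B P g \<and> (\<forall>x \<in> carrier A. g (i x) = f x)))"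

definition proj_univ :: "('r, 'm) module \<Rightarrow> bool" where
  "proj_univ P \<longleftrightarrow> lmod P \<and> (\<forall>(B :: ('r, 'm) module) (C :: ('r, 'm) module) e f.
     lin B C e \<and> e ` carrier B = carrier C \<and> lin P C f \<longrightarrow>
     (\<exists>g. lin P B g \<and> (\<forall>x \<in> carrier P. e (g x) = f x)))"

lemma inj_mod_imp_inj_univ:
  assumes P: "inj_mod P" shows "inj_univ P"
  unfolding inj_univ_def
proof (intro conjI inj_mod_lmod[OF P] allI impI)
  fix A B :: "('r, 'a) module" and i f
  assume h: "lin A B i \<and> inj_on i (carrier A) \<and> lin A P f"
  have n: "null_map A P f" using null_into_inj_mod[OF P] h by blast
  obtain g where "null_map B P g" "\<And>a. a \<in> carrier A \<Longrightarrow> g (i a) = f a"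
    by (rule null_extend[OF n, of B i]) (use h in \<open>auto intro: that\<close>)
  then show "\<exists>g. lin B P g \<and> (\<forall>x \<in> carrier A. g (i x) = f x)"
    by (blast intro: null_lin)
qed

end

section \<open>Finite modules over a quasi-Frobenius ring\<close>

text \<open>The infinite type \<open>'m\<close> is the universe in which the carriers of the objects lie.\<close>

locale finite_ring_universe = ring_over_division_subring R F for R :: "('r, 'b) ring_scheme" and F +
  fixes U :: "'m itself"
  assumes inf_univ: "infinite (UNIV :: 'm set)"
    and fin_R: "finite (carrier R)"
begin

text \<open>An injection exists whenever \<open>B\<close> is finite, since \<open>'m\<close> is infinite.\<close>

definition transport_map :: "('r, 'x) module \<Rightarrow> 'x \<Rightarrow> 'm" where
  "transport_map B = (SOME f. inj_on f (carrier B))"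

definition transport :: "('r, 'x) module \<Rightarrow> ('r, 'm) module" where
  "transport B = img_mod B (transport_map B)"

lemma transport:
  assumes B: "lmod B" "finite (carrier B)"
  shows "lin B (transport B) (transport_map B)"
    and "bij_betw (transport_map B) (carrier B) (carrier (transport B))"
    and "finite (carrier (transport B))"
proof -
  obtain Y :: "'m set" where "finite Y" "card Y = card (carrier B)"
    using infinite_arbitrarily_large[OF inf_univ] by metis
  then obtain f where "bij_betw f (carrier B) Y"
    using finite_same_card_bij[OF B(2)] by metis
  then have "\<exists>f :: _ \<Rightarrow> 'm. inj_on f (carrier B)" unfolding bij_betw_def by blast
  then have inj: "inj_on (transport_map B) (carrier B)" unfolding transport_map_def by (rule someI_ex)
  show "lin B (transport B) (transport_map B)"
    unfolding transport_def by (rule lin_img_mod_inj[OF B(1) inj])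
  show "bij_betw (transport_map B) (carrier B) (carrier (transport B))"
    using inj by (simp add: transport_def bij_betw_def)
  show "finite (carrier (transport B))" using B by (simp add: transport_def)
qed

lemma transport_inverse:
  assumes B: "lmod B" "finite (carrier B)"
  obtains k where "lin (transport B) B k"
    "\<And>x. x \<in> carrier B \<Longrightarrow> k (transport_map B x) = x"
    "\<And>y. y \<in> carrier (transport B) \<Longrightarrow> transport_map B (k y) = y"
proof (rule that[OF lin_inv_into[OF transport(1,2)[OF B]]])
  note bij = transport(2)[OF B]
  show "inv_into (carrier B) (transport_map B) (transport_map B x) = x" if "x \<in> carrier B" for x
    using bij that by (simp add: bij_betw_def)
  show "transport_map B (inv_into (carrier B) (transport_map B) y) = y"
    if "y \<in> carrier (transport B)" for y
    using bij that by (simp add: bij_betw_def f_inv_into_f)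
qed

lemma inj_mod_transport_iff:
  assumes B: "lmod B" "finite (carrier B)"
  shows "inj_mod (transport B) \<longleftrightarrow> inj_mod B"
proof -
  obtain k where k: "lin (transport B) B k"
    "\<And>x. x \<in> carrier B \<Longrightarrow> k (transport_map B x) = x"
    "\<And>y. y \<in> carrier (transport B) \<Longrightarrow> transport_map B (k y) = y"
    by (rule transport_inverse[OF B]) (rule that)
  note t = transport(1)[OF B]
  show ?thesis
    using inj_mod_retract[OF t k(1)] inj_mod_retract[OF k(1) t] k(2,3) by blast
qed

end

locale finite_frobenius = finite_ring_universe R F U
  for R :: "('r, 'b) ring_scheme" and F and U :: "'m itself" +
  assumes frobenius: "\<And>P :: ('r, 'm) module. proj_univ P \<longleftrightarrow> inj_univ P"

context finite_ring_universe begin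

text \<open>\<open>I(P)\<close> is finite, so it has a copy in the universe, and injectivity of \<open>P\<close> splits the embedding
  of \<open>P\<close> in this copy.\<close>

lemma inj_univ_imp_inj_mod:
  assumes P: "inj_univ P" and fin: "finite (carrier P)"
  shows "inj_mod (P :: ('r, 'm) module)"
proof -
  have [simp]: "lmod P" using P by (simp add: inj_univ_def)
  let ?I = "coind P"
  have I: "lmod ?I" "finite (carrier ?I)" using fin fin_R by (simp_all add: finite_coind)
  let ?i = "\<lambda>x. transport_map ?I (eta P x)"
  have i: "lin P (transport ?I) ?i" by (rule lin_comp[OF lin_eta transport(1)[OF I]]) simp
  have inj: "inj_on ?i (carrier P)"
  proof (rule inj_onI)
    fix x y assume xy: "x \<in> carrier P" "y \<in> carrier P" "?i x = ?i y"
    have "eta P x \<in> carrier ?I" "eta P y \<in> carrier ?I" using lin_in[OF lin_eta[OF \<open>lmod P\<close>]] xy(1,2) by blast+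
    then have "eta P x = eta P y"
      using xy(3) transport(2)[OF I] unfolding bij_betw_def by (meson inj_onD)
    then show "x = y" using xy inj_eta[of P] by (meson inj_onD \<open>lmod P\<close>)
  qed
  have "\<exists>g. lin (transport ?I) P g \<and> (\<forall>x \<in> carrier P. g (?i x) = x)"
    using P i inj lin_id[OF \<open>lmod P\<close>] unfolding inj_univ_def by blast
  then obtain g where g: "lin (transport ?I) P g" "\<forall>x \<in> carrier P. g (?i x) = x" by blast
  have I_inj: "inj_mod (transport ?I)" using inj_mod_transport_iff[OF I] inj_mod_coind[of P] by simp
  show ?thesis by (rule inj_mod_retract[OF i g(1) _ I_inj]) (use g(2) in simp)
qed

end

context finite_frobenius begin

text \<open>Injective modules are projective: the lifting problem is transported to the universe, where the
  quasi-Frobenius property solves it.\<close>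

lemma inj_mod_lift:
  assumes P: "inj_mod P" and fin: "finite (carrier P)" "finite (carrier B)"
    and e: "lin B C e" and surj: "e ` carrier B = carrier C" and f: "lin P C f"
  obtains g where "lin P B g" "\<And>x. x \<in> carrier P \<Longrightarrow> e (g x) = f x"
proof -
  have finC: "finite (carrier C)" using fin(2) surj by (metis finite_imageI)
  have lm: "lmod P" "lmod B" "lmod C" using e f lin_dom lin_cod by blast+
  note tP = transport[OF lm(1) fin(1)] and tB = transport[OF lm(2) fin(2)] and tC = transport[OF lm(3) finC]
  obtain kP where kP: "lin (transport P) P kP" "\<And>x. x \<in> carrier P \<Longrightarrow> kP (transport_map P x) = x"
    by (rule transport_inverse[OF lm(1) fin(1)]) (rule that)
  obtain kB where kB: "lin (transport B) B kB" "\<And>x. x \<in> carrier B \<Longrightarrow> kB (transport_map B x) = x"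
    by (rule transport_inverse[OF lm(2) fin(2)]) (rule that)
  obtain kC where kC: "\<And>x. x \<in> carrier C \<Longrightarrow> kC (transport_map C x) = x"
    "\<And>y. y \<in> carrier (transport C) \<Longrightarrow> transport_map C (kC y) = y" "lin (transport C) C kC"
    by (rule transport_inverse[OF lm(3) finC]) (rule that)
  have "proj_univ (transport P)"
    unfolding frobenius by (rule inj_mod_imp_inj_univ) (simp add: inj_mod_transport_iff lm fin P)
  moreover have e': "lin (transport B) (transport C) (\<lambda>b. transport_map C (e (kB b)))"
    by (rule lin_comp[OF lin_comp[OF kB(1) e] tC(1)])
  moreover have "(\<lambda>b. transport_map C (e (kB b))) ` carrier (transport B) = carrier (transport C)"
  proof
    show "(\<lambda>b. transport_map C (e (kB b))) ` carrier (transport B) \<subseteq> carrier (transport C)"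
      using e' by (auto simp: lin_def)
    show "carrier (transport C) \<subseteq> (\<lambda>b. transport_map C (e (kB b))) ` carrier (transport B)"
    proof
      fix y assume y: "y \<in> carrier (transport C)"
      then have "kC y \<in> carrier C" using kC(3) by simp
      then obtain b where b: "b \<in> carrier B" "e b = kC y" using surj by (metis imageE)
      show "y \<in> (\<lambda>b. transport_map C (e (kB b))) ` carrier (transport B)"
        by (rule image_eqI[of _ _ "transport_map B b"]) (use b y tB(1) in \<open>simp_all add: kB kC\<close>)
    qed
  qed
  moreover have "lin (transport P) (transport C) (\<lambda>p. transport_map C (f (kP p)))"
    by (rule lin_comp[OF lin_comp[OF kP(1) f] tC(1)])
  ultimately obtain g where g: "lin (transport P) (transport B) g"
    "\<forall>x \<in> carrier (transport P). transport_map C (e (kB (g x))) = transport_map C (f (kP x))"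
    unfolding proj_univ_def by blast
  show ?thesis
  proof (rule that[OF lin_comp[OF lin_comp[OF tP(1) g(1)] kB(1)]])
    fix x assume x: "x \<in> carrier P"
    then have tx: "transport_map P x \<in> carrier (transport P)" using tP(1) by simp
    have "e (kB (g (transport_map P x))) = kC (transport_map C (e (kB (g (transport_map P x)))))"
      using tx g(1) kB(1) e by (simp add: kC)
    also have "\<dots> = f x" using g(2) tx x f by (simp add: kP kC)
    finally show "e (kB (g (transport_map P x))) = f x" .
  qed
qed

text \<open>\<open>R\<close> is projective as a module, being free on \<open>1\<close>, hence injective by the quasi-Frobenius
  property.\<close>

lemma inj_mod_reg: "inj_mod reg"
proof -
  have fin: "finite (carrier reg)" by (simp add: fin_R)
  note t = transport[OF lmod_reg fin]
  obtain k where k: "lin (transport reg) reg k" "\<And>x. x \<in> carrier reg \<Longrightarrow> k (transport_map reg x) = x"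
    "\<And>y. y \<in> carrier (transport reg) \<Longrightarrow> transport_map reg (k y) = y"
    by (rule transport_inverse[OF lmod_reg fin]) (rule that)
  have k_in: "k x \<in> carrier R" if "x \<in> carrier (transport reg)" for x using lin_in[OF k(1) that] by simp
  have "proj_univ (transport reg)"
    unfolding proj_univ_def
  proof (intro conjI lin_cod[OF t(1)] allI impI)
    fix B C :: "('r, 'm) module" and e f
    assume h: "lin B C e \<and> e ` carrier B = carrier C \<and> lin (transport reg) C f"
    then have e: "lin B C e" and f: "lin (transport reg) C f" by blast+
    have [simp]: "lmod B" "lmod C" using e lin_dom lin_cod by blast+
    let ?u = "transport_map reg \<one>\<^bsub>R\<^esub>"
    have u: "?u \<in> carrier (transport reg)" using lin_in[OF t(1), of "\<one>\<^bsub>R\<^esub>"] by simp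
    then have "f ?u \<in> carrier C" using f by simp
    then obtain b where b: "b \<in> carrier B" "e b = f ?u" using h by (metis imageE)
    have "lin (transport reg) B (\<lambda>x. k x \<odot>\<^bsub>B\<^esub> b)"
    proof (rule linI[OF lin_cod[OF t(1)]])
      fix x y assume "x \<in> carrier (transport reg)" "y \<in> carrier (transport reg)"
      then show "k (x \<oplus>\<^bsub>transport reg\<^esub> y) \<odot>\<^bsub>B\<^esub> b = k x \<odot>\<^bsub>B\<^esub> b \<oplus>\<^bsub>B\<^esub> k y \<odot>\<^bsub>B\<^esub> b"
        using k(1) b by (simp add: lin_add[OF k(1)] lmod_smult_l_distr k_in)
    next
      fix a x assume "a \<in> carrier R" "x \<in> carrier (transport reg)"
      then show "k (a \<odot>\<^bsub>transport reg\<^esub> x) \<odot>\<^bsub>B\<^esub> b = a \<odot>\<^bsub>B\<^esub> (k x \<odot>\<^bsub>B\<^esub> b)"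
        using b by (simp add: lin_smult[OF k(1)] lmod_smult_assoc k_in)
    qed (use b k_in in simp_all)
    moreover have "e (k x \<odot>\<^bsub>B\<^esub> b) = f x" if x: "x \<in> carrier (transport reg)" for x
    proof -
      have "e (k x \<odot>\<^bsub>B\<^esub> b) = f (k x \<odot>\<^bsub>transport reg\<^esub> ?u)"
        using x b u e f k_in by (simp add: lin_smult[OF e] lin_smult[OF f])
      also have "k x \<odot>\<^bsub>transport reg\<^esub> ?u = transport_map reg (k x \<odot>\<^bsub>reg\<^esub> \<one>\<^bsub>R\<^esub>)"
        using k_in[OF x] lin_smult[OF t(1), of "k x" "\<one>\<^bsub>R\<^esub>"] by simp
      also have "\<dots> = x" using k_in[OF x] x by (simp add: k(3))
      finally show ?thesis .
    qed
    ultimately show "\<exists>g. lin (transport reg) B g \<and> (\<forall>x \<in> carrier (transport reg). e (g x) = f x)" by blast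
  qed
  then have "inj_mod (transport reg)" unfolding frobenius by (rule inj_univ_imp_inj_mod) (rule t(3))
  then show ?thesis using inj_mod_transport_iff[OF lmod_reg fin] by blast
qed

text \<open>A free module on the elements of \<open>X\<close>, built up one generator at a time and moved back into the
  universe at every step.  It is injective because \<open>R\<close> is.\<close>

lemma free_cover:
  fixes P :: "('r, 'm) module"
  assumes [simp]: "lmod P" and X: "finite X" "X \<subseteq> carrier P"
  shows "\<exists>(E :: ('r, 'm) module) p. inj_mod E \<and> finite (carrier E) \<and> lin E P p \<and> X \<subseteq> p ` carrier E"
  using X
proof (induction X rule: finite_induct)
  case empty
  have "inj_mod (zero_mod :: ('r, 'm) module)"
    unfolding inj_mod_def by (rule null_cong[OF null_zero[OF lmod_zero_mod lmod_zero_mod]]) simp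
  moreover have "finite (carrier (zero_mod :: ('r, 'm) module))" by simp
  ultimately show ?case using lin_const_zero[OF lmod_zero_mod \<open>lmod P\<close>] by blast
next
  case (insert x X)
  then obtain E :: "('r, 'm) module" and p where E: "inj_mod E" "finite (carrier E)" "lin E P p" "X \<subseteq> p ` carrier E"
    by auto
  have [simp]: "lmod E" using E(1) by (rule inj_mod_lmod)
  let ?D = "dsum E reg"
  have D: "lmod ?D" "finite (carrier ?D)" using E fin_R by simp_all
  have x: "x \<in> carrier P" using insert by simp
  have "lin reg P (\<lambda>r. r \<odot>\<^bsub>P\<^esub> x)"
    by (rule linI) (use x in \<open>simp_all add: lmod_smult_l_distr lmod_smult_assoc\<close>)
  note p' = lin_copair[OF E(3) this]
  obtain k where k: "lin (transport ?D) ?D k" "\<And>y. y \<in> carrier ?D \<Longrightarrow> k (transport_map ?D y) = y"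
    by (rule transport_inverse[OF D]) (rule that)
  let ?p = "\<lambda>y. p (fst (k y)) \<oplus>\<^bsub>P\<^esub> snd (k y) \<odot>\<^bsub>P\<^esub> x"
  have "inj_mod (transport ?D)" by (simp add: inj_mod_transport_iff D E inj_mod_dsum inj_mod_reg del: dsum_simps)
  moreover have "lin (transport ?D) P ?p" by (rule lin_comp[OF k(1) p'])
  moreover have "insert x X \<subseteq> ?p ` carrier (transport ?D)"
  proof
    fix y assume "y \<in> insert x X"
    then consider "y = x" | "y \<in> X" by blast
    then obtain d where d: "d \<in> carrier ?D" "y = p (fst d) \<oplus>\<^bsub>P\<^esub> snd d \<odot>\<^bsub>P\<^esub> x"
    proof cases
      case 1
      show ?thesis by (rule that[of "(\<zero>\<^bsub>E\<^esub>, \<one>\<^bsub>R\<^esub>)"]) (use 1 x E(3) in \<open>simp_all add: lin_zero\<close>)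
    next
      case 2
      then obtain u where "u \<in> carrier E" "y = p u" using E(4) by blast
      then show ?thesis by (intro that[of "(u, \<zero>\<^bsub>R\<^esub>)"]) (use x E(3) in simp_all)
    qed
    show "y \<in> ?p ` carrier (transport ?D)"
      by (rule image_eqI[of _ _ "transport_map ?D d"])
        (use d k(2)[OF d(1)] lin_in[OF transport(1)[OF D] d(1)] in simp_all)
  qed
  ultimately show ?case using transport(3)[OF D] by blast
qed

section \<open>Stable equivalences and mapping cones\<close>

text \<open>The injective module \<open>C\<close> is also projective, so \<open>q\<close> has a section \<open>t\<close> and \<open>B = i(M) \<oplus> t(C)\<close>;
  the projection to the injective summand is null.\<close>

lemma inj_mod_cokernel_stable_eqv:
  assumes s: "ses M B C i q" and fin: "finite (carrier B)" and C: "inj_mod C"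
  shows "stable_eqv M B i"
proof -
  note il = sesD(1)[OF s] and ql = sesD(2)[OF s] and inj = sesD(3)[OF s]
  have [simp]: "lmod M" "lmod B" "lmod C" using il ql lin_dom lin_cod by auto
  have finC: "finite (carrier C)" using fin sesD(4)[OF s] by (metis finite_imageI)
  obtain t where t: "lin C B t" "\<And>x. x \<in> carrier C \<Longrightarrow> q (t x) = x"
    by (rule inj_mod_lift[OF C finC fin ql sesD(4)[OF s] lin_id]) (simp_all add: that)
  note lins = il ql t(1)
  let ?e = "\<lambda>b. b \<oplus>\<^bsub>B\<^esub> \<ominus>\<^bsub>B\<^esub> t (q b)"
  have e: "lin B B ?e" by (intro lin_sum lin_minus lin_id lin_comp[OF ql t(1)]) simp
  obtain r where r: "lin B M r" "\<And>b. b \<in> carrier B \<Longrightarrow> i (r b) = ?e b"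
  proof (rule lin_corestrict[OF il inj e])
    fix b assume b: "b \<in> carrier B"
    show "?e b \<in> i ` carrier M"
      by (rule sesD(5)[OF s]) (use b lins in \<open>simp_all add: lin_add[OF ql] lin_neg[OF ql] t(2)\<close>)
  qed (rule that)
  show ?thesis
  proof (rule stable_eqvI[OF il r(1)])
    have ri: "r (i x) = x" if "x \<in> carrier M" for x
    proof -
      have "i (r (i x)) = i x" using that lins sesD(6)[OF s] by (simp add: r lin_zero[OF t(1)])
      then show ?thesis using inj that il r(1) by (meson inj_onD lin_in)
    qed
    show "stably_eq M M (\<lambda>x. r (i x)) (\<lambda>x. x)"
      by (rule stably_eq_cong[OF stably_eq_refl[OF lin_id]]) (simp_all add: ri)
    show "stably_eq B B (\<lambda>y. i (r y)) (\<lambda>y. y)"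
      by (rule stably_eqI[OF lin_id null_minus[OF null_comp_left[OF null_into_inj_mod[OF C ql] t(1)]]])
        (simp_all add: r)
  qed
qed

text \<open>\<open>f\<close> is \<open>(f, \<eta>)\<close> followed by the projection that forgets the injective summand \<open>I(M)\<close>, which is a
  stable equivalence.  So the question is reduced to the injection \<open>(f, \<eta>)\<close>.\<close>

lemma stable_eqv_iff_cone_inj_mod:
  assumes f: "lin M N f" and fin: "finite (carrier M)" "finite (carrier N)"
    and s: "ses M (dsum N (coind M)) Q (\<lambda>x. (f x, eta M x)) q"
  shows "stable_eqv M N f \<longleftrightarrow> inj_mod Q"
proof -
  have [simp]: "lmod M" "lmod N" using f lin_dom lin_cod by auto
  let ?i = "\<lambda>x. (f x, eta M x)"
  have p: "stable_eqv (dsum N (coind M)) N fst" by (rule stable_eqv_fst) (simp_all add: inj_mod_coind)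
  have "stable_eqv M N f \<longleftrightarrow> stable_eqv M (dsum N (coind M)) ?i"
    using stable_eqv_cancel_left[OF p, of M ?i] stable_eqv_comp[OF _ p, of M ?i] lin_cone_map[OF f] by auto
  also have "\<dots> \<longleftrightarrow> inj_mod Q"
    using stable_eqv_cokernel_inj_mod[OF s] inj_mod_cokernel_stable_eqv[OF s] fin fin_R by (auto simp: finite_coind)
  finally show ?thesis .
qed

text \<open>Since \<open>I\<close> is exact, the cones of \<open>a\<close>, \<open>b\<close> and \<open>c\<close> form a short exact sequence, and the first of
  them is injective.  Both the extension axiom and the gluing axiom are instances.\<close>

lemma ses_stable_eqv:
  fixes A :: "('r, 'x) module" and B :: "('r, 'y) module" and C :: "('r, 'z) module"
    and A' :: "('r, 'u) module" and B' :: "('r, 'v) module" and C' :: "('r, 'w) module"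
  assumes top: "ses A B C f g" and bot: "ses A' B' C' f' g'"
    and lins: "lin A A' a" "lin B B' b" "lin C C' c"
    and left: "\<And>x. x \<in> carrier A \<Longrightarrow> f' (a x) = b (f x)"
    and right: "\<And>x. x \<in> carrier B \<Longrightarrow> g' (b x) = c (g x)"
    and fin: "finite (carrier B)" "finite (carrier B')"
    and a: "stable_eqv A A' a"
  shows "stable_eqv B B' b \<longleftrightarrow> stable_eqv C C' c"
proof -
  have finA: "finite (carrier A)"
    using fin(1) sesD(1,3)[OF top] by (auto simp: lin_def intro: inj_on_finite)
  have finA': "finite (carrier A')"
    using fin(2) sesD(1,3)[OF bot] by (auto simp: lin_def intro: inj_on_finite)
  have finC: "finite (carrier C)" using fin(1) sesD(4)[OF top] by (metis finite_imageI)
  have finC': "finite (carrier C')" using fin(2) sesD(4)[OF bot] by (metis finite_imageI)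
  obtain QA :: "('r, 'u \<times> ('r \<Rightarrow> 'x)) module" and qa where
    qa: "ses A (dsum A' (coind A)) QA (\<lambda>x. (a x, eta A x)) qa"
    by (rule ses_cokernel_exists[OF lin_cone_map inj_cone_map, OF lins(1) lins(1)]) (rule that)
  obtain QB :: "('r, 'v \<times> ('r \<Rightarrow> 'y)) module" and qb where
    qb: "ses B (dsum B' (coind B)) QB (\<lambda>x. (b x, eta B x)) qb"
    by (rule ses_cokernel_exists[OF lin_cone_map inj_cone_map, OF lins(2) lins(2)]) (rule that)
  obtain QC :: "('r, 'w \<times> ('r \<Rightarrow> 'z)) module" and qc where
    qc: "ses C (dsum C' (coind C)) QC (\<lambda>x. (c x, eta C x)) qc"
    by (rule ses_cokernel_exists[OF lin_cone_map inj_cone_map, OF lins(3) lins(3)]) (rule that)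
  obtain f'' g'' where "ses QA QB QC f'' g''"
  proof (rule ses_cokernels[OF top ses_dsum[OF bot ses_coind[OF top]] qa qb qc])
    fix x assume "x \<in> carrier A"
    then show "(f' (fst (a x, eta A x)), cmap f (snd (a x, eta A x))) = (b (f x), eta B (f x))"
      using sesD(1)[OF top] by (simp add: left cmap_eta)
  next
    fix x assume "x \<in> carrier B"
    then show "(g' (fst (b x, eta B x)), cmap g (snd (b x, eta B x))) = (c (g x), eta C (g x))"
      using sesD(2)[OF top] by (simp add: right cmap_eta)
  qed (rule that)
  moreover have "inj_mod QA" using stable_eqv_iff_cone_inj_mod[OF lins(1) finA finA' qa] a by simp
  ultimately have "inj_mod QB \<longleftrightarrow> inj_mod QC" by (rule ses_inj_mod)
  then show ?thesis
    using stable_eqv_iff_cone_inj_mod[OF lins(2) fin qb] stable_eqv_iff_cone_inj_mod[OF lins(3) finC finC' qc] by simp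
qed

end

context ring_over_division_subring begin

section \<open>Arrows of module categories as linear maps\<close>

definition arr :: "('r, 'm) module \<Rightarrow> ('r, 'm) module \<Rightarrow> ('m \<Rightarrow> 'm) \<Rightarrow> ('r, 'm) module_arrow" where
  "arr M N f = (M, N, restrict f (carrier M))"

lemma arr_eq_iff: "arr M N f = arr M' N' g \<longleftrightarrow> M = M' \<and> N = N' \<and> (\<forall>x \<in> carrier M. f x = g x)"
  unfolding arr_def by (auto simp: restrict_def fun_eq_iff; metis)

lemma lmodule_hom_iff: "lmod M \<Longrightarrow> lmod N \<Longrightarrow>
    f \<in> lmodule_hom R M N \<longleftrightarrow> lin M N f \<and> f \<in> extensional (carrier M)"
  by (auto simp: lmodule_hom_def lin_def PiE_def)

context
  fixes A :: "('r, 'm) module set"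
begin

abbreviation "mc \<equiv> module_category_on R A"

lemma mc_simps [simp]:
  "Dom mc (arr M N f) = M" "Cod mc (arr M N f) = N" "Id mc M = arr M M (\<lambda>x. x)"
  "Obj mc = {M \<in> A. lmod M}"
  by (simp_all add: module_category_on_def arr_def)

lemma Arr_iff: "\<alpha> \<in> Arr mc \<longleftrightarrow> (\<exists>M N f. M \<in> A \<and> N \<in> A \<and> lin M N f \<and> \<alpha> = arr M N f)"
proof
  assume "\<alpha> \<in> Arr mc"
  then obtain M N f where \<alpha>: "\<alpha> = (M, N, f)" "M \<in> A" "N \<in> A" "lmod M" "lmod N" "f \<in> lmodule_hom R M N"
    by (auto simp: module_category_on_def)
  then have "lin M N f" "\<alpha> = arr M N f" by (simp_all add: lmodule_hom_iff arr_def extensional_restrict)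
  with \<alpha> show "\<exists>M N f. M \<in> A \<and> N \<in> A \<and> lin M N f \<and> \<alpha> = arr M N f" by blast
next
  assume "\<exists>M N f. M \<in> A \<and> N \<in> A \<and> lin M N f \<and> \<alpha> = arr M N f"
  then obtain M N f where \<alpha>: "M \<in> A" "N \<in> A" "lin M N f" "\<alpha> = arr M N f" by blast
  have "lin M N (restrict f (carrier M))" by (rule lin_cong[OF \<alpha>(3)]) simp
  with \<alpha> show "\<alpha> \<in> Arr mc"
    using lin_dom[OF \<alpha>(3)] lin_cod[OF \<alpha>(3)]
    by (simp add: module_category_on_def arr_def lmodule_hom_iff)
qed

lemma ArrE:
  assumes "\<alpha> \<in> Arr mc"
  obtains M N f where "M \<in> A" "N \<in> A" "lin M N f" "\<alpha> = arr M N f"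
  using assms by (auto simp: Arr_iff)

lemma Hom_iff: "\<alpha> \<in> Hom mc M N \<longleftrightarrow> M \<in> A \<and> N \<in> A \<and> (\<exists>f. lin M N f \<and> \<alpha> = arr M N f)"
  by (auto simp: Hom_def Arr_iff arr_eq_iff)

lemma HomE:
  assumes "\<alpha> \<in> Hom mc M N"
  obtains f where "M \<in> A" "N \<in> A" "lin M N f" "\<alpha> = arr M N f"
  using assms by (auto simp: Hom_iff)

lemma Bex_Hom: "M \<in> A \<Longrightarrow> N \<in> A \<Longrightarrow> (\<exists>\<alpha> \<in> Hom mc M N. Q \<alpha>) \<longleftrightarrow> (\<exists>f. lin M N f \<and> Q (arr M N f))"
  unfolding Bex_def Hom_iff by blast

lemma arr_Arr [simp]: "M \<in> A \<Longrightarrow> N \<in> A \<Longrightarrow> lin M N f \<Longrightarrow> arr M N f \<in> Arr mc"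
  and arr_Hom [simp]: "M \<in> A \<Longrightarrow> N \<in> A \<Longrightarrow> lin M N f \<Longrightarrow> arr M N f \<in> Hom mc M N"
  by (auto simp: Arr_iff Hom_iff)

lemma comp_arr [simp]: "lin M N f \<Longrightarrow> arr N P g \<cdot>\<^bsub>mc\<^esub> arr M N f = arr M P (\<lambda>x. g (f x))"
  by (simp add: module_category_on_def arr_def compose_def restrict_def fun_eq_iff)

lemma category_mc: "category mc"
proof
  fix \<alpha> assume "\<alpha> \<in> Arr mc"
  then obtain M N f where \<alpha>: "M \<in> A" "N \<in> A" "lin M N f" "\<alpha> = arr M N f" by (rule ArrE)
  then show "Dom mc \<alpha> \<in> Obj mc" "Cod mc \<alpha> \<in> Obj mc" by (auto dest: lin_dom lin_cod)
next
  fix X assume "X \<in> Obj mc" then show "Id mc X \<in> Hom mc X X" by (simp add: lin_id)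
next
  fix \<alpha> G X Y Z assume "\<alpha> \<in> Hom mc X Y" "G \<in> Hom mc Y Z"
  then obtain f g where "X \<in> A" "Y \<in> A" "Z \<in> A" "lin X Y f" "\<alpha> = arr X Y f" "lin Y Z g" "G = arr Y Z g"
    by (auto elim!: HomE)
  then show "G \<cdot>\<^bsub>mc\<^esub> \<alpha> \<in> Hom mc X Z" by (simp add: lin_comp[of X Y f Z g])
next
  fix \<alpha> X Y assume "\<alpha> \<in> Hom mc X Y"
  then obtain f where "X \<in> A" "Y \<in> A" "lin X Y f" "\<alpha> = arr X Y f" by (rule HomE)
  then show "\<alpha> \<cdot>\<^bsub>mc\<^esub> Id mc X = \<alpha>" "Id mc Y \<cdot>\<^bsub>mc\<^esub> \<alpha> = \<alpha>" by (simp_all add: lin_id lin_dom)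
next
  fix \<alpha> G H W X Y Z assume "\<alpha> \<in> Hom mc W X" "G \<in> Hom mc X Y" "H \<in> Hom mc Y Z"
  then obtain f g h where "lin W X f" "\<alpha> = arr W X f" "lin X Y g" "G = arr X Y g"
    "lin Y Z h" "H = arr Y Z h" by (auto elim!: HomE)
  then show "(H \<cdot>\<^bsub>mc\<^esub> G) \<cdot>\<^bsub>mc\<^esub> \<alpha> = H \<cdot>\<^bsub>mc\<^esub> (G \<cdot>\<^bsub>mc\<^esub> \<alpha>)"
    by (simp add: lin_comp[of W X f Y g])
qed

lemma iso_arrow_bij:
  assumes "iso_arrow mc (arr M N f)" "lin M N f"
  shows "bij_betw f (carrier M) (carrier N)"
proof -
  obtain g where g: "lin N M g" "arr M M (\<lambda>x. g (f x)) = arr M M (\<lambda>x. x)"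
    "arr N N (\<lambda>x. f (g x)) = arr N N (\<lambda>x. x)"
    using assms by (auto simp: iso_arrow_def elim!: HomE)
  then show ?thesis
    by (intro bij_betwI[of _ _ _ g]) (use assms(2) in \<open>auto simp: arr_eq_iff\<close>)
qed

lemma injective_imp_monic:
  assumes \<alpha>: "arr M N f \<in> Arr mc" "lin M N f" and inj: "inj_on f (carrier M)"
  shows "monic mc (arr M N f)"
  unfolding monic_def
proof (intro conjI ballI impI \<alpha>(1))
  fix W G H assume "G \<in> Hom mc W (Dom mc (arr M N f))" "H \<in> Hom mc W (Dom mc (arr M N f))"
    and eq: "arr M N f \<cdot>\<^bsub>mc\<^esub> G = arr M N f \<cdot>\<^bsub>mc\<^esub> H"
  then obtain g h where gh: "lin W M g" "G = arr W M g" "lin W M h" "H = arr W M h"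
    by (auto elim!: HomE)
  with eq have "\<forall>x \<in> carrier W. f (g x) = f (h x)" by (simp add: arr_eq_iff)
  then show "G = H" using gh inj by (auto simp: arr_eq_iff inj_on_def)
qed

lemma surjective_imp_epic:
  assumes \<alpha>: "arr M N f \<in> Arr mc" "lin M N f" and surj: "f ` carrier M = carrier N"
  shows "epic mc (arr M N f)"
  unfolding epic_def
proof (intro conjI ballI impI \<alpha>(1))
  fix W G H assume "G \<in> Hom mc (Cod mc (arr M N f)) W" "H \<in> Hom mc (Cod mc (arr M N f)) W"
    and eq: "G \<cdot>\<^bsub>mc\<^esub> arr M N f = H \<cdot>\<^bsub>mc\<^esub> arr M N f"
  then obtain g h where gh: "lin N W g" "G = arr N W g" "lin N W h" "H = arr N W h"
    by (auto elim!: HomE)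
  with eq \<alpha> have "\<forall>x \<in> carrier M. g (f x) = h (f x)" by (simp add: arr_eq_iff)
  then have "\<forall>y \<in> carrier N. g y = h y" using surj by (metis imageE)
  then show "G = H" using gh by (simp add: arr_eq_iff)
qed

text \<open>The projection to the cokernel agrees with zero after composition with \<open>f\<close>.\<close>

lemma epic_imp_surjective:
  assumes quot: "\<And>D q. lin N D q \<Longrightarrow> q ` carrier N = carrier D \<Longrightarrow> D \<in> A"
    and \<alpha>: "epic mc (arr M N f)" "lin M N f" "N \<in> A"
  shows "f ` carrier M = carrier N"
proof -
  have [simp]: "lmod M" "lmod N" using \<alpha> lin_dom lin_cod by blast+
  obtain D :: "('r, 'm) module" and q where q: "lin N D q" "q ` carrier N = carrier D"
    "\<And>b. b \<in> carrier N \<Longrightarrow> q b = \<zero>\<^bsub>D\<^esub> \<longleftrightarrow> b \<in> f ` carrier M"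
    by (rule cokernel_exists[OF \<alpha>(2)]) (rule that)
  have D: "D \<in> A" "lmod D" using quot q lin_cod by blast+
  have z: "lin N D (\<lambda>_. \<zero>\<^bsub>D\<^esub>)" by (rule lin_const_zero) (simp_all add: D)
  have "arr N D q \<cdot>\<^bsub>mc\<^esub> arr M N f = arr N D (\<lambda>_. \<zero>\<^bsub>D\<^esub>) \<cdot>\<^bsub>mc\<^esub> arr M N f"
    using \<alpha> q by (simp add: arr_eq_iff)
  then have "arr N D q = arr N D (\<lambda>_. \<zero>\<^bsub>D\<^esub>)"
    using \<alpha>(1,3) q(1) z D unfolding epic_def by simp
  then have "\<forall>b \<in> carrier N. q b = \<zero>\<^bsub>D\<^esub>" by (simp add: arr_eq_iff)
  then have "carrier N \<subseteq> f ` carrier M" using q(3) by blast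
  then show ?thesis using \<alpha>(2) by (auto simp: lin_def)
qed

end

text \<open>The whole carrier generates, with coefficients \<open>1\<close> at \<open>x\<close> and \<open>0\<close> elsewhere.\<close>

lemma finite_imp_finitely_generated:
  assumes M: "lmod M" and fin: "finite (carrier M)"
  shows "finitely_generated R M"
proof -
  interpret M: abelian_group M by (rule lmod_abelian_group[OF M])
  have "\<exists>c \<in> carrier M \<rightarrow> carrier R. x = (\<Oplus>\<^bsub>M\<^esub>s\<in>carrier M. c s \<odot>\<^bsub>M\<^esub> s)" if x: "x \<in> carrier M" for x
  proof (rule bexI[of _ "\<lambda>s. if x = s then \<one>\<^bsub>R\<^esub> else \<zero>\<^bsub>R\<^esub>"])
    have "(\<Oplus>\<^bsub>M\<^esub>s\<in>carrier M. (if x = s then \<one>\<^bsub>R\<^esub> else \<zero>\<^bsub>R\<^esub>) \<odot>\<^bsub>M\<^esub> s) =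
        (\<Oplus>\<^bsub>M\<^esub>s\<in>carrier M. if x = s then s else \<zero>\<^bsub>M\<^esub>)"
      by (rule M.finsum_cong') (use M in auto)
    also have "\<dots> = x" using M.finsum_singleton[OF x fin, of "\<lambda>s. s"] by simp
    finally show "x = (\<Oplus>\<^bsub>M\<^esub>s\<in>carrier M. (if x = s then \<one>\<^bsub>R\<^esub> else \<zero>\<^bsub>R\<^esub>) \<odot>\<^bsub>M\<^esub> s)" by simp
  qed simp
  then show ?thesis unfolding finitely_generated_def using fin by blast
qed

end

lemma finitely_generated_imp_finite:
  assumes M: "left_module R M" and fin: "finite (carrier R)" and fg: "finitely_generated R M"
  shows "finite (carrier M)"
proof -
  interpret left_module R M by (rule M)
  obtain S where S: "finite S" "S \<subseteq> carrier M"
    "\<And>x. x \<in> carrier M \<Longrightarrow> \<exists>c \<in> S \<rightarrow> carrier R. x = (\<Oplus>\<^bsub>M\<^esub>s\<in>S. c s \<odot>\<^bsub>M\<^esub> s)"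
    using fg unfolding finitely_generated_def by blast
  have "carrier M \<subseteq> (\<lambda>c. \<Oplus>\<^bsub>M\<^esub>s\<in>S. c s \<odot>\<^bsub>M\<^esub> s) ` (S \<rightarrow>\<^sub>E carrier R)"
  proof
    fix x assume "x \<in> carrier M"
    then obtain c where c: "c \<in> S \<rightarrow> carrier R" "x = (\<Oplus>\<^bsub>M\<^esub>s\<in>S. c s \<odot>\<^bsub>M\<^esub> s)" using S(3) by blast
    have "(\<Oplus>\<^bsub>M\<^esub>s\<in>S. c s \<odot>\<^bsub>M\<^esub> s) = (\<Oplus>\<^bsub>M\<^esub>s\<in>S. restrict c S s \<odot>\<^bsub>M\<^esub> s)"
      by (rule M.finsum_cong') (use S c in \<open>auto intro!: lsmult_closed\<close>)
    then show "x \<in> (\<lambda>c. \<Oplus>\<^bsub>M\<^esub>s\<in>S. c s \<odot>\<^bsub>M\<^esub> s) ` (S \<rightarrow>\<^sub>E carrier R)"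
      using c by (intro image_eqI[of _ _ "restrict c S"]) auto
  qed
  then show ?thesis using S(1) fin by (meson finite_PiE finite_imageI finite_subset)
qed

context finite_ring_universe begin

abbreviation FM :: "('r, 'm) module set" where "FM \<equiv> {M. finitely_generated R M}"

lemma FM_iff: "lmod M \<Longrightarrow> M \<in> FM \<longleftrightarrow> finite (carrier M)"
  using finite_imp_finitely_generated finitely_generated_imp_finite fin_R by auto

lemma FM_surj: "lin M N f \<Longrightarrow> f ` carrier M = carrier N \<Longrightarrow> M \<in> FM \<Longrightarrow> N \<in> FM"
  using FM_iff[of M] FM_iff[of N] lin_dom[of M N f] lin_cod[of M N f] by (metis finite_imageI)

text \<open>\<open>R\<close> is a generator: elements \<open>x\<close> and \<open>y\<close> with the same image give two maps \<open>R \<rightarrow> M\<close>, namely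
  \<open>r \<mapsto> r x\<close> and \<open>r \<mapsto> r y\<close>, that agree after composition with \<open>f\<close>.\<close>

lemma monic_imp_injective:
  fixes M N :: "('r, 'm) module"
  assumes reg: "transport reg \<in> A"
    and \<alpha>: "monic (mc A) (arr M N f)" "lin M N f" "M \<in> A"
  shows "inj_on f (carrier M)"
proof (rule inj_onI)
  fix x y assume xy: "x \<in> carrier M" "y \<in> carrier M" and eq: "f x = f y"
  have [simp]: "lmod M" "lmod N" using \<alpha> lin_dom lin_cod by blast+
  have fin: "finite (carrier reg)" by (simp add: fin_R)
  obtain k where k: "lin (transport reg) reg k" "\<And>x. x \<in> carrier reg \<Longrightarrow> k (transport_map reg x) = x"
    by (rule transport_inverse[OF lmod_reg fin]) (rule that)
  have k_in: "k r \<in> carrier R" if "r \<in> carrier (transport reg)" for r using lin_in[OF k(1) that] by simp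
  have l: "lin (transport reg) M (\<lambda>r. k r \<odot>\<^bsub>M\<^esub> z)" if z: "z \<in> carrier M" for z
  proof -
    have "lin reg M (\<lambda>r. r \<odot>\<^bsub>M\<^esub> z)"
      by (rule linI) (use z in \<open>simp_all add: lmod_smult_l_distr lmod_smult_assoc\<close>)
    from lin_comp[OF k(1) this] show ?thesis .
  qed
  have "arr M N f \<cdot>\<^bsub>mc A\<^esub> arr (transport reg) M (\<lambda>r. k r \<odot>\<^bsub>M\<^esub> x) =
      arr M N f \<cdot>\<^bsub>mc A\<^esub> arr (transport reg) M (\<lambda>r. k r \<odot>\<^bsub>M\<^esub> y)"
    using l xy \<alpha>(2) eq k_in by (simp add: arr_eq_iff lin_smult)
  moreover have "transport reg \<in> Obj (mc A)" using reg lin_dom[OF k(1)] by simp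
  ultimately have "arr (transport reg) M (\<lambda>r. k r \<odot>\<^bsub>M\<^esub> x) = arr (transport reg) M (\<lambda>r. k r \<odot>\<^bsub>M\<^esub> y)"
    using \<alpha>(1,3) l[OF xy(1)] l[OF xy(2)] reg unfolding monic_def by simp
  moreover have "transport_map reg \<one>\<^bsub>R\<^esub> \<in> carrier (transport reg)"
    using lin_in[OF transport(1)[OF lmod_reg fin], of "\<one>\<^bsub>R\<^esub>"] by simp
  ultimately have "k (transport_map reg \<one>\<^bsub>R\<^esub>) \<odot>\<^bsub>M\<^esub> x = k (transport_map reg \<one>\<^bsub>R\<^esub>) \<odot>\<^bsub>M\<^esub> y"
    by (auto simp: arr_eq_iff)
  then show "x = y" using xy by (simp add: k(2))
qed

lemma transport_reg_FM: "transport reg \<in> FM"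
  using FM_iff[OF lin_cod[OF transport(1)[OF lmod_reg]]] transport(3)[OF lmod_reg] fin_R by simp

lemma monic_iff:
  assumes "M \<in> FM" "N \<in> FM" "lin M N f"
  shows "monic (mc FM) (arr M N f) \<longleftrightarrow> inj_on f (carrier M)"
  using monic_imp_injective[OF transport_reg_FM _ assms(3,1)]
    injective_imp_monic[OF arr_Arr[OF assms] assms(3)] by (rule iffI)

lemma epic_iff:
  assumes "M \<in> FM" "N \<in> FM" "lin M N f"
  shows "epic (mc FM) (arr M N f) \<longleftrightarrow> f ` carrier M = carrier N"
proof
  assume e: "epic (mc FM) (arr M N f)"
  show "f ` carrier M = carrier N"
  proof (rule epic_imp_surjective[OF _ e assms(3,2)])
    show "D \<in> FM" if "lin N D q" "q ` carrier N = carrier D" for D q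
      using FM_surj[OF that assms(2)] .
  qed
next
  assume "f ` carrier M = carrier N"
  then show "epic (mc FM) (arr M N f)"
    using surjective_imp_epic[OF arr_Arr[OF assms] assms(3)] by blast
qed

lemma projective_modules_iff:
  "projective_object (modules R) P \<longleftrightarrow> proj_univ (P :: ('r, 'm) module)"
proof -
  have epic: "epic (modules R) (arr M N f) \<longleftrightarrow> f ` carrier M = carrier N"
    if "lin M N f" for M N :: "('r, 'm) module" and f
    using epic_imp_surjective[where A = UNIV and M = M and N = N and f = f]
      surjective_imp_epic[OF arr_Arr[OF UNIV_I UNIV_I that] that] that
    unfolding modules_def by blast
  show ?thesis
  proof
    assume P: "projective_object (modules R) P"
    show "proj_univ P"
      unfolding proj_univ_def
    proof (intro conjI allI impI)
      show "lmod P" using P by (simp add: projective_object_def modules_def)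
      fix B C :: "('r, 'm) module" and e f
      assume h: "lin B C e \<and> e ` carrier B = carrier C \<and> lin P C f"
      then have "epic (modules R) (arr B C e)" using epic by blast
      moreover have "arr P C f \<in> Hom (modules R) P (Cod (modules R) (arr B C e))"
        using h by (simp add: modules_def)
      ultimately obtain G where "G \<in> Hom (modules R) P (Dom (modules R) (arr B C e))"
        "arr B C e \<cdot>\<^bsub>modules R\<^esub> G = arr P C f"
        using P unfolding projective_object_def by blast
      then show "\<exists>g. lin P B g \<and> (\<forall>x \<in> carrier P. e (g x) = f x)"
        unfolding modules_def by (auto elim!: HomE simp: arr_eq_iff)
    qed
  next
    assume P: "proj_univ P"
    show "projective_object (modules R) P"
      unfolding projective_object_def
    proof (intro conjI allI impI)
      show "P \<in> Obj (modules R)" using P by (simp add: proj_univ_def modules_def)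
      fix E \<alpha> assume h: "epic (modules R) E \<and> \<alpha> \<in> Hom (modules R) P (Cod (modules R) E)"
      then have "E \<in> Arr (modules R)" by (simp add: epic_def)
      then obtain B C e where E: "lin B C e" "E = arr B C e" unfolding modules_def by (auto elim: ArrE)
      with h have "e ` carrier B = carrier C" by (simp add: epic)
      moreover obtain f where f: "lin P C f" "\<alpha> = arr P C f"
        using h E unfolding modules_def by (auto elim!: HomE)
      ultimately obtain g where "lin P B g" "\<forall>x \<in> carrier P. e (g x) = f x"
        using P E unfolding proj_univ_def by blast
      then show "\<exists>G \<in> Hom (modules R) P (Dom (modules R) E). E \<cdot>\<^bsub>modules R\<^esub> G = \<alpha>"
        using E f unfolding modules_def by (intro bexI[of _ "arr P B g"]) (simp_all add: arr_eq_iff)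
    qed
  qed
qed

lemma injective_modules_iff:
  "injective_object (modules R) P \<longleftrightarrow> inj_univ (P :: ('r, 'm) module)"
proof -
  have monic: "monic (modules R) (arr M N f) \<longleftrightarrow> inj_on f (carrier M)"
    if "lin M N f" for M N :: "('r, 'm) module" and f
    using monic_imp_injective[where A = UNIV and M = M and N = N and f = f]
      injective_imp_monic[OF arr_Arr[OF UNIV_I UNIV_I that] that] that
    unfolding modules_def by blast
  show ?thesis
  proof
    assume P: "injective_object (modules R) P"
    show "inj_univ P"
      unfolding inj_univ_def
    proof (intro conjI allI impI)
      show "lmod P" using P by (simp add: injective_object_def modules_def)
      fix B C :: "('r, 'm) module" and e f
      assume h: "lin B C e \<and> inj_on e (carrier B) \<and> lin B P f"
      then have "monic (modules R) (arr B C e)" using monic by blast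
      moreover have "arr B P f \<in> Hom (modules R) (Dom (modules R) (arr B C e)) P"
        using h by (simp add: modules_def)
      ultimately obtain G where "G \<in> Hom (modules R) (Cod (modules R) (arr B C e)) P"
        "G \<cdot>\<^bsub>modules R\<^esub> arr B C e = arr B P f"
        using P unfolding injective_object_def by blast
      then show "\<exists>g. lin C P g \<and> (\<forall>x \<in> carrier B. g (e x) = f x)"
        using h unfolding modules_def by (auto elim!: HomE simp: arr_eq_iff)
    qed
  next
    assume P: "inj_univ P"
    show "injective_object (modules R) P"
      unfolding injective_object_def
    proof (intro conjI allI impI)
      show "P \<in> Obj (modules R)" using P by (simp add: inj_univ_def modules_def)
      fix E \<alpha> assume h: "monic (modules R) E \<and> \<alpha> \<in> Hom (modules R) (Dom (modules R) E) P"
      then have "E \<in> Arr (modules R)" by (simp add: monic_def)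
      then obtain B C e where E: "lin B C e" "E = arr B C e" unfolding modules_def by (auto elim: ArrE)
      with h have "inj_on e (carrier B)" by (simp add: monic)
      moreover obtain f where f: "lin B P f" "\<alpha> = arr B P f"
        using h E unfolding modules_def by (auto elim!: HomE)
      ultimately obtain g where "lin C P g" "\<forall>x \<in> carrier B. g (e x) = f x"
        using P E unfolding inj_univ_def by blast
      then show "\<exists>G \<in> Hom (modules R) (Cod (modules R) E) P. G \<cdot>\<^bsub>modules R\<^esub> E = \<alpha>"
        using E f unfolding modules_def by (intro bexI[of _ "arr C P g"]) (simp_all add: arr_eq_iff)
    qed
  qed
qed

lemma quasi_frobenius_imp_finite_frobenius:
  assumes "quasi_frobenius TYPE('m) R" shows "finite_frobenius TYPE('m) R F"
proof (intro finite_frobenius.intro finite_frobenius_axioms.intro)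
  show "finite_ring_universe TYPE('m) R F" by unfold_locales
  show "proj_univ P \<longleftrightarrow> inj_univ P" for P :: "('r, 'm) module"
    using assms by (simp add: quasi_frobenius_def projective_modules_iff injective_modules_iff)
qed

end

context finite_frobenius begin

abbreviation \<C> :: "('r, 'm) module_category" where "\<C> \<equiv> mc FM"

text \<open>A projective object is a direct summand of a finite free module, which is injective; the converse
  is \<open>inj_mod_lift\<close>.\<close>

lemma projective_fg_iff: "projective_object \<C> P \<longleftrightarrow> finite (carrier P) \<and> inj_mod P"
proof
  assume P: "projective_object \<C> P"
  then have PF: "P \<in> FM" "lmod P" by (simp_all add: projective_object_def)
  then have fin: "finite (carrier P)" using FM_iff by blast
  obtain E :: "('r, 'm) module" and p where E: "inj_mod E" "finite (carrier E)" "lin E P p"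
    and cov: "carrier P \<subseteq> p ` carrier E"
    using free_cover[OF PF(2) fin order_refl] by blast
  have surj: "p ` carrier E = carrier P" using cov E(3) by (auto simp: lin_def)
  have EF: "E \<in> FM" using E FM_iff inj_mod_lmod by blast
  have "epic \<C> (arr E P p)" using epic_iff[OF EF PF(1) E(3)] surj by blast
  moreover have "arr P P (\<lambda>x. x) \<in> Hom \<C> P (Cod \<C> (arr E P p))" using PF by (simp add: lin_id)
  ultimately obtain S where "S \<in> Hom \<C> P (Dom \<C> (arr E P p))"
    "arr E P p \<cdot>\<^bsub>\<C>\<^esub> S = arr P P (\<lambda>x. x)"
    using P unfolding projective_object_def by blast
  then obtain s where "lin P E s" "\<forall>x \<in> carrier P. p (s x) = x"
    by (auto elim!: HomE simp: arr_eq_iff)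
  then show "finite (carrier P) \<and> inj_mod P" using inj_mod_retract[OF _ E(3) _ E(1)] fin by blast
next
  assume P: "finite (carrier P) \<and> inj_mod P"
  then have PF: "P \<in> FM" "lmod P" using FM_iff inj_mod_lmod by blast+
  show "projective_object \<C> P"
    unfolding projective_object_def
  proof (intro conjI allI impI)
    show "P \<in> Obj \<C>" using PF by simp
    fix E \<alpha> assume h: "epic \<C> E \<and> \<alpha> \<in> Hom \<C> P (Cod \<C> E)"
    then have "E \<in> Arr \<C>" by (simp add: epic_def)
    then obtain B C e where E: "B \<in> FM" "C \<in> FM" "lin B C e" "E = arr B C e" by (rule ArrE)
    with h have surj: "e ` carrier B = carrier C" using epic_iff by blast
    obtain f where f: "lin P C f" "\<alpha> = arr P C f" using h E by (auto elim!: HomE)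
    have finB: "finite (carrier B)" using E FM_iff lin_dom by blast
    obtain g where "lin P B g" "\<And>x. x \<in> carrier P \<Longrightarrow> e (g x) = f x"
      by (rule inj_mod_lift[OF conjunct2[OF P] conjunct1[OF P] finB E(3) surj f(1)]) (rule that)
    then show "\<exists>G \<in> Hom \<C> P (Dom \<C> E). E \<cdot>\<^bsub>\<C>\<^esub> G = \<alpha>"
      using E f PF by (intro bexI[of _ "arr P B g"]) (simp_all add: arr_eq_iff)
  qed
qed

text \<open>For the converse direction, the copy of \<open>I(M)\<close> in the universe is injective, hence projective.\<close>

lemma factors_through_projective_iff:
  assumes M: "M \<in> FM" "N \<in> FM" and f: "lin M N f"
  shows "(\<exists>P. projective_object \<C> P \<and> factors_through \<C> (arr M N f) P) \<longleftrightarrow> null_map M N f"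
proof
  assume "\<exists>P. projective_object \<C> P \<and> factors_through \<C> (arr M N f) P"
  then obtain P G H where P: "inj_mod P" and G: "G \<in> Hom \<C> M P" and H: "H \<in> Hom \<C> P N"
    and eq: "arr M N f = H \<cdot>\<^bsub>\<C>\<^esub> G"
    by (auto simp: projective_fg_iff factors_through_def)
  from G obtain g where g: "lin M P g" "G = arr M P g" by (rule HomE)
  from H obtain h where h: "lin P N h" "H = arr P N h" by (rule HomE)
  have "null_map M N (\<lambda>x. h (g x))" by (rule null_comp_left[OF null_into_inj_mod[OF P g(1)] h(1)])
  then show "null_map M N f" by (rule null_cong) (use eq g h in \<open>simp add: arr_eq_iff\<close>)
next
  assume "null_map M N f"
  then obtain g where g: "lmod M" "lin (coind M) N g" "\<And>x. x \<in> carrier M \<Longrightarrow> g (eta M x) = f x"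
    by (rule nullE) (rule that)
  let ?I = "coind M"
  have I: "lmod ?I" "finite (carrier ?I)" using g(1) M FM_iff fin_R by (simp_all add: finite_coind)
  obtain k where k: "lin (transport ?I) ?I k" "\<And>x. x \<in> carrier ?I \<Longrightarrow> k (transport_map ?I x) = x"
    by (rule transport_inverse[OF I]) (rule that)
  note t = transport[OF I]
  have rel: "inj_mod (transport ?I)" using inj_mod_transport_iff[OF I] inj_mod_coind[OF g(1)] by blast
  have TF: "transport ?I \<in> FM" using FM_iff[OF inj_mod_lmod[OF rel]] t(3) by blast
  have "factors_through \<C> (arr M N f) (transport ?I)"
    unfolding factors_through_def mc_simps
  proof (intro bexI)
    have l: "lin M (transport ?I) (\<lambda>x. transport_map ?I (eta M x))" by (rule lin_comp[OF lin_eta[OF g(1)] t(1)])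
    show "arr M N f = arr (transport ?I) N (\<lambda>y. g (k y)) \<cdot>\<^bsub>\<C>\<^esub> arr M (transport ?I) (\<lambda>x. transport_map ?I (eta M x))"
      using l g lin_in[OF lin_eta[OF g(1)]] by (simp add: arr_eq_iff k(2))
    show "arr M (transport ?I) (\<lambda>x. transport_map ?I (eta M x)) \<in> Hom \<C> M (transport ?I)"
      using l M TF by simp
    show "arr (transport ?I) N (\<lambda>y. g (k y)) \<in> Hom \<C> (transport ?I) N"
      using lin_comp[OF k(1) g(2)] M TF by simp
  qed
  then show "\<exists>P. projective_object \<C> P \<and> factors_through \<C> (arr M N f) P"
    using rel t(3) projective_fg_iff by blast
qed

lemma stably_equal_iff:
  assumes M: "M \<in> FM" "N \<in> FM" and f: "lin M N f" and g: "lin M N g"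
  shows "stably_equal R (arr M N f) (arr M N g) \<longleftrightarrow> stably_eq M N f g"
proof -
  have [simp]: "lmod M" "lmod N" using f lin_dom lin_cod by blast+
  let ?d = "\<lambda>x. f x \<oplus>\<^bsub>N\<^esub> \<ominus>\<^bsub>N\<^esub> g x"
  have "arrow_diff (arr M N f) (arr M N g) = arr M N ?d"
    by (auto simp: arrow_diff_def arr_def a_minus_def)
  moreover have "lin M N ?d" by (intro lin_sum lin_minus f g)
  ultimately have "stably_equal R (arr M N f) (arr M N g) \<longleftrightarrow> null_map M N ?d"
    unfolding stably_equal_def fg_modules_def using factors_through_projective_iff[OF M] by simp
  also have "\<dots> \<longleftrightarrow> stably_eq M N f g"
  proof
    assume "null_map M N ?d"
    then show "stably_eq M N f g" by (rule stably_eqI[OF g]) (use f g in \<open>simp add: lmod_ac\<close>)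
  next
    assume "stably_eq M N f g"
    then obtain n where n: "null_map M N n" "\<And>x. x \<in> carrier M \<Longrightarrow> f x = g x \<oplus>\<^bsub>N\<^esub> n x" by (rule stably_eqE) (rule that)
    show "null_map M N ?d"
      by (rule null_cong[OF n(1)]) (use g null_lin[OF n(1)] in \<open>simp add: n(2) lmod_ac\<close>)
  qed
  finally show ?thesis .
qed

lemma stable_equivalence_iff:
  assumes M: "M \<in> FM" "N \<in> FM" and f: "lin M N f"
  shows "stable_equivalence R (arr M N f) \<longleftrightarrow> stable_eqv M N f"
proof -
  have [simp]: "lmod M" "lmod N" using f lin_dom lin_cod by blast+
  have "stable_equivalence R (arr M N f) \<longleftrightarrow>
    (\<exists>h. lin N M h \<and> stably_equal R (arr N N (\<lambda>y. f (h y))) (arr N N (\<lambda>y. y)) \<and>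
      stably_equal R (arr M M (\<lambda>x. h (f x))) (arr M M (\<lambda>x. x)))"
    unfolding stable_equivalence_def fg_modules_def Let_def
    using M f by (simp add: Bex_Hom cong: conj_cong)
  also have "\<dots> \<longleftrightarrow> stable_eqv M N f"
    unfolding stable_eqv_def using M f
    by (auto simp: stably_equal_iff lin_id lin_comp[OF f] lin_comp[OF _ f])
  finally show ?thesis .
qed

end

context ring_over_division_subring begin

section \<open>Pushouts\<close>

text \<open>Exactness of \<open>X \<rightarrow> Y \<oplus> Z \<rightarrow> P \<rightarrow> 0\<close> with first map \<open>(f, -g)\<close> and second map \<open>i + j\<close>, which
  characterizes the pushouts among the commutative squares \<open>i f = j g\<close>.\<close>

definition po :: "('r, 'x) module \<Rightarrow> ('r, 'y) module \<Rightarrow> ('r, 'z) module \<Rightarrow> ('r, 'p) module \<Rightarrow>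
    ('x \<Rightarrow> 'y) \<Rightarrow> ('x \<Rightarrow> 'z) \<Rightarrow> ('y \<Rightarrow> 'p) \<Rightarrow> ('z \<Rightarrow> 'p) \<Rightarrow> bool" where
  "po X Y Z P f g i j \<longleftrightarrow> lin X Y f \<and> lin X Z g \<and> lin Y P i \<and> lin Z P j \<and>
     (\<forall>x \<in> carrier X. i (f x) = j (g x)) \<and>
     (\<forall>p \<in> carrier P. \<exists>y \<in> carrier Y. \<exists>z \<in> carrier Z. p = i y \<oplus>\<^bsub>P\<^esub> j z) \<and>
     (\<forall>y \<in> carrier Y. \<forall>z \<in> carrier Z. i y \<oplus>\<^bsub>P\<^esub> j z = \<zero>\<^bsub>P\<^esub> \<longrightarrow>
        (\<exists>x \<in> carrier X. y = f x \<and> z = \<ominus>\<^bsub>Z\<^esub> g x))"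

lemma poD:
  assumes "po X Y Z P f g i j"
  shows "lin X Y f" "lin X Z g" "lin Y P i" "lin Z P j"
    "\<And>x. x \<in> carrier X \<Longrightarrow> i (f x) = j (g x)"
    "\<And>p. p \<in> carrier P \<Longrightarrow> \<exists>y \<in> carrier Y. \<exists>z \<in> carrier Z. p = i y \<oplus>\<^bsub>P\<^esub> j z"
    "\<And>y z. y \<in> carrier Y \<Longrightarrow> z \<in> carrier Z \<Longrightarrow> i y \<oplus>\<^bsub>P\<^esub> j z = \<zero>\<^bsub>P\<^esub> \<Longrightarrow>
      \<exists>x \<in> carrier X. y = f x \<and> z = \<ominus>\<^bsub>Z\<^esub> g x"
  using assms unfolding po_def by blast+

lemma po_surj:
  assumes "po X Y Z P f g i j"
  shows "(\<lambda>p. i (fst p) \<oplus>\<^bsub>P\<^esub> j (snd p)) ` carrier (dsum Y Z) = carrier P"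
proof
  note s = lin_copair[OF poD(3,4)[OF assms]]
  show "(\<lambda>p. i (fst p) \<oplus>\<^bsub>P\<^esub> j (snd p)) ` carrier (dsum Y Z) \<subseteq> carrier P"
    using lin_in[OF s] by blast
  show "carrier P \<subseteq> (\<lambda>p. i (fst p) \<oplus>\<^bsub>P\<^esub> j (snd p)) ` carrier (dsum Y Z)"
  proof
    fix p assume "p \<in> carrier P"
    then obtain y z where "y \<in> carrier Y" "z \<in> carrier Z" "p = i y \<oplus>\<^bsub>P\<^esub> j z"
      using poD(6)[OF assms] by blast
    then show "p \<in> (\<lambda>p. i (fst p) \<oplus>\<^bsub>P\<^esub> j (snd p)) ` carrier (dsum Y Z)"
      by (intro image_eqI[of _ _ "(y, z)"]) simp_all
  qed
qed

lemma po_universal: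
  assumes po: "po X Y Z P f g i j" and i': "lin Y W i'" and j': "lin Z W j'"
    and eq: "\<And>x. x \<in> carrier X \<Longrightarrow> i' (f x) = j' (g x)"
  obtains u where "lin P W u" "\<And>y. y \<in> carrier Y \<Longrightarrow> u (i y) = i' y"
    "\<And>z. z \<in> carrier Z \<Longrightarrow> u (j z) = j' z"
proof -
  note l = poD(1-4)[OF po]
  have [simp]: "lmod X" "lmod Y" "lmod Z" "lmod P" "lmod W" using l i' lin_dom lin_cod by blast+
  obtain u where u: "lin P W u"
    "\<And>p. p \<in> carrier (dsum Y Z) \<Longrightarrow> u (i (fst p) \<oplus>\<^bsub>P\<^esub> j (snd p)) = i' (fst p) \<oplus>\<^bsub>W\<^esub> j' (snd p)"
  proof (rule lin_factor_surj[OF lin_copair[OF l(3,4)] po_surj[OF po] lin_copair[OF i' j']])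
    fix b assume b: "b \<in> carrier (dsum Y Z)" "i (fst b) \<oplus>\<^bsub>P\<^esub> j (snd b) = \<zero>\<^bsub>P\<^esub>"
    then have "fst b \<in> carrier Y" "snd b \<in> carrier Z" by auto
    then obtain x where x: "x \<in> carrier X" "fst b = f x" "snd b = \<ominus>\<^bsub>Z\<^esub> g x"
      using poD(7)[OF po _ _ b(2)] by blast
    then show "i' (fst b) \<oplus>\<^bsub>W\<^esub> j' (snd b) = \<zero>\<^bsub>W\<^esub>"
      using l i' j' by (simp add: eq lin_neg[OF j'])
  qed (rule that)
  show ?thesis
  proof (rule that[OF u(1)])
    show "u (i y) = i' y" if "y \<in> carrier Y" for y
      using u(2)[of "(y, \<zero>\<^bsub>Z\<^esub>)"] that l i' j' by (simp add: lin_zero)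
    show "u (j z) = j' z" if "z \<in> carrier Z" for z
      using u(2)[of "(\<zero>\<^bsub>Y\<^esub>, z)"] that l i' j' by (simp add: lin_zero)
  qed
qed

lemma po_unique:
  assumes po: "po X Y Z P f g i j" and u: "lin P W u" and v: "lin P W v"
    and "\<And>y. y \<in> carrier Y \<Longrightarrow> u (i y) = v (i y)" "\<And>z. z \<in> carrier Z \<Longrightarrow> u (j z) = v (j z)"
    and p: "p \<in> carrier P"
  shows "u p = v p"
proof -
  obtain y z where "y \<in> carrier Y" "z \<in> carrier Z" "p = i y \<oplus>\<^bsub>P\<^esub> j z"
    using poD(6)[OF po p] by blast
  then show ?thesis using assms poD(3,4)[OF po] by (simp add: lin_add)
qed

lemma po_ses:
  assumes po: "po X Y Z P f g i j" and inj: "inj_on f (carrier X)"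
  shows "ses X (dsum Y Z) P (\<lambda>x. (f x, \<ominus>\<^bsub>Z\<^esub> g x)) (\<lambda>p. i (fst p) \<oplus>\<^bsub>P\<^esub> j (snd p))"
proof -
  note l = poD(1-4)[OF po]
  have [simp]: "lmod X" "lmod Y" "lmod Z" "lmod P" using l lin_dom lin_cod by blast+
  show ?thesis
    unfolding ses_def
  proof (intro conjI ballI iffI)
    show "lin X (dsum Y Z) (\<lambda>x. (f x, \<ominus>\<^bsub>Z\<^esub> g x))" by (rule lin_pair[OF l(1) lin_minus[OF l(2)]])
    show "lin (dsum Y Z) P (\<lambda>p. i (fst p) \<oplus>\<^bsub>P\<^esub> j (snd p))" by (rule lin_copair[OF l(3,4)])
    show "inj_on (\<lambda>x. (f x, \<ominus>\<^bsub>Z\<^esub> g x)) (carrier X)" using inj by (auto simp: inj_on_def)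
    show "(\<lambda>p. i (fst p) \<oplus>\<^bsub>P\<^esub> j (snd p)) ` carrier (dsum Y Z) = carrier P" by (rule po_surj[OF po])
  next
    fix b assume "b \<in> carrier (dsum Y Z)" and 0: "i (fst b) \<oplus>\<^bsub>P\<^esub> j (snd b) = \<zero>\<^bsub>P\<^esub>"
    then have "fst b \<in> carrier Y" "snd b \<in> carrier Z" by auto
    then obtain x where "x \<in> carrier X" "fst b = f x" "snd b = \<ominus>\<^bsub>Z\<^esub> g x"
      using poD(7)[OF po _ _ 0] by blast
    then show "b \<in> (\<lambda>x. (f x, \<ominus>\<^bsub>Z\<^esub> g x)) ` carrier X" by (intro image_eqI[of _ _ x]) (simp_all add: prod_eq_iff)
  next
    fix b assume "b \<in> (\<lambda>x. (f x, \<ominus>\<^bsub>Z\<^esub> g x)) ` carrier X"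
    then obtain x where "x \<in> carrier X" "b = (f x, \<ominus>\<^bsub>Z\<^esub> g x)" by blast
    then show "i (fst b) \<oplus>\<^bsub>P\<^esub> j (snd b) = \<zero>\<^bsub>P\<^esub>" using l poD(5)[OF po] by (simp add: lin_neg)
  qed
qed

lemma po_inj:
  assumes po: "po X Y Z P f g i j" and inj: "inj_on g (carrier X)"
  shows "inj_on i (carrier Y)"
proof -
  note l = poD(1-4)[OF po]
  have [simp]: "lmod X" "lmod Y" "lmod Z" "lmod P" using l lin_dom lin_cod by blast+
  show ?thesis
    unfolding inj_on_lin_iff[OF l(3)]
  proof (intro ballI impI)
    fix y assume y: "y \<in> carrier Y" "i y = \<zero>\<^bsub>P\<^esub>"
    then have "i y \<oplus>\<^bsub>P\<^esub> j \<zero>\<^bsub>Z\<^esub> = \<zero>\<^bsub>P\<^esub>" using l by (simp add: lin_zero)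
    then obtain x where x: "x \<in> carrier X" "y = f x" "\<zero>\<^bsub>Z\<^esub> = \<ominus>\<^bsub>Z\<^esub> g x"
      using poD(7)[OF po y(1) lmod_zero_closed] by auto
    then have "g x = \<zero>\<^bsub>Z\<^esub>" using l by (metis lin_in lmod_minus_minus lmod_minus_zero \<open>lmod Z\<close>)
    then have "x = \<zero>\<^bsub>X\<^esub>" using inj x(1) unfolding inj_on_lin_iff[OF l(2)] by blast
    then show "y = \<zero>\<^bsub>Y\<^esub>" using x l by (simp add: lin_zero)
  qed
qed

lemma po_transport:
  assumes po: "po X Y Z P f g i j" and k: "lin P P' k" "bij_betw k (carrier P) (carrier P')"
  shows "po X Y Z P' f g (\<lambda>y. k (i y)) (\<lambda>z. k (j z))"
proof -
  note l = poD(1-4)[OF po]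
  have [simp]: "lmod P" using l lin_cod by blast
  have inj: "inj_on k (carrier P)" and surj: "k ` carrier P = carrier P'" using k by (auto simp: bij_betw_def)
  show ?thesis
    unfolding po_def
  proof (intro conjI ballI impI l lin_comp[OF l(3) k(1)] lin_comp[OF l(4) k(1)])
    show "k (i (f x)) = k (j (g x))" if "x \<in> carrier X" for x using poD(5)[OF po that] by simp
  next
    fix p' assume "p' \<in> carrier P'"
    then obtain p where p: "p \<in> carrier P" "p' = k p" using surj by blast
    with poD(6)[OF po] obtain y z where "y \<in> carrier Y" "z \<in> carrier Z" "p = i y \<oplus>\<^bsub>P\<^esub> j z" by blast
    then show "\<exists>y \<in> carrier Y. \<exists>z \<in> carrier Z. p' = k (i y) \<oplus>\<^bsub>P'\<^esub> k (j z)"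
      using p l k by (intro bexI[of _ y] bexI[of _ z]) (simp_all add: lin_add)
  next
    fix y z assume yz: "y \<in> carrier Y" "z \<in> carrier Z" "k (i y) \<oplus>\<^bsub>P'\<^esub> k (j z) = \<zero>\<^bsub>P'\<^esub>"
    then have "k (i y \<oplus>\<^bsub>P\<^esub> j z) = \<zero>\<^bsub>P'\<^esub>" using l k by (simp add: lin_add)
    then have "i y \<oplus>\<^bsub>P\<^esub> j z = \<zero>\<^bsub>P\<^esub>" using inj yz l unfolding inj_on_lin_iff[OF k(1)] by simp
    then show "\<exists>x \<in> carrier X. y = f x \<and> z = \<ominus>\<^bsub>Z\<^esub> g x" using poD(7)[OF po] yz by blast
  qed
qed

lemma po_exists:
  fixes Y :: "('r, 'y) module" and Z :: "('r, 'z) module"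
  assumes f: "lin X Y f" and g: "lin X Z g"
  obtains P :: "('r, 'y \<times> 'z) module" and i j where "po X Y Z P f g i j"
    "(\<lambda>p. i (fst p) \<oplus>\<^bsub>P\<^esub> j (snd p)) ` carrier (dsum Y Z) = carrier P"
proof -
  have [simp]: "lmod X" "lmod Y" "lmod Z" using f g lin_dom lin_cod by blast+
  let ?h = "\<lambda>x. (f x, \<ominus>\<^bsub>Z\<^esub> g x)"
  let ?B = "dsum Y Z"
  have h: "lin X ?B ?h" by (rule lin_pair[OF f lin_minus[OF g]])
  obtain P :: "('r, 'y \<times> 'z) module" and q where q: "lin ?B P q" "q ` carrier ?B = carrier P"
    "\<And>b. b \<in> carrier ?B \<Longrightarrow> q b = \<zero>\<^bsub>P\<^esub> \<longleftrightarrow> b \<in> ?h ` carrier X"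
    by (rule cokernel_exists[OF h]) (rule that)
  have [simp]: "lmod P" using q(1) lin_cod by blast
  let ?i = "\<lambda>y. q (y, \<zero>\<^bsub>Z\<^esub>)" and ?j = "\<lambda>z. q (\<zero>\<^bsub>Y\<^esub>, z)"
  have ij: "?i y \<oplus>\<^bsub>P\<^esub> ?j z = q (y, z)" if "y \<in> carrier Y" "z \<in> carrier Z" for y z
    using lin_add[OF q(1), of "(y, \<zero>\<^bsub>Z\<^esub>)" "(\<zero>\<^bsub>Y\<^esub>, z)"] that by simp
  have il: "lin Y P ?i" and jl: "lin Z P ?j"
    by (rule lin_comp[OF lin_pair[OF lin_id lin_const_zero] q(1)] lin_comp[OF lin_pair[OF lin_const_zero lin_id] q(1)]; simp)+
  have surj: "(\<lambda>p. ?i (fst p) \<oplus>\<^bsub>P\<^esub> ?j (snd p)) ` carrier ?B = carrier P"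
    unfolding q(2)[symmetric] by (rule image_cong) (auto simp: ij)
  have "po X Y Z P f g ?i ?j"
    unfolding po_def
  proof (intro conjI ballI impI f g il jl)
    fix x assume x: "x \<in> carrier X"
    have "?i (f x) \<oplus>\<^bsub>P\<^esub> ?j (\<ominus>\<^bsub>Z\<^esub> g x) = \<zero>\<^bsub>P\<^esub>"
      using x f g q(3)[of "?h x"] by (simp add: ij)
    moreover have "?j (\<ominus>\<^bsub>Z\<^esub> g x) = \<ominus>\<^bsub>P\<^esub> ?j (g x)" using lin_neg[OF jl] x g by simp
    ultimately show "?i (f x) = ?j (g x)"
      using lin_in[OF il, of "f x"] lin_in[OF jl, of "g x"] x f g by (simp add: lmod_eq_neg_iff)
  next
    fix p assume "p \<in> carrier P"
    then obtain b where b: "b \<in> carrier ?B" "p = q b" using q(2) by blast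
    then show "\<exists>y \<in> carrier Y. \<exists>z \<in> carrier Z. p = ?i y \<oplus>\<^bsub>P\<^esub> ?j z"
      by (intro bexI[of _ "fst b"] bexI[of _ "snd b"]) (auto simp: ij)
  next
    fix y z assume yz: "y \<in> carrier Y" "z \<in> carrier Z" "?i y \<oplus>\<^bsub>P\<^esub> ?j z = \<zero>\<^bsub>P\<^esub>"
    then have "(y, z) \<in> ?h ` carrier X" using q(3)[of "(y, z)"] by (simp add: ij)
    then show "\<exists>x \<in> carrier X. y = f x \<and> z = \<ominus>\<^bsub>Z\<^esub> g x" by blast
  qed
  then show ?thesis using surj by (rule that)
qed

end

context finite_frobenius begin

lemma FM_dsum:
  assumes "M \<in> FM" "N \<in> FM" "lmod M" "lmod N"
  shows "finite (carrier (dsum M N))"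
  using assms FM_iff by (metis dsum_simps(1) finite_cartesian_product)

lemma po_exists_FM:
  assumes f: "lin X Y f" and g: "lin X Z g" and "Y \<in> FM" "Z \<in> FM"
  obtains P :: "('r, 'm) module" and i j where "P \<in> FM" "po X Y Z P f g i j"
proof -
  obtain P0 :: "('r, 'm \<times> 'm) module" and i j where P0: "po X Y Z P0 f g i j"
    and surj: "(\<lambda>p. i (fst p) \<oplus>\<^bsub>P0\<^esub> j (snd p)) ` carrier (dsum Y Z) = carrier P0"
    by (rule po_exists[OF f g]) (rule that)
  have "finite (carrier (dsum Y Z))" using assms FM_dsum lin_cod by blast
  then have fin: "finite (carrier P0)" unfolding surj[symmetric] by simp
  have lm: "lmod P0" using poD(3)[OF P0] lin_cod by blast
  note t = transport[OF lm fin]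
  have "transport P0 \<in> FM" using FM_iff[OF lin_cod[OF t(1)]] t(3) by blast
  then show ?thesis using po_transport[OF P0 t(1,2)] by (rule that)
qed

lemma po_imp_is_pushout:
  assumes po: "po X Y Z P f g i j" and FM: "X \<in> FM" "Y \<in> FM" "Z \<in> FM" "P \<in> FM"
  shows "is_pushout \<C> (arr X Y f) (arr X Z g) (arr Y P i) (arr Z P j)"
proof -
  note l = poD(1-4)[OF po]
  show ?thesis
    unfolding is_pushout_def
  proof (intro conjI allI impI)
    show "span \<C> (arr X Y f) (arr X Z g)" using l FM by (simp add: span_def)
    show "cocone \<C> (arr X Y f) (arr X Z g) (arr Y P i) (arr Z P j)"
      using l FM poD(5)[OF po] by (simp add: cocone_def arr_eq_iff)
    fix \<iota> \<kappa> assume c: "cocone \<C> (arr X Y f) (arr X Z g) \<iota> \<kappa>"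
    then have "\<iota> \<in> Arr \<C>" "\<kappa> \<in> Arr \<C>" by (simp_all add: cocone_def)
    from this(1) obtain Y' W i' where i: "W \<in> FM" "lin Y' W i'" "\<iota> = arr Y' W i'" by (rule ArrE)
    from \<open>\<kappa> \<in> Arr \<C>\<close> obtain Z' W' j' where j: "lin Z' W' j'" "\<kappa> = arr Z' W' j'" by (rule ArrE)
    have YZ: "Y' = Y" "Z' = Z" "W' = W" using c i j by (simp_all add: cocone_def)
    then have eq: "i' (f x) = j' (g x)" if "x \<in> carrier X" for x
      using c i j l that by (simp add: cocone_def arr_eq_iff)
    obtain u where u: "lin P W u" "\<And>y. y \<in> carrier Y \<Longrightarrow> u (i y) = i' y"
      "\<And>z. z \<in> carrier Z \<Longrightarrow> u (j z) = j' z"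
      by (rule po_universal[OF po i(2)[unfolded YZ] j(1)[unfolded YZ]]) (blast intro: eq, rule that)
    show "\<exists>!\<upsilon>. \<upsilon> \<in> Hom \<C> (Cod \<C> (arr Y P i)) (Cod \<C> \<iota>) \<and>
        \<upsilon> \<cdot>\<^bsub>\<C>\<^esub> arr Y P i = \<iota> \<and> \<upsilon> \<cdot>\<^bsub>\<C>\<^esub> arr Z P j = \<kappa>"
    proof (rule ex1I[of _ "arr P W u"])
      show "arr P W u \<in> Hom \<C> (Cod \<C> (arr Y P i)) (Cod \<C> \<iota>) \<and>
          arr P W u \<cdot>\<^bsub>\<C>\<^esub> arr Y P i = \<iota> \<and> arr P W u \<cdot>\<^bsub>\<C>\<^esub> arr Z P j = \<kappa>"
        using u l FM i j YZ by (simp add: arr_eq_iff)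
      fix \<upsilon> assume \<upsilon>: "\<upsilon> \<in> Hom \<C> (Cod \<C> (arr Y P i)) (Cod \<C> \<iota>) \<and>
        \<upsilon> \<cdot>\<^bsub>\<C>\<^esub> arr Y P i = \<iota> \<and> \<upsilon> \<cdot>\<^bsub>\<C>\<^esub> arr Z P j = \<kappa>"
      then have "\<upsilon> \<in> Hom \<C> P W" using i by simp
      then obtain v where v: "lin P W v" "\<upsilon> = arr P W v" by (rule HomE)
      have "v p = u p" if "p \<in> carrier P" for p
        by (rule po_unique[OF po v(1) u(1) _ _ that])
          (use \<upsilon> v l i j YZ u in \<open>simp_all add: arr_eq_iff\<close>)
      then show "\<upsilon> = arr P W u" using v by (simp add: arr_eq_iff)
    qed
  qed
qed

text \<open>Pushouts are unique up to isomorphism, so the exactness known for one that is constructed as a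
  cokernel carries over to all.\<close>

lemma is_pushoutE:
  assumes push: "is_pushout \<C> \<alpha> \<beta> \<iota> \<kappa>"
  obtains X Y Z P f g i j where "X \<in> FM" "Y \<in> FM" "Z \<in> FM" "P \<in> FM"
    "\<alpha> = arr X Y f" "\<beta> = arr X Z g" "\<iota> = arr Y P i" "\<kappa> = arr Z P j" "po X Y Z P f g i j"
proof -
  have sp: "span \<C> \<alpha> \<beta>" and co: "cocone \<C> \<alpha> \<beta> \<iota> \<kappa>" using push by (simp_all add: is_pushout_def)
  then have A: "\<alpha> \<in> Arr \<C>" "\<beta> \<in> Arr \<C>" "\<iota> \<in> Arr \<C>" "\<kappa> \<in> Arr \<C>" by (simp_all add: span_def cocone_def)
  from A(1) obtain X Y f where f: "X \<in> FM" "Y \<in> FM" "lin X Y f" "\<alpha> = arr X Y f" by (rule ArrE)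
  from A(2) obtain X' Z g where g: "Z \<in> FM" "lin X' Z g" "\<beta> = arr X' Z g" by (rule ArrE)
  from A(3) obtain Y' P i where i: "P \<in> FM" "lin Y' P i" "\<iota> = arr Y' P i" by (rule ArrE)
  from A(4) obtain Z' P' j where j: "lin Z' P' j" "\<kappa> = arr Z' P' j" by (rule ArrE)
  have same: "X' = X" "Y' = Y" "Z' = Z" "P' = P"
    using sp co f g i j by (simp_all add: span_def cocone_def)
  note g = g[unfolded same] and i = i[unfolded same] and j = j[unfolded same]
  have [simp]: "lmod P" by (rule lin_cod[OF i(2)])
  have eq: "i (f x) = j (g x)" if "x \<in> carrier X" for x
    using co f g i j that by (simp add: cocone_def arr_eq_iff)
  obtain Q i0 j0 where Q: "Q \<in> FM" and po: "po X Y Z Q f g i0 j0"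
    by (rule po_exists_FM[OF f(3) _ f(2)]) (use g in \<open>auto intro: that\<close>)
  note l = poD(1-4)[OF po]
  have [simp]: "lmod Q" using l lin_cod by blast
  obtain u where u: "lin Q P u" "\<And>y. y \<in> carrier Y \<Longrightarrow> u (i0 y) = i y"
    "\<And>z. z \<in> carrier Z \<Longrightarrow> u (j0 z) = j z"
    by (rule po_universal[OF po i(2) j(1)]) (blast intro: eq, rule that)
  \<comment> \<open>\<open>u\<close> is inverted by the map \<open>v\<close> that the universal property of \<open>P\<close> provides.\<close>
  have univ: "\<exists>!\<upsilon>. \<upsilon> \<in> Hom \<C> P W \<and> \<upsilon> \<cdot>\<^bsub>\<C>\<^esub> \<iota> = arr Y W i' \<and> \<upsilon> \<cdot>\<^bsub>\<C>\<^esub> \<kappa> = arr Z W j'"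
    if "W \<in> FM" "lin Y W i'" "lin Z W j'" "\<And>x. x \<in> carrier X \<Longrightarrow> i' (f x) = j' (g x)" for W i' j'
  proof -
    have "cocone \<C> \<alpha> \<beta> (arr Y W i') (arr Z W j')"
      using that f g by (simp add: cocone_def arr_eq_iff)
    with push have "\<exists>!\<upsilon>. \<upsilon> \<in> Hom \<C> (Cod \<C> \<iota>) (Cod \<C> (arr Y W i')) \<and>
        \<upsilon> \<cdot>\<^bsub>\<C>\<^esub> \<iota> = arr Y W i' \<and> \<upsilon> \<cdot>\<^bsub>\<C>\<^esub> \<kappa> = arr Z W j'"
      unfolding is_pushout_def by blast
    then show ?thesis unfolding i(3) mc_simps .
  qed
  obtain \<upsilon> where \<upsilon>: "\<upsilon> \<in> Hom \<C> P Q" "\<upsilon> \<cdot>\<^bsub>\<C>\<^esub> \<iota> = arr Y Q i0" "\<upsilon> \<cdot>\<^bsub>\<C>\<^esub> \<kappa> = arr Z Q j0"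
    using univ[OF Q l(3,4) poD(5)[OF po]] by blast
  from \<upsilon>(1) obtain v where v: "lin P Q v" "\<upsilon> = arr P Q v" by (rule HomE)
  have vi: "v (i y) = i0 y" if "y \<in> carrier Y" for y using \<upsilon>(2) v i that by (simp add: arr_eq_iff)
  have vj: "v (j z) = j0 z" if "z \<in> carrier Z" for z using \<upsilon>(3) v j that by (simp add: arr_eq_iff)
  have "arr P P (\<lambda>p. u (v p)) = arr P P (\<lambda>p. p)"
  proof -
    have "arr P P (\<lambda>p. u (v p)) \<in> Hom \<C> P P \<and> arr P P (\<lambda>p. u (v p)) \<cdot>\<^bsub>\<C>\<^esub> \<iota> = arr Y P i \<and>
        arr P P (\<lambda>p. u (v p)) \<cdot>\<^bsub>\<C>\<^esub> \<kappa> = arr Z P j"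
      using lin_comp[OF v(1) u(1)] i j by (simp add: arr_eq_iff vi vj u)
    moreover have "arr P P (\<lambda>p. p) \<in> Hom \<C> P P \<and> arr P P (\<lambda>p. p) \<cdot>\<^bsub>\<C>\<^esub> \<iota> = arr Y P i \<and>
        arr P P (\<lambda>p. p) \<cdot>\<^bsub>\<C>\<^esub> \<kappa> = arr Z P j"
      using i j by (simp add: arr_eq_iff lin_id)
    ultimately show ?thesis using univ[OF i(1,2) j(1) eq] by blast
  qed
  then have uv: "u (v p) = p" if "p \<in> carrier P" for p using that by (simp add: arr_eq_iff)
  have vu: "v (u p) = p" if "p \<in> carrier Q" for p
    by (rule po_unique[OF po lin_comp[OF u(1) v(1)] lin_id _ _ that]) (simp_all add: u vi vj)
  have "bij_betw u (carrier Q) (carrier P)"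
    by (rule bij_betwI[of _ _ _ v]) (use u(1) v(1) uv vu in auto)
  from po_transport[OF po u(1) this] have "po X Y Z P f g (\<lambda>y. u (i0 y)) (\<lambda>z. u (j0 z))" .
  moreover have "lin Y P i" "lin Z P j" using i j by auto
  ultimately have "po X Y Z P f g i j" unfolding po_def by (simp add: u eq)
  then show ?thesis using f g i j by (intro that) auto
qed

section \<open>The Waldhausen structure\<close>

abbreviation cofs :: "('r, 'm) module_arrow set" where "cofs \<equiv> {\<alpha> \<in> Arr \<C>. monic \<C> \<alpha>}"
abbreviation weqs :: "('r, 'm) module_arrow set" where "weqs \<equiv> {\<alpha> \<in> Arr \<C>. stable_equivalence R \<alpha>}"
abbreviation pt :: "('r, 'm) module" where "pt \<equiv> zero_mod"

lemma cofs_arr: "M \<in> FM \<Longrightarrow> N \<in> FM \<Longrightarrow> lin M N f \<Longrightarrow> arr M N f \<in> cofs \<longleftrightarrow> inj_on f (carrier M)"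
  using monic_iff[of M N f] by simp

lemma weqs_arr: "M \<in> FM \<Longrightarrow> N \<in> FM \<Longrightarrow> lin M N f \<Longrightarrow> arr M N f \<in> weqs \<longleftrightarrow> stable_eqv M N f"
  using stable_equivalence_iff[of M N f] by simp

lemma cofsE:
  assumes "\<alpha> \<in> cofs"
  obtains M N f where "M \<in> FM" "N \<in> FM" "lin M N f" "\<alpha> = arr M N f" "inj_on f (carrier M)"
proof -
  from assms have "\<alpha> \<in> Arr \<C>" by simp
  then obtain M N f where *: "M \<in> FM" "N \<in> FM" "lin M N f" "\<alpha> = arr M N f" by (rule ArrE)
  from assms have "inj_on f (carrier M)" unfolding *(4) cofs_arr[OF *(1-3)] .
  with * show ?thesis by (rule that)
qed

lemma weqsE:
  assumes "\<alpha> \<in> weqs"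
  obtains M N f where "M \<in> FM" "N \<in> FM" "stable_eqv M N f" "\<alpha> = arr M N f"
proof -
  from assms have "\<alpha> \<in> Arr \<C>" by simp
  then obtain M N f where *: "M \<in> FM" "N \<in> FM" "lin M N f" "\<alpha> = arr M N f" by (rule ArrE)
  from assms have "stable_eqv M N f" unfolding *(4) weqs_arr[OF *(1-3)] .
  from that[OF *(1,2) this *(4)] show ?thesis .
qed

lemma arr_weqs: "M \<in> FM \<Longrightarrow> N \<in> FM \<Longrightarrow> stable_eqv M N f \<Longrightarrow> arr M N f \<in> weqs"
  using weqs_arr stable_eqv_lin by blast

lemma pt_FM: "pt \<in> FM"
  using FM_iff[of pt] by simp

lemma lin_to_pt: "lmod M \<Longrightarrow> lin M pt (\<lambda>_. undefined)"
  using lin_const_zero[of M pt] by simp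

lemma pt_zero: "zero_object \<C> pt"
  unfolding zero_object_def
proof (intro conjI ballI)
  show "pt \<in> Obj \<C>" using pt_FM by simp
  fix X assume "X \<in> Obj \<C>"
  then have X: "X \<in> FM" "lmod X" by auto
  show "\<exists>!\<alpha>. \<alpha> \<in> Hom \<C> pt X"
  proof (rule ex1I[of _ "arr pt X (\<lambda>_. \<zero>\<^bsub>X\<^esub>)"])
    show "arr pt X (\<lambda>_. \<zero>\<^bsub>X\<^esub>) \<in> Hom \<C> pt X" by (rule arr_Hom[OF pt_FM X(1) lin_const_zero[OF lmod_zero_mod X(2)]])
    fix \<alpha> assume "\<alpha> \<in> Hom \<C> pt X"
    then obtain f where "lin pt X f" "\<alpha> = arr pt X f" by (rule HomE)
    then show "\<alpha> = arr pt X (\<lambda>_. \<zero>\<^bsub>X\<^esub>)" using lin_zero[of pt X f] by (simp add: arr_eq_iff)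
  qed
  show "\<exists>!\<alpha>. \<alpha> \<in> Hom \<C> X pt"
  proof (rule ex1I[of _ "arr X pt (\<lambda>_. undefined)"])
    show "arr X pt (\<lambda>_. undefined) \<in> Hom \<C> X pt" by (rule arr_Hom[OF X(1) pt_FM lin_to_pt[OF X(2)]])
    fix \<alpha> assume "\<alpha> \<in> Hom \<C> X pt"
    then obtain f where f: "lin X pt f" "\<alpha> = arr X pt f" by (rule HomE)
    then show "\<alpha> = arr X pt (\<lambda>_. undefined)" using lin_in[OF f(1)] by (simp add: arr_eq_iff)
  qed
qed

text \<open>As \<open>X \<rightarrow> Y\<close> is injective, the pushout is the cokernel in a short exact sequence
  \<open>X \<rightarrow> Y \<oplus> Z \<rightarrow> P\<close>, and the claim is an instance of \<open>ses_stable_eqv\<close>.\<close>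

lemma gluing:
  assumes push: "is_pushout \<C> \<alpha> \<beta> \<iota> \<kappa>" "is_pushout \<C> \<alpha>' \<beta>' \<iota>' \<kappa>'"
    and cof: "\<alpha> \<in> cofs" "\<alpha>' \<in> cofs"
    and sq: "square \<C> \<alpha> \<alpha>' \<xi> \<eta>" "square \<C> \<beta> \<beta>' \<xi> \<zeta>"
    and weq: "\<xi> \<in> weqs" "\<eta> \<in> weqs" "\<zeta> \<in> weqs"
    and \<upsilon>: "\<upsilon> \<in> Hom \<C> (Cod \<C> \<iota>) (Cod \<C> \<iota>')" "\<upsilon> \<cdot>\<^bsub>\<C>\<^esub> \<iota> = \<iota>' \<cdot>\<^bsub>\<C>\<^esub> \<eta>" "\<upsilon> \<cdot>\<^bsub>\<C>\<^esub> \<kappa> = \<kappa>' \<cdot>\<^bsub>\<C>\<^esub> \<zeta>"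
  shows "\<upsilon> \<in> weqs"
proof -
  from push(1) obtain X Y Z P f g i j where FM: "X \<in> FM" "Y \<in> FM" "Z \<in> FM" "P \<in> FM"
    and a: "\<alpha> = arr X Y f" "\<beta> = arr X Z g" "\<iota> = arr Y P i" "\<kappa> = arr Z P j" and po: "po X Y Z P f g i j"
    by (rule is_pushoutE)
  from push(2) obtain X' Y' Z' P' f' g' i' j' where FM': "X' \<in> FM" "Y' \<in> FM" "Z' \<in> FM" "P' \<in> FM"
    and a': "\<alpha>' = arr X' Y' f'" "\<beta>' = arr X' Z' g'" "\<iota>' = arr Y' P' i'" "\<kappa>' = arr Z' P' j'"
    and po': "po X' Y' Z' P' f' g' i' j'"
    by (rule is_pushoutE)
  note l = poD(1-4)[OF po] and l' = poD(1-4)[OF po']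
  have [simp]: "lmod X" "lmod Y" "lmod Z" "lmod P" "lmod X'" "lmod Y'" "lmod Z'" "lmod P'"
    using l l' lin_dom lin_cod by blast+
  have "\<xi> \<in> Hom \<C> X X'" "\<eta> \<in> Hom \<C> Y Y'" "\<zeta> \<in> Hom \<C> Z Z'"
    using sq a a' by (simp_all add: square_def)
  then obtain x y z where x: "lin X X' x" "\<xi> = arr X X' x" and y: "lin Y Y' y" "\<eta> = arr Y Y' y"
    and z: "lin Z Z' z" "\<zeta> = arr Z Z' z" by (metis HomE)
  have "\<upsilon> \<in> Hom \<C> P P'" using \<upsilon>(1) a a' by simp
  then obtain u where u: "lin P P' u" "\<upsilon> = arr P P' u" by (rule HomE)
  have inj: "inj_on f (carrier X)" "inj_on f' (carrier X')"
    using cof a a' FM FM' l l' cofs_arr by blast+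
  have seqs: "stable_eqv X X' x" "stable_eqv Y Y' y" "stable_eqv Z Z' z"
    using weq x y z FM FM' weqs_arr by blast+
  have fx: "f' (x t) = y (f t)" and gx: "g' (x t) = z (g t)" if "t \<in> carrier X" for t
    using sq that a a' x y z l by (simp_all add: square_def arr_eq_iff)
  have ui: "u (i t) = i' (y t)" if "t \<in> carrier Y" for t
    using \<upsilon>(2) that a a' u l y by (simp add: arr_eq_iff)
  have uj: "u (j t) = j' (z t)" if "t \<in> carrier Z" for t
    using \<upsilon>(3) that a a' u l z by (simp add: arr_eq_iff)
  have "stable_eqv (dsum Y Z) (dsum Y' Z') (\<lambda>p. (y (fst p), z (snd p))) \<longleftrightarrow> stable_eqv P P' u"
  proof (rule ses_stable_eqv[OF po_ses[OF po inj(1)] po_ses[OF po' inj(2)] x(1) _ u(1)])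
    show "lin (dsum Y Z) (dsum Y' Z') (\<lambda>p. (y (fst p), z (snd p)))"
      by (rule stable_eqv_lin[OF stable_eqv_dsum[OF seqs(2,3)]])
  next
    fix t assume "t \<in> carrier X"
    then show "(f' (x t), \<ominus>\<^bsub>Z'\<^esub> g' (x t)) = (y (fst (f t, \<ominus>\<^bsub>Z\<^esub> g t)), z (snd (f t, \<ominus>\<^bsub>Z\<^esub> g t)))"
      using z l by (simp add: fx gx lin_neg)
  next
    fix t assume "t \<in> carrier (dsum Y Z)"
    then show "i' (fst (y (fst t), z (snd t))) \<oplus>\<^bsub>P'\<^esub> j' (snd (y (fst t), z (snd t))) =
        u (i (fst t) \<oplus>\<^bsub>P\<^esub> j (snd t))"
      using u l by (auto simp: lin_add ui uj)
  next
    show "finite (carrier (dsum Y Z))" "finite (carrier (dsum Y' Z'))"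
      using FM_dsum FM FM' by simp_all
  qed (rule seqs(1))
  then have "stable_eqv P P' u" using stable_eqv_dsum[OF seqs(2,3)] by blast
  then show ?thesis using arr_weqs FM FM' u by blast
qed

lemma waldhausen: "waldhausen_category \<C> pt cofs weqs"
proof (intro waldhausen_category.intro category_mc waldhausen_category_axioms.intro)
  show "zero_object \<C> pt" by (rule pt_zero)
next
  fix \<alpha> \<beta> assume sp: "span \<C> \<alpha> \<beta>"
  then have "\<alpha> \<in> Arr \<C>" "\<beta> \<in> Arr \<C>" by (simp_all add: span_def)
  from this(1) obtain X Y f where f: "X \<in> FM" "Y \<in> FM" "lin X Y f" "\<alpha> = arr X Y f" by (rule ArrE)
  from \<open>\<beta> \<in> Arr \<C>\<close> obtain X' Z g where g: "Z \<in> FM" "lin X' Z g" "\<beta> = arr X' Z g" by (rule ArrE)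
  have X': "X' = X" using sp f g by (simp add: span_def)
  obtain P i j where P: "P \<in> FM" "po X Y Z P f g i j"
    by (rule po_exists_FM[OF f(3) g(2)[unfolded X'] f(2) g(1)]) (rule that)
  have "is_pushout \<C> \<alpha> \<beta> (arr Y P i) (arr Z P j)"
    unfolding f(4) g(3) X' by (rule po_imp_is_pushout[OF P(2) f(1,2) g(1) P(1)])
  then show "\<exists>\<iota> \<kappa>. is_pushout \<C> \<alpha> \<beta> \<iota> \<kappa>" by blast
next
  fix \<alpha> \<beta> assume h: "\<alpha> \<in> cofs" "\<beta> \<in> cofs" "Dom \<C> \<beta> = Cod \<C> \<alpha>"
  from h(1) obtain M N f where f: "M \<in> FM" "N \<in> FM" "lin M N f" "\<alpha> = arr M N f" "inj_on f (carrier M)"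
    by (rule cofsE)
  from h(2) obtain N' Q g where g: "N' \<in> FM" "Q \<in> FM" "lin N' Q g" "\<beta> = arr N' Q g" "inj_on g (carrier N')"
    by (rule cofsE)
  have N': "N' = N" using h(3) f g by simp
  note g = g[unfolded N']
  have "inj_on (\<lambda>x. g (f x)) (carrier M)" using f g by (simp add: inj_on_def)
  then show "\<beta> \<cdot>\<^bsub>\<C>\<^esub> \<alpha> \<in> cofs"
    unfolding f(4) g(4) comp_arr[OF f(3)] using cofs_arr[OF f(1) g(2) lin_comp[OF f(3) g(3)]] by blast
next
  fix \<alpha> \<beta> assume h: "\<alpha> \<in> weqs" "\<beta> \<in> weqs" "Dom \<C> \<beta> = Cod \<C> \<alpha>"
  from h(1) obtain M N f where f: "M \<in> FM" "N \<in> FM" "stable_eqv M N f" "\<alpha> = arr M N f" by (rule weqsE)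
  from h(2) obtain N' Q g where g: "N' \<in> FM" "Q \<in> FM" "stable_eqv N' Q g" "\<beta> = arr N' Q g" by (rule weqsE)
  have N': "N' = N" using h(3) f g by simp
  note g = g[unfolded N']
  show "\<beta> \<cdot>\<^bsub>\<C>\<^esub> \<alpha> \<in> weqs"
    unfolding f(4) g(4) comp_arr[OF stable_eqv_lin[OF f(3)]] by (rule arr_weqs[OF f(1) g(2) stable_eqv_comp[OF f(3) g(3)]])
next
  fix \<alpha> assume iso: "iso_arrow \<C> \<alpha>"
  then have "\<alpha> \<in> Arr \<C>" by (simp add: iso_arrow_def)
  then obtain M N f where f: "M \<in> FM" "N \<in> FM" "lin M N f" "\<alpha> = arr M N f" by (rule ArrE)
  have bij: "bij_betw f (carrier M) (carrier N)" using iso_arrow_bij[of FM M N f] iso f by blast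
  show "\<alpha> \<in> cofs" using cofs_arr[OF f(1-3)] bij f(4) unfolding bij_betw_def by blast
  show "\<alpha> \<in> weqs" unfolding f(4) by (rule arr_weqs[OF f(1,2) stable_eqv_iso[OF f(3) bij]])
next
  fix X \<alpha> assume "X \<in> Obj \<C>" "\<alpha> \<in> Hom \<C> pt X"
  then obtain f where f: "pt \<in> FM" "X \<in> FM" "lin pt X f" "\<alpha> = arr pt X f" by (auto elim: HomE)
  have "inj_on f (carrier pt)" by simp
  then show "\<alpha> \<in> cofs" using cofs_arr[OF f(1-3)] f(4) by blast
next
  fix \<alpha> \<beta> \<iota> \<kappa> assume push: "is_pushout \<C> \<alpha> \<beta> \<iota> \<kappa>" and cof: "\<beta> \<in> cofs"
  from push obtain X Y Z P f g i j where FM: "X \<in> FM" "Y \<in> FM" "Z \<in> FM" "P \<in> FM"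
    and a: "\<alpha> = arr X Y f" "\<beta> = arr X Z g" "\<iota> = arr Y P i" "\<kappa> = arr Z P j" and po: "po X Y Z P f g i j"
    by (rule is_pushoutE)
  have "inj_on g (carrier X)" using cof a cofs_arr[OF FM(1,3) poD(2)[OF po]] by blast
  then have "inj_on i (carrier Y)" by (rule po_inj[OF po])
  then show "\<iota> \<in> cofs" using a cofs_arr[OF FM(2,4) poD(3)[OF po]] by blast
next
  show "cofs \<subseteq> Arr \<C>" "weqs \<subseteq> Arr \<C>" by (rule Collect_restrict)+
qed (rule gluing)

lemma saturation: "saturation_axiom \<C> weqs"
  unfolding saturation_axiom_def
proof (intro ballI impI)
  fix \<alpha> \<beta> assume A: "\<alpha> \<in> Arr \<C>" "\<beta> \<in> Arr \<C>" and D: "Dom \<C> \<beta> = Cod \<C> \<alpha>"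
  from A(1) obtain M N f where f: "M \<in> FM" "N \<in> FM" "lin M N f" "\<alpha> = arr M N f" by (rule ArrE)
  from A(2) obtain N' Q g where g: "N' \<in> FM" "Q \<in> FM" "lin N' Q g" "\<beta> = arr N' Q g" by (rule ArrE)
  have N': "N' = N" using D f g by simp
  note g = g[unfolded N']
  have gf: "\<beta> \<cdot>\<^bsub>\<C>\<^esub> \<alpha> = arr M Q (\<lambda>x. g (f x))" unfolding f(4) g(4) by (rule comp_arr[OF f(3)])
  have "\<alpha> \<in> weqs \<longleftrightarrow> stable_eqv M N f" unfolding f(4) by (rule weqs_arr[OF f(1-3)])
  moreover have "\<beta> \<in> weqs \<longleftrightarrow> stable_eqv N Q g" unfolding g(4) by (rule weqs_arr[OF f(2) g(2,3)])
  moreover have "\<beta> \<cdot>\<^bsub>\<C>\<^esub> \<alpha> \<in> weqs \<longleftrightarrow> stable_eqv M Q (\<lambda>x. g (f x))"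
    unfolding gf by (rule weqs_arr[OF f(1) g(2) lin_comp[OF f(3) g(3)]])
  ultimately show "(\<alpha> \<in> weqs \<and> \<beta> \<in> weqs \<longrightarrow> \<beta> \<cdot>\<^bsub>\<C>\<^esub> \<alpha> \<in> weqs) \<and>
      (\<alpha> \<in> weqs \<and> \<beta> \<cdot>\<^bsub>\<C>\<^esub> \<alpha> \<in> weqs \<longrightarrow> \<beta> \<in> weqs) \<and>
      (\<beta> \<in> weqs \<and> \<beta> \<cdot>\<^bsub>\<C>\<^esub> \<alpha> \<in> weqs \<longrightarrow> \<alpha> \<in> weqs)"
    using stable_eqv_comp[of M N f Q g] stable_eqv_cancel_right[of M N f Q g, OF _ _ g(3)]
      stable_eqv_cancel_left[of N Q g M f, OF _ _ f(3)] by blast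
qed

lemma cofiber_sequenceE:
  assumes "cofiber_sequence \<C> pt cofs \<alpha> \<beta>"
  obtains X Y Q f q where "X \<in> FM" "Y \<in> FM" "Q \<in> FM" "\<alpha> = arr X Y f" "\<beta> = arr Y Q q" "ses X Y Q f q"
proof -
  from assms obtain \<tau> \<sigma> where cof: "\<alpha> \<in> cofs" and \<tau>: "\<tau> \<in> Hom \<C> (Dom \<C> \<alpha>) pt"
    and push: "is_pushout \<C> \<alpha> \<tau> \<beta> \<sigma>"
    unfolding cofiber_sequence_def by blast
  from push obtain X Y Z Q f g q j where FM: "X \<in> FM" "Y \<in> FM" "Z \<in> FM" "Q \<in> FM"
    and a: "\<alpha> = arr X Y f" "\<tau> = arr X Z g" "\<beta> = arr Y Q q" "\<sigma> = arr Z Q j" and po: "po X Y Z Q f g q j"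
    by (rule is_pushoutE)
  note l = poD(1-4)[OF po]
  have [simp]: "lmod X" "lmod Y" "lmod Q" using l lin_dom lin_cod by blast+
  have Z: "Z = pt" using \<tau> a by (auto simp: Hom_iff arr_eq_iff)
  have j0: "j z = \<zero>\<^bsub>Q\<^esub>" if "z \<in> carrier Z" for z using that lin_zero[OF l(4)] Z by simp
  have "ses X Y Q f q"
    unfolding ses_def
  proof (intro conjI l ballI iffI)
    show "inj_on f (carrier X)" using cof a cofs_arr[OF FM(1,2) l(1)] by blast
    show "q ` carrier Y = carrier Q"
    proof
      show "q ` carrier Y \<subseteq> carrier Q" using l by auto
      show "carrier Q \<subseteq> q ` carrier Y"
      proof
        fix p assume "p \<in> carrier Q"
        then obtain y z where "y \<in> carrier Y" "z \<in> carrier Z" "p = q y \<oplus>\<^bsub>Q\<^esub> j z" using poD(6)[OF po] by blast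
        then show "p \<in> q ` carrier Y" using j0 l by simp
      qed
    qed
  next
    fix y assume y: "y \<in> carrier Y" "q y = \<zero>\<^bsub>Q\<^esub>"
    have "\<zero>\<^bsub>Z\<^esub> \<in> carrier Z" using Z by simp
    moreover from this have "q y \<oplus>\<^bsub>Q\<^esub> j \<zero>\<^bsub>Z\<^esub> = \<zero>\<^bsub>Q\<^esub>" using y j0 by simp
    ultimately show "y \<in> f ` carrier X" using poD(7)[OF po y(1)] by blast
  next
    fix y assume "y \<in> carrier Y" "y \<in> f ` carrier X"
    then obtain x where "x \<in> carrier X" "y = f x" by blast
    then show "q y = \<zero>\<^bsub>Q\<^esub>" using poD(5)[OF po] j0 l by simp
  qed
  then show ?thesis using FM a by (intro that) auto
qed

lemma extension: "extension_axiom \<C> pt cofs weqs"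
  unfolding extension_axiom_def
proof (intro allI impI, elim conjE)
  fix \<alpha> \<beta> \<alpha>' \<beta>' \<xi> \<eta> \<zeta>
  assume cs: "cofiber_sequence \<C> pt cofs \<alpha> \<beta>" "cofiber_sequence \<C> pt cofs \<alpha>' \<beta>'"
    and sq: "square \<C> \<alpha> \<alpha>' \<xi> \<eta>" "square \<C> \<beta> \<beta>' \<eta> \<zeta>" and weq: "\<xi> \<in> weqs" "\<zeta> \<in> weqs"
  from cs(1) obtain X Y Q f q where FM: "X \<in> FM" "Y \<in> FM" "Q \<in> FM"
    and a: "\<alpha> = arr X Y f" "\<beta> = arr Y Q q" and s: "ses X Y Q f q" by (rule cofiber_sequenceE)
  from cs(2) obtain X' Y' Q' f' q' where FM': "X' \<in> FM" "Y' \<in> FM" "Q' \<in> FM"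
    and a': "\<alpha>' = arr X' Y' f'" "\<beta>' = arr Y' Q' q'" and s': "ses X' Y' Q' f' q'" by (rule cofiber_sequenceE)
  note l = sesD(1,2)[OF s] and l' = sesD(1,2)[OF s']
  have [simp]: "lmod Y" "lmod Y'" using l l' lin_cod by blast+
  have "\<xi> \<in> Hom \<C> X X'" "\<eta> \<in> Hom \<C> Y Y'" "\<zeta> \<in> Hom \<C> Q Q'"
    using sq a a' by (simp_all add: square_def)
  then obtain x y z where x: "lin X X' x" "\<xi> = arr X X' x" and y: "lin Y Y' y" "\<eta> = arr Y Y' y"
    and z: "lin Q Q' z" "\<zeta> = arr Q Q' z" by (metis HomE)
  have left: "f' (x t) = y (f t)" if "t \<in> carrier X" for t
    using sq(1) that a a' x y l by (simp add: square_def arr_eq_iff)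
  have right: "q' (y t) = z (q t)" if "t \<in> carrier Y" for t
    using sq(2) that a a' y z l by (simp add: square_def arr_eq_iff)
  have seqs: "stable_eqv X X' x" "stable_eqv Q Q' z" using weq x z FM FM' weqs_arr by blast+
  have fin: "finite (carrier Y)" "finite (carrier Y')" using FM FM' FM_iff by simp_all
  have "stable_eqv Y Y' y"
    using ses_stable_eqv[OF s s' x(1) y(1) z(1) left right fin seqs(1)] seqs(2) by blast
  then show "\<eta> \<in> weqs" unfolding y(2) by (rule arr_weqs[OF FM(2) FM'(2)])
qed

section \<open>The cylinder functor\<close>

abbreviation cyl_mod :: "('r, 'm) module \<Rightarrow> ('r, 'm) module \<Rightarrow> ('r, 'm \<times> ('r \<Rightarrow> 'm)) module" where
  "cyl_mod X Y \<equiv> dsum Y (coind X)"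

text \<open>The cylinder of \<open>X \<rightarrow> Y\<close> is \<open>Y \<oplus> I(X)\<close>, transported to the universe.  For \<open>X = pt\<close> it has to
  be equal to \<open>Y\<close>; this is harmless, since \<open>I(pt)\<close> is zero and \<open>fst\<close> identifies \<open>Y \<oplus> I(pt)\<close> with
  \<open>Y\<close>.\<close>

definition cyl_obj :: "('r, 'm) module \<Rightarrow> ('r, 'm) module \<Rightarrow> ('r, 'm) module" where
  "cyl_obj X Y = (if X = pt then Y else transport (cyl_mod X Y))"

definition cyl_iso :: "('r, 'm) module \<Rightarrow> ('r, 'm) module \<Rightarrow> 'm \<times> ('r \<Rightarrow> 'm) \<Rightarrow> 'm" where
  "cyl_iso X Y = (if X = pt then fst else transport_map (cyl_mod X Y))"

definition cyl_inv :: "('r, 'm) module \<Rightarrow> ('r, 'm) module \<Rightarrow> 'm \<Rightarrow> 'm \<times> ('r \<Rightarrow> 'm)" where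
  "cyl_inv X Y = inv_into (carrier (cyl_mod X Y)) (cyl_iso X Y)"

lemma coind_pt: "carrier (coind pt) = {\<zero>\<^bsub>coind pt\<^esub>}"
proof -
  have "\<phi> = \<zero>\<^bsub>coind pt\<^esub>" if "\<phi> \<in> carrier (coind pt)" for \<phi>
    by (rule coind_eqI[of _ pt]) (use that coind_in[OF that] in simp_all)
  moreover have "\<zero>\<^bsub>coind pt\<^esub> \<in> carrier (coind pt)" by simp
  ultimately show ?thesis by blast
qed

context
  fixes X Y :: "('r, 'm) module"
  assumes X: "X \<in> FM" "lmod X" and Y: "Y \<in> FM" "lmod Y"
begin

lemma finite_cyl_mod: "finite (carrier (cyl_mod X Y))"
  using X Y FM_iff fin_R finite_coind[of X] by simp

lemma lmod_cyl_mod: "lmod (cyl_mod X Y)"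
  using X Y by simp

lemma lin_cyl_iso: "lin (cyl_mod X Y) (cyl_obj X Y) (cyl_iso X Y)"
proof (cases "X = pt")
  case True
  have "lin (cyl_mod X Y) Y fst" by (rule lin_fst) (use X Y in simp_all)
  with True show ?thesis by (simp add: cyl_obj_def cyl_iso_def)
next
  case False
  then show ?thesis
    using transport(1)[OF lmod_cyl_mod finite_cyl_mod] by (simp add: cyl_obj_def cyl_iso_def)
qed

lemma bij_cyl_iso: "bij_betw (cyl_iso X Y) (carrier (cyl_mod X Y)) (carrier (cyl_obj X Y))"
proof (cases "X = pt")
  case True
  then show ?thesis
    by (auto simp: cyl_obj_def cyl_iso_def coind_pt bij_betw_def inj_on_def)
next
  case False
  then show ?thesis
    using transport(2)[OF lmod_cyl_mod finite_cyl_mod] by (simp add: cyl_obj_def cyl_iso_def)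
qed

lemma lmod_cyl: "lmod (cyl_obj X Y)"
  by (rule lin_cod[OF lin_cyl_iso])

lemma FM_cyl: "cyl_obj X Y \<in> FM"
  using FM_iff[OF lmod_cyl] bij_betw_finite[OF bij_cyl_iso] finite_cyl_mod by blast

lemma lin_cyl_inv: "lin (cyl_obj X Y) (cyl_mod X Y) (cyl_inv X Y)"
  unfolding cyl_inv_def by (rule lin_inv_into[OF lin_cyl_iso bij_cyl_iso])

lemma cyl_inv_iso: "p \<in> carrier (cyl_mod X Y) \<Longrightarrow> cyl_inv X Y (cyl_iso X Y p) = p"
  unfolding cyl_inv_def using bij_cyl_iso unfolding bij_betw_def by (rule inv_into_f_f[OF conjunct1])

lemma cyl_iso_inv: "t \<in> carrier (cyl_obj X Y) \<Longrightarrow> cyl_iso X Y (cyl_inv X Y t) = t"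
  unfolding cyl_inv_def using bij_cyl_iso unfolding bij_betw_def by (metis f_inv_into_f)

lemma bij_cyl_inv: "bij_betw (cyl_inv X Y) (carrier (cyl_obj X Y)) (carrier (cyl_mod X Y))"
  unfolding cyl_inv_def by (rule bij_betw_inv_into[OF bij_cyl_iso])

lemma cyl_inv_in:
  assumes "t \<in> carrier (cyl_obj X Y)"
  shows "fst (cyl_inv X Y t) \<in> carrier Y" "snd (cyl_inv X Y t) \<in> carrier (coind X)"
  using lin_in[OF lin_cyl_inv assms] by auto

lemma cyl_objE:
  assumes "t \<in> carrier (cyl_obj X Y)"
  obtains y \<phi> where "y \<in> carrier Y" "\<phi> \<in> carrier (coind X)" "t = cyl_iso X Y (y, \<phi>)"
  using that[of "fst (cyl_inv X Y t)" "snd (cyl_inv X Y t)"] cyl_inv_in[OF assms] cyl_iso_inv[OF assms]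
  by simp

end

text \<open>With \<open>Y \<oplus> I(X)\<close> for the cylinder, \<open>j\<^sub>1 = (f, \<eta>)\<close>, \<open>j\<^sub>2\<close> is the inclusion of \<open>Y\<close>, \<open>p\<close> is the
  projection to \<open>Y\<close>, and a morphism of arrows \<open>(a, b)\<close> induces \<open>b \<oplus> I(a)\<close>.\<close>

definition front_incl :: "('r, 'm) module \<Rightarrow> ('r, 'm) module \<Rightarrow> ('m \<Rightarrow> 'm) \<Rightarrow> 'm \<Rightarrow> 'm" where
  "front_incl X Y f x = cyl_iso X Y (f x, eta X x)"

definition back_incl :: "('r, 'm) module \<Rightarrow> ('r, 'm) module \<Rightarrow> 'm \<Rightarrow> 'm" where
  "back_incl X Y y = cyl_iso X Y (y, \<zero>\<^bsub>coind X\<^esub>)"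

definition cyl_proj :: "('r, 'm) module \<Rightarrow> ('r, 'm) module \<Rightarrow> 'm \<Rightarrow> 'm" where
  "cyl_proj X Y t = fst (cyl_inv X Y t)"

definition cyl_fun :: "('r, 'm) module \<Rightarrow> ('r, 'm) module \<Rightarrow> ('r, 'm) module \<Rightarrow> ('r, 'm) module \<Rightarrow>
    ('m \<Rightarrow> 'm) \<Rightarrow> ('m \<Rightarrow> 'm) \<Rightarrow> 'm \<Rightarrow> 'm" where
  "cyl_fun X' Y' X Y a b t = cyl_iso X Y (b (fst (cyl_inv X' Y' t)), cmap a (snd (cyl_inv X' Y' t)))"

definition cyl :: "(('r, 'm) module, ('r, 'm) module_arrow) cylinder" where
  "cyl = \<lparr>Cyl = (\<lambda>(X, Y, f). cyl_obj X Y),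
     j1 = (\<lambda>(X, Y, f). arr X (cyl_obj X Y) (front_incl X Y f)),
     j2 = (\<lambda>(X, Y, f). arr Y (cyl_obj X Y) (back_incl X Y)),
     pr = (\<lambda>(X, Y, f). arr (cyl_obj X Y) Y (cyl_proj X Y)),
     Cyl_map = (\<lambda>(X', Y', f') (X, Y, f) (_, _, a) (_, _, b).
       arr (cyl_obj X' Y') (cyl_obj X Y) (cyl_fun X' Y' X Y a b))\<rparr>"

lemma cyl_arr [simp]:
  "Cyl cyl (arr X Y f) = cyl_obj X Y"
  "j1 cyl (arr X Y f) = arr X (cyl_obj X Y) (front_incl X Y f)"
  "j2 cyl (arr X Y f) = arr Y (cyl_obj X Y) (back_incl X Y)"
  "pr cyl (arr X Y f) = arr (cyl_obj X Y) Y (cyl_proj X Y)"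
  by (simp_all add: cyl_def arr_def front_incl_def restrict_def fun_eq_iff)

lemma Cyl_map_arr:
  assumes "X' \<in> FM" "lmod X'" "Y' \<in> FM" "lmod Y'"
  shows "Cyl_map cyl (arr X' Y' f') (arr X Y f) (arr X' X a) (arr Y' Y b) =
    arr (cyl_obj X' Y') (cyl_obj X Y) (cyl_fun X' Y' X Y a b)"
proof -
  have "cmap (restrict a (carrier X')) \<phi> = cmap a \<phi>" if "\<phi> \<in> carrier (coind X')" for \<phi>
    unfolding cmap_def by (rule restrict_ext) (use that in simp)
  then have "cyl_fun X' Y' X Y (restrict a (carrier X')) (restrict b (carrier Y')) t = cyl_fun X' Y' X Y a b t"
    if "t \<in> carrier (cyl_obj X' Y')" for t
    using cyl_inv_in[OF assms that] by (simp add: cyl_fun_def)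
  then have "arr (cyl_obj X' Y') (cyl_obj X Y) (cyl_fun X' Y' X Y (restrict a (carrier X')) (restrict b (carrier Y'))) =
      arr (cyl_obj X' Y') (cyl_obj X Y) (cyl_fun X' Y' X Y a b)"
    by (simp add: arr_eq_iff)
  then show ?thesis by (simp add: cyl_def arr_def)
qed

lemma lin_front_incl:
  assumes "X \<in> FM" "lmod X" "Y \<in> FM" "lmod Y" "lin X Y f"
  shows "lin X (cyl_obj X Y) (front_incl X Y f)"
  using lin_comp[OF lin_cone_map[OF assms(5)] lin_cyl_iso[OF assms(1-4)]] by (simp add: front_incl_def[abs_def])

lemma lin_back_incl:
  assumes "X \<in> FM" "lmod X" "Y \<in> FM" "lmod Y"
  shows "lin Y (cyl_obj X Y) (back_incl X Y)"
  using lin_comp[OF lin_pair[OF lin_id lin_const_zero] lin_cyl_iso[OF assms]] assms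
  by (simp add: back_incl_def[abs_def])

lemma lin_cyl_proj:
  assumes "X \<in> FM" "lmod X" "Y \<in> FM" "lmod Y"
  shows "lin (cyl_obj X Y) Y (cyl_proj X Y)"
  using lin_comp[OF lin_cyl_inv[OF assms] lin_fst] assms by (simp add: cyl_proj_def[abs_def])

lemma lin_cyl_fun:
  assumes "X' \<in> FM" "lmod X'" "Y' \<in> FM" "lmod Y'" "X \<in> FM" "lmod X" "Y \<in> FM" "lmod Y"
    and a: "lin X' X a" and b: "lin Y' Y b"
  shows "lin (cyl_obj X' Y') (cyl_obj X Y) (cyl_fun X' Y' X Y a b)"
proof -
  have "lin (cyl_mod X' Y') (cyl_mod X Y) (\<lambda>p. (b (fst p), cmap a (snd p)))"
    by (intro lin_pair lin_comp[OF lin_fst b] lin_comp[OF lin_snd lin_cmap[OF a]]) (use assms in simp_all)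
  from lin_comp[OF lin_comp[OF lin_cyl_inv[OF assms(1-4)] this] lin_cyl_iso[OF assms(5-8)]]
  show ?thesis by (simp add: cyl_fun_def[abs_def])
qed

lemma cyl_fun_iso:
  assumes "X' \<in> FM" "lmod X'" "Y' \<in> FM" "lmod Y'" "y \<in> carrier Y'" "\<phi> \<in> carrier (coind X')"
  shows "cyl_fun X' Y' X Y a b (cyl_iso X' Y' (y, \<phi>)) = cyl_iso X Y (b y, cmap a \<phi>)"
  using cyl_inv_iso[OF assms(1-4), of "(y, \<phi>)"] assms by (simp add: cyl_fun_def)

lemma cyl_proj_iso:
  assumes "X \<in> FM" "lmod X" "Y \<in> FM" "lmod Y" "y \<in> carrier Y" "\<phi> \<in> carrier (coind X)"
  shows "cyl_proj X Y (cyl_iso X Y (y, \<phi>)) = y"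
  using cyl_inv_iso[OF assms(1-4), of "(y, \<phi>)"] assms by (simp add: cyl_proj_def)

lemma cyl_iso_eq_iff:
  assumes "X \<in> FM" "lmod X" "Y \<in> FM" "lmod Y" "p \<in> carrier (cyl_mod X Y)" "q \<in> carrier (cyl_mod X Y)"
  shows "cyl_iso X Y p = cyl_iso X Y q \<longleftrightarrow> p = q"
  using cyl_inv_iso[OF assms(1-4)] assms(5,6) by metis

lemma cmap_inj:
  fixes N :: "('r, 'y) module"
  assumes "lin M N f" "inj_on f (carrier M)" shows "inj_on (cmap f) (carrier (coind M))"
proof -
  obtain C :: "('r, 'y) module" and q where "ses M N C f q"
    by (rule ses_cokernel_exists[OF assms]) (rule that)
  then show ?thesis using sesD(3)[OF ses_coind] by blast
qed

lemma cyl_fun_inj: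
  assumes "X' \<in> FM" "lmod X'" "Y' \<in> FM" "lmod Y'" "X \<in> FM" "lmod X" "Y \<in> FM" "lmod Y"
    and a: "lin X' X a" "inj_on a (carrier X')" and b: "lin Y' Y b" "inj_on b (carrier Y')"
  shows "inj_on (cyl_fun X' Y' X Y a b) (carrier (cyl_obj X' Y'))"
proof (rule inj_onI)
  note A' = assms(1-4) and A = assms(5-8)
  fix s t assume s: "s \<in> carrier (cyl_obj X' Y')" and t: "t \<in> carrier (cyl_obj X' Y')"
    and eq: "cyl_fun X' Y' X Y a b s = cyl_fun X' Y' X Y a b t"
  obtain y \<phi> where y: "y \<in> carrier Y'" "\<phi> \<in> carrier (coind X')" "s = cyl_iso X' Y' (y, \<phi>)"
    by (rule cyl_objE[OF A' s])
  obtain z \<psi> where z: "z \<in> carrier Y'" "\<psi> \<in> carrier (coind X')" "t = cyl_iso X' Y' (z, \<psi>)"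
    by (rule cyl_objE[OF A' t])
  have "cyl_iso X Y (b y, cmap a \<phi>) = cyl_iso X Y (b z, cmap a \<psi>)"
    using eq y z by (simp add: cyl_fun_iso[OF A'])
  then have "b y = b z" "cmap a \<phi> = cmap a \<psi>"
    using cyl_iso_eq_iff[OF A, of "(b y, cmap a \<phi>)" "(b z, cmap a \<psi>)"] y z b(1) lin_cmap[OF a(1)] by simp_all
  then have "y = z" "\<phi> = \<psi>"
    using inj_onD[OF b(2) _ y(1) z(1)] inj_onD[OF cmap_inj[OF a] _ y(2) z(2)] by blast+
  then show "s = t" using y z by simp
qed

lemma cyl_fun_stable_eqv:
  assumes "X' \<in> FM" "lmod X'" "Y' \<in> FM" "lmod Y'" "X \<in> FM" "lmod X" "Y \<in> FM" "lmod Y"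
    and a: "lin X' X a" and b: "stable_eqv Y' Y b"
  shows "stable_eqv (cyl_obj X' Y') (cyl_obj X Y) (cyl_fun X' Y' X Y a b)"
proof -
  note A' = assms(1-4) and A = assms(5-8)
  have "stable_eqv (coind X') (coind X) (cmap a)"
    by (rule stable_eqv_inj_mod[OF inj_mod_coind inj_mod_coind lin_cmap[OF a]]) (use assms in simp_all)
  from stable_eqv_comp[OF stable_eqv_comp[OF stable_eqv_iso[OF lin_cyl_inv[OF A'] bij_cyl_inv[OF A']] stable_eqv_dsum[OF b this]]
      stable_eqv_iso[OF lin_cyl_iso[OF A] bij_cyl_iso[OF A]]]
  show ?thesis by (simp add: cyl_fun_def[abs_def])
qed

lemma squareE:
  assumes "square \<C> \<alpha>' \<alpha> \<xi> \<eta>"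
  obtains X' Y' X Y f' f a b where "X' \<in> FM" "lmod X'" "Y' \<in> FM" "lmod Y'" "X \<in> FM" "lmod X" "Y \<in> FM" "lmod Y"
    "\<alpha>' = arr X' Y' f'" "\<alpha> = arr X Y f" "\<xi> = arr X' X a" "\<eta> = arr Y' Y b"
    "lin X' Y' f'" "lin X Y f" "lin X' X a" "lin Y' Y b"
    "\<And>x. x \<in> carrier X' \<Longrightarrow> f (a x) = b (f' x)"
proof -
  have A: "\<alpha>' \<in> Arr \<C>" "\<alpha> \<in> Arr \<C>" and H: "\<xi> \<in> Hom \<C> (Dom \<C> \<alpha>') (Dom \<C> \<alpha>)" "\<eta> \<in> Hom \<C> (Cod \<C> \<alpha>') (Cod \<C> \<alpha>)"
    and eq: "\<alpha> \<cdot>\<^bsub>\<C>\<^esub> \<xi> = \<eta> \<cdot>\<^bsub>\<C>\<^esub> \<alpha>'" using assms by (simp_all add: square_def)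
  from A(1) obtain X' Y' f' where f': "X' \<in> FM" "Y' \<in> FM" "lin X' Y' f'" "\<alpha>' = arr X' Y' f'" by (rule ArrE)
  from A(2) obtain X Y f where f: "X \<in> FM" "Y \<in> FM" "lin X Y f" "\<alpha> = arr X Y f" by (rule ArrE)
  from H(1) obtain a where a: "lin X' X a" "\<xi> = arr X' X a" unfolding f'(4) f(4) mc_simps by (rule HomE)
  from H(2) obtain b where b: "lin Y' Y b" "\<eta> = arr Y' Y b" unfolding f'(4) f(4) mc_simps by (rule HomE)
  have "f (a x) = b (f' x)" if "x \<in> carrier X'" for x
    using eq that f f' a b by (simp add: arr_eq_iff)
  then show ?thesis
    using that[OF f'(1) lin_dom[OF f'(3)] f'(2) lin_cod[OF f'(3)] f(1) lin_dom[OF f(3)] f(2) lin_cod[OF f(3)]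
      f'(4) f(4) a(2) b(2) f'(3) f(3) a(1) b(1)] by blast
qed

text \<open>The iterated pushout is \<open>Y \<oplus> (X \<amalg>\<^bsub>X'\<^esub> I(X'))\<close>, and it embeds in \<open>Y \<oplus> I(X)\<close> because \<open>\<eta>(X)\<close> and
  \<open>I(X')\<close> meet in \<open>\<eta>(X')\<close> only: if the map \<open>r \<mapsto> r x\<close> takes its values in \<open>X'\<close>, then \<open>x \<in> X'\<close>, as
  \<open>x\<close> is its value at \<open>1\<close>.\<close>

lemma pushout_cylinder_mono:
  assumes sq: "square \<C> \<alpha>' \<alpha> \<xi> \<eta>" and cof: "\<xi> \<in> cofs" "\<eta> \<in> cofs"
    and push1: "is_pushout \<C> \<xi> (j1 cyl \<alpha>') \<iota> \<kappa>"
    and push2: "is_pushout \<C> (\<kappa> \<cdot>\<^bsub>\<C>\<^esub> j2 cyl \<alpha>') \<eta> \<rho> \<mu>"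
    and \<upsilon>: "\<upsilon> \<in> Hom \<C> (Cod \<C> \<rho>) (Cyl cyl \<alpha>)"
    and \<upsilon>1: "\<upsilon> \<cdot>\<^bsub>\<C>\<^esub> (\<rho> \<cdot>\<^bsub>\<C>\<^esub> \<iota>) = j1 cyl \<alpha>" and \<upsilon>2: "\<upsilon> \<cdot>\<^bsub>\<C>\<^esub> (\<rho> \<cdot>\<^bsub>\<C>\<^esub> \<kappa>) = Cyl_map cyl \<alpha>' \<alpha> \<xi> \<eta>"
    and \<upsilon>3: "\<upsilon> \<cdot>\<^bsub>\<C>\<^esub> \<mu> = j2 cyl \<alpha>"
  shows "\<upsilon> \<in> cofs"
proof -
  from sq obtain X' Y' X Y f' f a b where A': "X' \<in> FM" "lmod X'" "Y' \<in> FM" "lmod Y'"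
    and A: "X \<in> FM" "lmod X" "Y \<in> FM" "lmod Y"
    and e: "\<alpha>' = arr X' Y' f'" "\<alpha> = arr X Y f" "\<xi> = arr X' X a" "\<eta> = arr Y' Y b"
    and l: "lin X' Y' f'" "lin X Y f" "lin X' X a" "lin Y' Y b"
    and comm: "\<And>x. x \<in> carrier X' \<Longrightarrow> f (a x) = b (f' x)"
    by (rule squareE) (rule that)
  have [simp]: "lmod X'" "lmod Y'" "lmod X" "lmod Y" by (fact A' A)+
  let ?T' = "cyl_obj X' Y'" and ?T = "cyl_obj X Y"
  have [simp]: "lmod ?T'" "lmod ?T" by (fact lmod_cyl[OF A'] lmod_cyl[OF A])+
  from push1 obtain X1 X2 T1 P a1 g1 i k where p1: "P \<in> FM" "\<xi> = arr X1 X2 a1" "j1 cyl \<alpha>' = arr X1 T1 g1"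
    "\<iota> = arr X2 P i" "\<kappa> = arr T1 P k" and po1: "po X1 X2 T1 P a1 g1 i k" by (rule is_pushoutE)
  have t1: "X1 = X'" "X2 = X" "T1 = ?T'" using p1 e by (simp_all add: arr_eq_iff)
  note p1 = p1[unfolded t1] and po1 = po1[unfolded t1]
  from push2 obtain Y1 P1 Y2 Q c1 b1 l' m where p2: "Q \<in> FM" "\<kappa> \<cdot>\<^bsub>\<C>\<^esub> j2 cyl \<alpha>' = arr Y1 P1 c1" "\<eta> = arr Y1 Y2 b1"
    "\<rho> = arr P1 Q l'" "\<mu> = arr Y2 Q m" and po2: "po Y1 P1 Y2 Q c1 b1 l' m" by (rule is_pushoutE)
  have kb: "\<kappa> \<cdot>\<^bsub>\<C>\<^esub> j2 cyl \<alpha>' = arr Y' P (\<lambda>y. k (back_incl X' Y' y))"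
    using lin_back_incl[OF A'] p1 e by simp
  have t2: "Y1 = Y'" "P1 = P" "Y2 = Y" using p2 e kb by (simp_all add: arr_eq_iff)
  note p2 = p2[unfolded t2] and po2 = po2[unfolded t2]
  note L1 = poD(1-4)[OF po1] and L2 = poD(1-4)[OF po2]
  have [simp]: "lmod P" "lmod Q" using L1 L2 lin_cod by blast+
  have a1: "a1 x = a x" if "x \<in> carrier X'" for x using p1(2) e that by (simp add: arr_eq_iff)
  have g1: "g1 x = front_incl X' Y' f' x" if "x \<in> carrier X'" for x using p1(3) e that by (simp add: arr_eq_iff)
  have c1: "c1 y = k (back_incl X' Y' y)" if "y \<in> carrier Y'" for y using p2(2) kb that by (simp add: arr_eq_iff)
  have b1: "b1 y = b y" if "y \<in> carrier Y'" for y using p2(3) e that by (simp add: arr_eq_iff)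
  have "\<upsilon> \<in> Hom \<C> Q ?T" using \<upsilon> p2 e by simp
  then obtain u where u: "lin Q ?T u" "\<upsilon> = arr Q ?T u" by (rule HomE)
  have u1: "u (l' (i x)) = front_incl X Y f x" if "x \<in> carrier X" for x
    using \<upsilon>1 that u p1 p2 e L1 L2 lin_comp[OF L1(3) L2(3)] by (simp add: arr_eq_iff)
  have u2: "u (l' (k t)) = cyl_fun X' Y' X Y a b t" if "t \<in> carrier ?T'" for t
  proof -
    have "\<upsilon> \<cdot>\<^bsub>\<C>\<^esub> (\<rho> \<cdot>\<^bsub>\<C>\<^esub> \<kappa>) = arr ?T' ?T (\<lambda>t. u (l' (k t)))"
      unfolding u(2) p2(4) p1(5) by (simp only: comp_arr[OF L1(4)] comp_arr[OF lin_comp[OF L1(4) L2(3)]])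
    moreover have "Cyl_map cyl \<alpha>' \<alpha> \<xi> \<eta> = arr ?T' ?T (cyl_fun X' Y' X Y a b)"
      unfolding e by (rule Cyl_map_arr[OF A'])
    ultimately show ?thesis using \<upsilon>2 that by (simp add: arr_eq_iff)
  qed
  have u3: "u (m y) = back_incl X Y y" if "y \<in> carrier Y" for y
    using \<upsilon>3 that u p2 e L2 by (simp add: arr_eq_iff)
  have inj_a: "inj_on a (carrier X')" using cof(1) unfolding e(3) cofs_arr[OF A'(1) A(1) l(3)] .
  have "inj_on u (carrier Q)"
    unfolding inj_on_lin_iff[OF u(1)]
  proof (intro ballI impI)
    fix q assume "q \<in> carrier Q" and 0: "u q = \<zero>\<^bsub>?T\<^esub>"
    then obtain p y where p: "p \<in> carrier P" and y: "y \<in> carrier Y" and q: "q = l' p \<oplus>\<^bsub>Q\<^esub> m y"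
      using poD(6)[OF po2] by blast
    obtain x t where x: "x \<in> carrier X" and t: "t \<in> carrier ?T'" and p_eq: "p = i x \<oplus>\<^bsub>P\<^esub> k t"
      using poD(6)[OF po1 p] by blast
    obtain y' \<psi> where y': "y' \<in> carrier Y'" and \<psi>: "\<psi> \<in> carrier (coind X')" and t_eq: "t = cyl_iso X' Y' (y', \<psi>)"
      by (rule cyl_objE[OF A' t])
    have \<psi>in: "cmap a \<psi> \<in> carrier (coind X)" by (rule lin_in[OF lin_cmap[OF l(3)] \<psi>])
    have \<eta>in: "eta X x \<in> carrier (coind X)" by (rule lin_in[OF lin_eta x]) simp
    have "u q = front_incl X Y f x \<oplus>\<^bsub>?T\<^esub> cyl_fun X' Y' X Y a b t \<oplus>\<^bsub>?T\<^esub> back_incl X Y y"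
      unfolding q p_eq using u(1) L1 L2 x t y by (simp add: lin_add u1 u2 u3)
    also have "\<dots> = cyl_iso X Y (f x \<oplus>\<^bsub>Y\<^esub> b y' \<oplus>\<^bsub>Y\<^esub> y, eta X x \<oplus>\<^bsub>coind X\<^esub> cmap a \<psi>)"
      unfolding t_eq cyl_fun_iso[OF A' y' \<psi>] front_incl_def back_incl_def
      using lin_add[OF lin_cyl_iso[OF A], symmetric] x y y' l \<psi>in \<eta>in by simp
    finally have "cyl_iso X Y (f x \<oplus>\<^bsub>Y\<^esub> b y' \<oplus>\<^bsub>Y\<^esub> y, eta X x \<oplus>\<^bsub>coind X\<^esub> cmap a \<psi>) =
        cyl_iso X Y \<zero>\<^bsub>cyl_mod X Y\<^esub>"
      using 0 lin_zero[OF lin_cyl_iso[OF A]] by simp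
    then have z1: "f x \<oplus>\<^bsub>Y\<^esub> b y' \<oplus>\<^bsub>Y\<^esub> y = \<zero>\<^bsub>Y\<^esub>" and z2: "eta X x \<oplus>\<^bsub>coind X\<^esub> cmap a \<psi> = \<zero>\<^bsub>coind X\<^esub>"
      using cyl_iso_eq_iff[OF A, of "(f x \<oplus>\<^bsub>Y\<^esub> b y' \<oplus>\<^bsub>Y\<^esub> y, eta X x \<oplus>\<^bsub>coind X\<^esub> cmap a \<psi>)" "\<zero>\<^bsub>cyl_mod X Y\<^esub>"]
        x y y' l \<psi>in \<eta>in by simp_all
    \<comment> \<open>The sign makes \<open>x = a x'\<close>, by evaluation of the second component at \<open>1\<close>.\<close>
    define x' where "x' = \<ominus>\<^bsub>X'\<^esub> \<psi> \<one>\<^bsub>R\<^esub>"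
    have x': "x' \<in> carrier X'" unfolding x'_def using \<psi> by simp
    have "x \<oplus>\<^bsub>X\<^esub> a (\<psi> \<one>\<^bsub>R\<^esub>) = \<zero>\<^bsub>X\<^esub>" using fun_cong[OF z2, of "\<one>\<^bsub>R\<^esub>"] x by simp
    then have xa: "x = a x'" unfolding x'_def using x \<psi> l by (simp add: lin_neg lmod_eq_neg_iff)
    have \<psi>_eq: "\<psi> = eta X' (\<ominus>\<^bsub>X'\<^esub> x')"
    proof (rule coind_eqI[OF \<psi>])
      show "eta X' (\<ominus>\<^bsub>X'\<^esub> x') \<in> carrier (coind X')" by (rule lin_in[OF lin_eta]) (simp_all add: x')
      fix r assume r: "r \<in> carrier R"
      have "r \<odot>\<^bsub>X\<^esub> x \<oplus>\<^bsub>X\<^esub> a (\<psi> r) = \<zero>\<^bsub>X\<^esub>" using fun_cong[OF z2, of r] r by simp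
      then have "a (r \<odot>\<^bsub>X'\<^esub> x' \<oplus>\<^bsub>X'\<^esub> \<psi> r) = \<zero>\<^bsub>X\<^esub>" unfolding xa using r x' \<psi> l by (simp add: lin_add lin_smult)
      then have "\<psi> r \<oplus>\<^bsub>X'\<^esub> r \<odot>\<^bsub>X'\<^esub> x' = \<zero>\<^bsub>X'\<^esub>"
        using inj_a r x' \<psi> unfolding inj_on_lin_iff[OF l(3)] by (simp add: lmod_comm)
      then show "\<psi> r = eta X' (\<ominus>\<^bsub>X'\<^esub> x') r" using r x' \<psi> by (simp add: lmod_eq_neg_iff lmod_smult_minus)
    qed
    define w where "w = f' x' \<oplus>\<^bsub>Y'\<^esub> y'"
    have w: "w \<in> carrier Y'" unfolding w_def using x' y' l by simp
    have i_eq: "i x = k (front_incl X' Y' f' x')" unfolding xa using poD(5)[OF po1 x'] x' by (simp add: a1 g1)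
    have "eta X' x' \<oplus>\<^bsub>coind X'\<^esub> \<psi> = \<zero>\<^bsub>coind X'\<^esub>"
      unfolding \<psi>_eq using x' lin_in[OF lin_eta, of X' x'] by (simp add: lin_neg[OF lin_eta])
    then have "front_incl X' Y' f' x' \<oplus>\<^bsub>?T'\<^esub> t = back_incl X' Y' w"
      unfolding t_eq front_incl_def back_incl_def w_def
      using lin_add[OF lin_cyl_iso[OF A'], symmetric] x' y' l \<psi> lin_in[OF lin_eta, of X' x'] by simp
    moreover have "p = k (front_incl X' Y' f' x' \<oplus>\<^bsub>?T'\<^esub> t)"
      unfolding p_eq i_eq using L1(4) lin_in[OF lin_front_incl[OF A' l(1)] x'] t by (simp add: lin_add)
    ultimately have "l' p = l' (c1 w)" by (simp add: c1[OF w])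
    also have "\<dots> = m (b w)" using poD(5)[OF po2 w] by (simp add: b1[OF w])
    finally have "q = m (b w \<oplus>\<^bsub>Y\<^esub> y)" unfolding q using L2 l w y by (simp add: lin_add)
    moreover have "b w \<oplus>\<^bsub>Y\<^esub> y = \<zero>\<^bsub>Y\<^esub>"
      using z1 unfolding w_def xa using x' y' l by (simp add: lin_add[OF l(4)] comm)
    ultimately show "q = \<zero>\<^bsub>Q\<^esub>" using L2 by (simp add: lin_zero)
  qed
  then show ?thesis unfolding u(2) cofs_arr[OF p2(1) FM_cyl[OF A] u(1)] .
qed

text \<open>The universal property of the coproduct \<open>P\<close> provides \<open>r : P \<rightarrow> X\<close> and \<open>s : P \<rightarrow> Y\<close> with
  \<open>i r + j s = 1\<close>.  The image of \<open>p\<close> in \<open>Y \<oplus> I(X)\<close> is \<open>(f (r p) + s p, \<eta> (r p))\<close>, which determines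
  \<open>r p\<close> and then \<open>s p\<close>.\<close>

lemma coproduct_cylinder_mono:
  assumes \<alpha>: "\<alpha> \<in> Arr \<C>" and cop: "is_coproduct \<C> \<iota> \<kappa>" and D: "Dom \<C> \<iota> = Dom \<C> \<alpha>" "Dom \<C> \<kappa> = Cod \<C> \<alpha>"
    and \<upsilon>: "\<upsilon> \<in> Hom \<C> (Cod \<C> \<iota>) (Cyl cyl \<alpha>)" "\<upsilon> \<cdot>\<^bsub>\<C>\<^esub> \<iota> = j1 cyl \<alpha>" "\<upsilon> \<cdot>\<^bsub>\<C>\<^esub> \<kappa> = j2 cyl \<alpha>"
  shows "\<upsilon> \<in> cofs"
proof -
  from \<alpha> obtain X Y f where f: "X \<in> FM" "Y \<in> FM" "lin X Y f" "\<alpha> = arr X Y f" by (rule ArrE)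
  have lm [simp]: "lmod X" "lmod Y" using f lin_dom lin_cod by blast+
  note A = f(1) lm(1) f(2) lm(2)
  let ?T = "cyl_obj X Y"
  have "\<iota> \<in> Arr \<C>" "\<kappa> \<in> Arr \<C>" and cod: "Cod \<C> \<iota> = Cod \<C> \<kappa>" using cop by (simp_all add: is_coproduct_def)
  from this(1) obtain X1 P i where i: "P \<in> FM" "lin X1 P i" "\<iota> = arr X1 P i" by (rule ArrE)
  from \<open>\<kappa> \<in> Arr \<C>\<close> obtain Y1 P1 j where j: "lin Y1 P1 j" "\<kappa> = arr Y1 P1 j" by (rule ArrE)
  have t: "X1 = X" "Y1 = Y" "P1 = P" using D cod f i j by simp_all
  note i = i[unfolded t] and j = j[unfolded t]
  have [simp]: "lmod P" "lmod ?T" using i(2) lin_cod lmod_cyl[OF A] by blast+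
  have univ: "\<exists>!\<omega>. \<omega> \<in> Hom \<C> P W \<and> \<omega> \<cdot>\<^bsub>\<C>\<^esub> \<iota> = arr X W g \<and> \<omega> \<cdot>\<^bsub>\<C>\<^esub> \<kappa> = arr Y W h"
    if W: "W \<in> FM" and g: "lin X W g" and h: "lin Y W h" for W g h
  proof -
    have "W \<in> Obj \<C>" "arr X W g \<in> Hom \<C> (Dom \<C> \<iota>) W" "arr Y W h \<in> Hom \<C> (Dom \<C> \<kappa>) W"
      using W g h f i j lin_cod[OF g] by simp_all
    with cop have "\<exists>!\<omega>. \<omega> \<in> Hom \<C> (Cod \<C> \<iota>) W \<and> \<omega> \<cdot>\<^bsub>\<C>\<^esub> \<iota> = arr X W g \<and> \<omega> \<cdot>\<^bsub>\<C>\<^esub> \<kappa> = arr Y W h"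
      unfolding is_coproduct_def by blast
    then show ?thesis unfolding i(3) mc_simps .
  qed
  have univ': "\<exists>w. lin P W w \<and> (\<forall>x \<in> carrier X. w (i x) = g x) \<and> (\<forall>y \<in> carrier Y. w (j y) = h y)"
    if W: "W \<in> FM" "lin X W g" "lin Y W h" for W g h
  proof -
    obtain \<omega> where \<omega>: "\<omega> \<in> Hom \<C> P W" "\<omega> \<cdot>\<^bsub>\<C>\<^esub> \<iota> = arr X W g" "\<omega> \<cdot>\<^bsub>\<C>\<^esub> \<kappa> = arr Y W h"
      using univ[OF W] by blast
    from \<omega>(1) obtain w where "lin P W w" "\<omega> = arr P W w" by (rule HomE)
    with \<omega> i j show ?thesis by (intro exI[of _ w]) (simp add: arr_eq_iff)
  qed
  obtain r where r: "lin P X r" "\<And>x. x \<in> carrier X \<Longrightarrow> r (i x) = x" "\<And>y. y \<in> carrier Y \<Longrightarrow> r (j y) = \<zero>\<^bsub>X\<^esub>"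
    using univ'[OF f(1) lin_id lin_const_zero] by auto
  obtain s where s: "lin P Y s" "\<And>x. x \<in> carrier X \<Longrightarrow> s (i x) = \<zero>\<^bsub>Y\<^esub>" "\<And>y. y \<in> carrier Y \<Longrightarrow> s (j y) = y"
    using univ'[OF f(2) lin_const_zero lin_id] by auto
  let ?e = "\<lambda>p. i (r p) \<oplus>\<^bsub>P\<^esub> j (s p)"
  have e: "lin P P ?e" by (intro lin_sum lin_comp[OF r(1) i(2)] lin_comp[OF s(1) j(1)])
  have "arr P P ?e \<in> Hom \<C> P P \<and> arr P P ?e \<cdot>\<^bsub>\<C>\<^esub> \<iota> = arr X P i \<and> arr P P ?e \<cdot>\<^bsub>\<C>\<^esub> \<kappa> = arr Y P j"
    using e i j r s by (simp add: arr_eq_iff lin_zero[OF i(2)] lin_zero[OF j(1)])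
  moreover have "arr P P (\<lambda>p. p) \<in> Hom \<C> P P \<and> arr P P (\<lambda>p. p) \<cdot>\<^bsub>\<C>\<^esub> \<iota> = arr X P i \<and>
      arr P P (\<lambda>p. p) \<cdot>\<^bsub>\<C>\<^esub> \<kappa> = arr Y P j"
    using i j by (simp add: arr_eq_iff lin_id)
  ultimately have "arr P P ?e = arr P P (\<lambda>p. p)" using univ[OF i(1,2) j(1)] by blast
  then have dec: "i (r p) \<oplus>\<^bsub>P\<^esub> j (s p) = p" if "p \<in> carrier P" for p using that by (simp add: arr_eq_iff)
  have "\<upsilon> \<in> Hom \<C> P ?T" using \<upsilon>(1) i f by simp
  then obtain u where u: "lin P ?T u" "\<upsilon> = arr P ?T u" by (rule HomE)
  have ui: "u (i x) = front_incl X Y f x" if "x \<in> carrier X" for x using \<upsilon>(2) that u i f by (simp add: arr_eq_iff)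
  have uj: "u (j y) = back_incl X Y y" if "y \<in> carrier Y" for y using \<upsilon>(3) that u j f by (simp add: arr_eq_iff)
  have "inj_on u (carrier P)"
    unfolding inj_on_lin_iff[OF u(1)]
  proof (intro ballI impI)
    fix p assume p: "p \<in> carrier P" and 0: "u p = \<zero>\<^bsub>?T\<^esub>"
    have rs [simp]: "r p \<in> carrier X" "s p \<in> carrier Y" using p r(1) s(1) by simp_all
    have \<eta>in: "eta X (r p) \<in> carrier (coind X)" by (rule lin_in[OF lin_eta]) simp_all
    have "u p = u (i (r p) \<oplus>\<^bsub>P\<^esub> j (s p))" by (simp add: dec[OF p])
    also have "\<dots> = front_incl X Y f (r p) \<oplus>\<^bsub>?T\<^esub> back_incl X Y (s p)"
      using i j by (simp add: lin_add[OF u(1)] ui uj)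
    also have "\<dots> = cyl_iso X Y (f (r p) \<oplus>\<^bsub>Y\<^esub> s p, eta X (r p))"
      unfolding front_incl_def back_incl_def using lin_add[OF lin_cyl_iso[OF A], symmetric] \<eta>in f by simp
    finally have "cyl_iso X Y (f (r p) \<oplus>\<^bsub>Y\<^esub> s p, eta X (r p)) = cyl_iso X Y \<zero>\<^bsub>cyl_mod X Y\<^esub>"
      using 0 lin_zero[OF lin_cyl_iso[OF A]] by simp
    then have z1: "f (r p) \<oplus>\<^bsub>Y\<^esub> s p = \<zero>\<^bsub>Y\<^esub>" and z2: "eta X (r p) = \<zero>\<^bsub>coind X\<^esub>"
      using cyl_iso_eq_iff[OF A, of "(f (r p) \<oplus>\<^bsub>Y\<^esub> s p, eta X (r p))" "\<zero>\<^bsub>cyl_mod X Y\<^esub>"] \<eta>in f by simp_all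
    have r0: "r p = \<zero>\<^bsub>X\<^esub>" using fun_cong[OF z2, of "\<one>\<^bsub>R\<^esub>"] by simp
    then have "s p = \<zero>\<^bsub>Y\<^esub>" using z1 f by (simp add: lin_zero)
    then show "p = \<zero>\<^bsub>P\<^esub>" using dec[OF p] r0 i j by (simp add: lin_zero)
  qed
  then show ?thesis unfolding u(2) cofs_arr[OF i(1) FM_cyl[OF A] u(1)] .
qed

lemma cylinder: "cylinder_functor \<C> pt cofs weqs cyl"
proof (intro cylinder_functor.intro waldhausen cylinder_functor_axioms.intro)
  fix \<alpha> assume "\<alpha> \<in> Arr \<C>"
  then obtain X Y f where f: "X \<in> FM" "Y \<in> FM" "lin X Y f" "\<alpha> = arr X Y f" by (rule ArrE)
  have lm [simp]: "lmod X" "lmod Y" using f lin_dom lin_cod by blast+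
  note A = f(1) lm(1) f(2) lm(2)
  have \<eta>in: "eta X x \<in> carrier (coind X)" if "x \<in> carrier X" for x by (rule lin_in[OF lin_eta that]) simp
  show "Cyl cyl \<alpha> \<in> Obj \<C>" unfolding f(4) using FM_cyl[OF A] lmod_cyl[OF A] by simp
  show "j1 cyl \<alpha> \<in> Hom \<C> (Dom \<C> \<alpha>) (Cyl cyl \<alpha>)"
    unfolding f(4) cyl_arr mc_simps by (rule arr_Hom[OF f(1) FM_cyl[OF A] lin_front_incl[OF A f(3)]])
  show "j2 cyl \<alpha> \<in> Hom \<C> (Cod \<C> \<alpha>) (Cyl cyl \<alpha>)"
    unfolding f(4) cyl_arr mc_simps by (rule arr_Hom[OF f(2) FM_cyl[OF A] lin_back_incl[OF A]])
  show "pr cyl \<alpha> \<in> Hom \<C> (Cyl cyl \<alpha>) (Cod \<C> \<alpha>)"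
    unfolding f(4) cyl_arr mc_simps by (rule arr_Hom[OF FM_cyl[OF A] f(2) lin_cyl_proj[OF A]])
  show "pr cyl \<alpha> \<cdot>\<^bsub>\<C>\<^esub> j1 cyl \<alpha> = \<alpha>"
    unfolding f(4) cyl_arr comp_arr[OF lin_front_incl[OF A f(3)]]
    using f(3) \<eta>in by (simp add: arr_eq_iff front_incl_def cyl_proj_iso[OF A])
  show "pr cyl \<alpha> \<cdot>\<^bsub>\<C>\<^esub> j2 cyl \<alpha> = Id \<C> (Cod \<C> \<alpha>)"
    unfolding f(4) cyl_arr comp_arr[OF lin_back_incl[OF A]]
    by (simp add: arr_eq_iff back_incl_def cyl_proj_iso[OF A])
  have "cyl_fun X Y X Y (\<lambda>x. x) (\<lambda>x. x) t = t" if t: "t \<in> carrier (cyl_obj X Y)" for t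
  proof -
    obtain y \<phi> where y: "y \<in> carrier Y" "\<phi> \<in> carrier (coind X)" "t = cyl_iso X Y (y, \<phi>)"
      by (rule cyl_objE[OF A t])
    have "cmap (\<lambda>x. x) \<phi> = \<phi>"
      by (rule coind_eqI[of _ X]) (use y lin_in[OF lin_cmap[OF lin_id[OF lm(1)]] y(2)] in simp_all)
    then show ?thesis using y by (simp add: cyl_fun_iso[OF A])
  qed
  then show "Cyl_map cyl \<alpha> \<alpha> (Id \<C> (Dom \<C> \<alpha>)) (Id \<C> (Cod \<C> \<alpha>)) = Id \<C> (Cyl cyl \<alpha>)"
    unfolding f(4) cyl_arr mc_simps Cyl_map_arr[OF A] by (simp add: arr_eq_iff)
next
  fix \<alpha>' \<alpha> \<xi> \<eta> assume sq: "square \<C> \<alpha>' \<alpha> \<xi> \<eta>"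
  from sq obtain X' Y' X Y f' f a b where A': "X' \<in> FM" "lmod X'" "Y' \<in> FM" "lmod Y'"
    and A: "X \<in> FM" "lmod X" "Y \<in> FM" "lmod Y"
    and e: "\<alpha>' = arr X' Y' f'" "\<alpha> = arr X Y f" "\<xi> = arr X' X a" "\<eta> = arr Y' Y b"
    and l: "lin X' Y' f'" "lin X Y f" "lin X' X a" "lin Y' Y b"
    and comm: "\<And>x. x \<in> carrier X' \<Longrightarrow> f (a x) = b (f' x)"
    by (rule squareE) (rule that)
  have [simp]: "lmod X'" "lmod Y'" "lmod X" "lmod Y" by (fact A' A)+
  note L = lin_cyl_fun[OF A' A l(3,4)]
  have m: "Cyl_map cyl \<alpha>' \<alpha> \<xi> \<eta> = arr (cyl_obj X' Y') (cyl_obj X Y) (cyl_fun X' Y' X Y a b)"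
    unfolding e by (rule Cyl_map_arr[OF A'])
  have eta': "eta X' x \<in> carrier (coind X')" if "x \<in> carrier X'" for x by (rule lin_in[OF lin_eta that]) simp
  show "Cyl_map cyl \<alpha>' \<alpha> \<xi> \<eta> \<in> Hom \<C> (Cyl cyl \<alpha>') (Cyl cyl \<alpha>)"
    unfolding m unfolding e cyl_arr by (rule arr_Hom[OF FM_cyl[OF A'] FM_cyl[OF A] L])
  show "Cyl_map cyl \<alpha>' \<alpha> \<xi> \<eta> \<cdot>\<^bsub>\<C>\<^esub> j1 cyl \<alpha>' = j1 cyl \<alpha> \<cdot>\<^bsub>\<C>\<^esub> \<xi>"
    unfolding m unfolding e cyl_arr comp_arr[OF lin_front_incl[OF A' l(1)]] comp_arr[OF l(3)]
    using l eta' by (simp add: arr_eq_iff front_incl_def cyl_fun_iso[OF A'] cmap_eta comm)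
  show "Cyl_map cyl \<alpha>' \<alpha> \<xi> \<eta> \<cdot>\<^bsub>\<C>\<^esub> j2 cyl \<alpha>' = j2 cyl \<alpha> \<cdot>\<^bsub>\<C>\<^esub> \<eta>"
    unfolding m unfolding e cyl_arr comp_arr[OF lin_back_incl[OF A']] comp_arr[OF l(4)]
    by (simp add: arr_eq_iff back_incl_def cyl_fun_iso[OF A'] lin_zero[OF lin_cmap[OF l(3)]])
  have "cyl_proj X Y (cyl_fun X' Y' X Y a b t) = b (cyl_proj X' Y' t)" if t: "t \<in> carrier (cyl_obj X' Y')" for t
  proof -
    obtain y \<phi> where y: "y \<in> carrier Y'" "\<phi> \<in> carrier (coind X')" "t = cyl_iso X' Y' (y, \<phi>)"
      by (rule cyl_objE[OF A' t])
    then show ?thesis using l lin_in[OF lin_cmap[OF l(3)]]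
      by (simp add: cyl_fun_iso[OF A'] cyl_proj_iso[OF A'] cyl_proj_iso[OF A])
  qed
  then show "pr cyl \<alpha> \<cdot>\<^bsub>\<C>\<^esub> Cyl_map cyl \<alpha>' \<alpha> \<xi> \<eta> = \<eta> \<cdot>\<^bsub>\<C>\<^esub> pr cyl \<alpha>'"
    unfolding m unfolding e cyl_arr comp_arr[OF L] comp_arr[OF lin_cyl_proj[OF A']] by (simp add: arr_eq_iff)
  show "Cyl_map cyl \<alpha>' \<alpha> \<xi> \<eta> \<in> weqs" if weq: "\<eta> \<in> weqs"
  proof -
    from weq have "stable_eqv Y' Y b" unfolding e(4) weqs_arr[OF A'(3) A(3) l(4)] .
    then show ?thesis
      unfolding m by (intro arr_weqs FM_cyl A' A cyl_fun_stable_eqv l)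
  qed
  show "Cyl_map cyl \<alpha>' \<alpha> \<xi> \<eta> \<in> cofs" if cof: "\<xi> \<in> cofs" "\<eta> \<in> cofs"
  proof -
    from cof(1) have a: "inj_on a (carrier X')" unfolding e(3) cofs_arr[OF A'(1) A(1) l(3)] .
    from cof(2) have b: "inj_on b (carrier Y')" unfolding e(4) cofs_arr[OF A'(3) A(3) l(4)] .
    show ?thesis
      unfolding m cofs_arr[OF FM_cyl[OF A'] FM_cyl[OF A] L] by (rule cyl_fun_inj[OF A' A l(3) a l(4) b])
  qed
next
  fix \<alpha>'' \<alpha>' \<xi>' \<eta>' \<alpha> \<xi> \<eta> assume sq': "square \<C> \<alpha>'' \<alpha>' \<xi>' \<eta>'" and sq: "square \<C> \<alpha>' \<alpha> \<xi> \<eta>"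
  from sq' obtain X2 Y2 X1 Y1 f2 f1 a' b' where A2: "X2 \<in> FM" "lmod X2" "Y2 \<in> FM" "lmod Y2"
    and A1: "X1 \<in> FM" "lmod X1" "Y1 \<in> FM" "lmod Y1"
    and e': "\<alpha>'' = arr X2 Y2 f2" "\<alpha>' = arr X1 Y1 f1" "\<xi>' = arr X2 X1 a'" "\<eta>' = arr Y2 Y1 b'"
    and l': "lin X2 Y2 f2" "lin X1 Y1 f1" "lin X2 X1 a'" "lin Y2 Y1 b'"
    by (rule squareE) (rule that)
  from sq obtain X' Y' X Y f' f a b where A: "X \<in> FM" "lmod X" "Y \<in> FM" "lmod Y"
    and e0: "\<alpha>' = arr X' Y' f'" "\<alpha> = arr X Y f" "\<xi> = arr X' X a" "\<eta> = arr Y' Y b"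
    and l0: "lin X' X a" "lin Y' Y b"
    by (rule squareE) (rule that)
  have t: "X' = X1" "Y' = Y1" using e' e0 by (simp_all add: arr_eq_iff)
  note e = e0[unfolded t] and l = l0[unfolded t]
  have "cyl_fun X2 Y2 X Y (\<lambda>x. a (a' x)) (\<lambda>y. b (b' y)) t = cyl_fun X1 Y1 X Y a b (cyl_fun X2 Y2 X1 Y1 a' b' t)"
    if t: "t \<in> carrier (cyl_obj X2 Y2)" for t
  proof -
    obtain y \<phi> where y: "y \<in> carrier Y2" "\<phi> \<in> carrier (coind X2)" "t = cyl_iso X2 Y2 (y, \<phi>)"
      by (rule cyl_objE[OF A2 t])
    moreover have "cmap (\<lambda>x. a (a' x)) \<phi> = cmap a (cmap a' \<phi>)" by (simp add: cmap_def restrict_def fun_eq_iff)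
    ultimately show ?thesis using l' lin_in[OF lin_cmap[OF l'(3)]]
      by (simp add: cyl_fun_iso[OF A2] cyl_fun_iso[OF A1])
  qed
  moreover have "Cyl_map cyl \<alpha>'' \<alpha> (\<xi> \<cdot>\<^bsub>\<C>\<^esub> \<xi>') (\<eta> \<cdot>\<^bsub>\<C>\<^esub> \<eta>') =
      arr (cyl_obj X2 Y2) (cyl_obj X Y) (cyl_fun X2 Y2 X Y (\<lambda>x. a (a' x)) (\<lambda>y. b (b' y)))"
    unfolding e'(1,3,4) e(2-4) comp_arr[OF l'(3)] comp_arr[OF l'(4)] by (rule Cyl_map_arr[OF A2])
  moreover have "Cyl_map cyl \<alpha>' \<alpha> \<xi> \<eta> = arr (cyl_obj X1 Y1) (cyl_obj X Y) (cyl_fun X1 Y1 X Y a b)"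
    unfolding e'(2) e(2-4) by (rule Cyl_map_arr[OF A1])
  moreover have "Cyl_map cyl \<alpha>'' \<alpha>' \<xi>' \<eta>' = arr (cyl_obj X2 Y2) (cyl_obj X1 Y1) (cyl_fun X2 Y2 X1 Y1 a' b')"
    unfolding e' by (rule Cyl_map_arr[OF A2])
  ultimately show "Cyl_map cyl \<alpha>'' \<alpha> (\<xi> \<cdot>\<^bsub>\<C>\<^esub> \<xi>') (\<eta> \<cdot>\<^bsub>\<C>\<^esub> \<eta>') =
      Cyl_map cyl \<alpha>' \<alpha> \<xi> \<eta> \<cdot>\<^bsub>\<C>\<^esub> Cyl_map cyl \<alpha>'' \<alpha>' \<xi>' \<eta>'"
    using lin_cyl_fun[OF A2 A1 l'(3,4)] by (simp add: arr_eq_iff)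
next
  fix Y \<alpha> assume "Y \<in> Obj \<C>" "\<alpha> \<in> Hom \<C> pt Y"
  then obtain f where Y: "Y \<in> FM" "lmod Y" and f: "\<alpha> = arr pt Y f" by (auto elim: HomE)
  have obj: "cyl_obj pt Y = Y" by (simp add: cyl_obj_def)
  have "cyl_proj pt Y y = y" if y: "y \<in> carrier Y" for y
    using cyl_proj_iso[OF pt_FM lmod_zero_mod Y y, of "\<zero>\<^bsub>coind pt\<^esub>"] by (simp add: cyl_iso_def)
  moreover have "back_incl pt Y y = y" for y by (simp add: back_incl_def cyl_iso_def)
  ultimately show "Cyl cyl \<alpha> = Y \<and> pr cyl \<alpha> = Id \<C> Y \<and> j2 cyl \<alpha> = Id \<C> Y"
    unfolding f by (simp add: obj arr_eq_iff)
qed (fact pushout_cylinder_mono, fact coproduct_cylinder_mono)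

lemma cylinder_weq: "cylinder_axiom \<C> weqs cyl"
  unfolding cylinder_axiom_def
proof
  fix \<alpha> assume "\<alpha> \<in> Arr \<C>"
  then obtain X Y f where f: "X \<in> FM" "Y \<in> FM" "lin X Y f" "\<alpha> = arr X Y f" by (rule ArrE)
  have lm: "lmod X" "lmod Y" using f lin_dom lin_cod by blast+
  note A = f(1) lm(1) f(2) lm(2)
  have "stable_eqv (cyl_obj X Y) Y (cyl_proj X Y)"
    using stable_eqv_comp[OF stable_eqv_iso[OF lin_cyl_inv[OF A] bij_cyl_inv[OF A]] stable_eqv_fst[OF lm(2) inj_mod_coind[OF lm(1)]]]
    by (simp add: cyl_proj_def[abs_def])
  then show "pr cyl \<alpha> \<in> weqs" unfolding f(4) cyl_arr by (rule arr_weqs[OF FM_cyl[OF A] f(2)])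
qed

end

section \<open>Finite-dimensional algebras over a finite field\<close>

lemma (in associative_algebra) finite_of_finitely_generated:
  assumes "finite (carrier K)" "finitely_generated K R"
  shows "finite (carrier R)"
proof -
  have "left_module K R"
    by unfold_locales (auto simp: smult_l_distr smult_r_distr smult_assoc1)
  from finitely_generated_imp_finite[OF this assms] show ?thesis .
qed

lemma (in associative_algebra) ring_over_scalars:
  assumes "field K"
  shows "ring_over_division_subring R ((\<lambda>c. c \<odot>\<^bsub>R\<^esub> \<one>\<^bsub>R\<^esub>) ` carrier K)"
proof -
  interpret K: field K by (rule assms)
  have mult: "c \<odot>\<^bsub>R\<^esub> \<one>\<^bsub>R\<^esub> \<otimes>\<^bsub>R\<^esub> x = c \<odot>\<^bsub>R\<^esub> x" if "c \<in> carrier K" "x \<in> carrier R" for c x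
    using that by (simp add: smult_mult_left)
  have cl: "c \<odot>\<^bsub>R\<^esub> \<one>\<^bsub>R\<^esub> \<in> carrier R" if "c \<in> carrier K" for c using that by simp
  show ?thesis
  proof (unfold_locales, safe)
    fix c assume "c \<in> carrier K" then show "c \<odot>\<^bsub>R\<^esub> \<one>\<^bsub>R\<^esub> \<in> carrier R" by (rule cl)
  next
    show "\<one>\<^bsub>R\<^esub> \<in> (\<lambda>c. c \<odot>\<^bsub>R\<^esub> \<one>\<^bsub>R\<^esub>) ` carrier K" by (rule image_eqI[of _ _ "\<one>\<^bsub>K\<^esub>"]) simp_all
  next
    fix c d assume "c \<in> carrier K" "d \<in> carrier K"
    then show "c \<odot>\<^bsub>R\<^esub> \<one>\<^bsub>R\<^esub> \<otimes>\<^bsub>R\<^esub> (d \<odot>\<^bsub>R\<^esub> \<one>\<^bsub>R\<^esub>) \<in> (\<lambda>c. c \<odot>\<^bsub>R\<^esub> \<one>\<^bsub>R\<^esub>) ` carrier K"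
      by (intro image_eqI[of _ _ "c \<otimes>\<^bsub>K\<^esub> d"]) (simp_all add: mult smult_assoc1)
  next
    fix c d assume "c \<in> carrier K" "d \<in> carrier K"
    then show "c \<odot>\<^bsub>R\<^esub> \<one>\<^bsub>R\<^esub> \<oplus>\<^bsub>R\<^esub> d \<odot>\<^bsub>R\<^esub> \<one>\<^bsub>R\<^esub> \<in> (\<lambda>c. c \<odot>\<^bsub>R\<^esub> \<one>\<^bsub>R\<^esub>) ` carrier K"
      by (intro image_eqI[of _ _ "c \<oplus>\<^bsub>K\<^esub> d"]) (simp_all add: smult_l_distr)
  next
    fix c assume "c \<in> carrier K"
    then show "\<ominus>\<^bsub>R\<^esub> (c \<odot>\<^bsub>R\<^esub> \<one>\<^bsub>R\<^esub>) \<in> (\<lambda>c. c \<odot>\<^bsub>R\<^esub> \<one>\<^bsub>R\<^esub>) ` carrier K"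
      by (intro image_eqI[of _ _ "\<ominus>\<^bsub>K\<^esub> c"]) (simp_all add: smult_l_minus)
  next
    fix c assume c: "c \<in> carrier K" "c \<odot>\<^bsub>R\<^esub> \<one>\<^bsub>R\<^esub> \<noteq> \<zero>\<^bsub>R\<^esub>"
    have "\<zero>\<^bsub>K\<^esub> \<odot>\<^bsub>R\<^esub> \<one>\<^bsub>R\<^esub> = \<zero>\<^bsub>R\<^esub>" by (simp add: smult_l_null)
    with c have "c \<noteq> \<zero>\<^bsub>K\<^esub>" by auto
    with c have u: "c \<in> Units K" by (simp add: K.field_Units)
    then have "inv\<^bsub>K\<^esub> c \<in> carrier K" "inv\<^bsub>K\<^esub> c \<otimes>\<^bsub>K\<^esub> c = \<one>\<^bsub>K\<^esub>" by simp_all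
    then have "inv\<^bsub>K\<^esub> c \<odot>\<^bsub>R\<^esub> \<one>\<^bsub>R\<^esub> \<otimes>\<^bsub>R\<^esub> (c \<odot>\<^bsub>R\<^esub> \<one>\<^bsub>R\<^esub>) = \<one>\<^bsub>R\<^esub>"
      using c by (simp add: mult flip: smult_assoc1)
    then show "\<exists>d \<in> (\<lambda>c. c \<odot>\<^bsub>R\<^esub> \<one>\<^bsub>R\<^esub>) ` carrier K. d \<otimes>\<^bsub>R\<^esub> (c \<odot>\<^bsub>R\<^esub> \<one>\<^bsub>R\<^esub>) = \<one>\<^bsub>R\<^esub>"
      using \<open>inv\<^bsub>K\<^esub> c \<in> carrier K\<close> by blast
  qed
qed

theorem corollary3p13:
  fixes K :: "('k, 'b) ring_scheme"
    and R :: "('k, 'r, 'c) module_scheme"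
    and C :: "('r, 'm) module_category"
  assumes "infinite (UNIV :: 'm set)"
    and "field K" and "finite (carrier K)"
    and "associative_algebra K R"
    and "finitely_generated K R"
    and "quasi_frobenius TYPE('m) R"
  defines "C \<equiv> fg_modules R"
  defines "cof \<equiv> {f \<in> Arr C. monic C f}"
    and "weq \<equiv> {f \<in> Arr C. stable_equivalence R f}"
  shows "\<exists>pt. waldhausen_category C pt cof weq \<and>
           saturation_axiom C weq \<and>
           extension_axiom C pt cof weq \<and>
           (\<exists>T. cylinder_functor C pt cof weq T \<and> cylinder_axiom C weq T)"
proof -
  let ?F = "(\<lambda>c. c \<odot>\<^bsub>R\<^esub> \<one>\<^bsub>R\<^esub>) ` carrier K"
  interpret A: associative_algebra K R by fact
  interpret ring_over_division_subring R ?F by (rule A.ring_over_scalars) fact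
  interpret U: finite_ring_universe R ?F "TYPE('m)"
    by unfold_locales (fact, rule A.finite_of_finitely_generated, fact+)
  interpret finite_frobenius R ?F "TYPE('m)"
    by (rule U.quasi_frobenius_imp_finite_frobenius) fact
  show ?thesis
    unfolding cof_def weq_def C_def fg_modules_def
    using waldhausen saturation extension cylinder cylinder_weq by blast
qed
end
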